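(* Let $F$ be Thompson's group $F$ and let $\pi_{ab}\colon F\to\mathbb{Z}^2$ be its standard abelianization map. Let $f\in F$ be such that $\pi_{ab}(f)$ is part of a generating pair of $\mathbb{Z}^2$ (i.e. there is $y\in\mathbb{Z}^2$ such that $\pi_{ab}(f)$ and $y$ generate $\mathbb{Z}^2$). Then $f$ is part of a generating pair of $F$, i.e. there is an element $g\in F$ such that $\langle f,g\rangle=F$.
   Context: Thompson's group $F$ is the group (under composition) of all piecewise-linear homeomorphisms of the interval $[0,1]$ with finitely many breakpoints, where all breakpoints are dyadic fractions (numbers in $\mathbb{Z}[\frac12]\cap(0,1)$) and all slopes are integer powers of $2$. (In particular its elements fix $0$ and $1$.) The standard abelianization map $\pi_{ab}\colon F\to\mathbb{Z}^2$ is the surjective homomorphism $\pi_{ab}(f)=(\log_2 f'(0^+),\log_2 f'(1^-))$, whose kernel is the derived subgroup $[F,F]$. *)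

theory Defs
  imports "HOL-Analysis.Analysis" "HOL-Algebra.Algebra"
begin

definition dyadic :: "real set" where
  "dyadic = {of_int m / 2 ^ n | (m :: int) (n :: nat). True}"

text \<open>\<open>B\<close> is a finite set of dyadic points containing all breakpoints of \<open>f\<close>: on every closed
  subinterval of \<open>[0,1]\<close> with no point of \<open>B\<close> in its interior, \<open>f\<close> is affine with slope a power
  of \<open>2\<close>. Points of \<open>B\<close> at which the slope does not change are harmless.\<close>

definition PL_breaks :: "(real \<Rightarrow> real) \<Rightarrow> real set \<Rightarrow> bool" where
  "PL_breaks f B \<longleftrightarrow> finite B \<and> B \<subseteq> dyadic \<inter> {0<..<1} \<and>
     (\<forall>a b. 0 \<le> a \<and> a < b \<and> b \<le> 1 \<and> {a<..<b} \<inter> B = {} \<longrightarrow>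
        (\<exists>(k :: int) c. \<forall>x\<in>{a..b}. f x = 2 powi k * x + c))"

definition thompson_PL :: "(real \<Rightarrow> real) \<Rightarrow> bool" where
  "thompson_PL f \<longleftrightarrow> (\<exists>B. PL_breaks f B)"

text \<open>As in \<^const>\<open>BijGroup\<close>, elements are represented by functions that are \<^const>\<open>undefined\<close>
  outside the unit interval, and the product \<open>g \<otimes> f\<close> is \<open>g \<circ> f\<close>.\<close>

definition thompson_F :: "(real \<Rightarrow> real) monoid" where
  "thompson_F = (BijGroup {0..1})
     \<lparr>carrier := {f \<in> Bij {0..1}. (\<exists>g. homeomorphism {0..1} {0..1} f g) \<and> thompson_PL f}\<rparr>"

abbreviation Z2 :: "(int \<times> int) monoid" where
  "Z2 \<equiv> integer_group \<times>\<times> integer_group"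

text \<open>The floor only serves as the conversion from \<^typ>\<open>real\<close> to \<^typ>\<open>int\<close>: the logarithms are
  integers on \<^const>\<open>thompson_F\<close>, see \<open>pi_ab_exact\<close> below.\<close>

definition pi_ab :: "(real \<Rightarrow> real) \<Rightarrow> int \<times> int" where
  "pi_ab f = (\<lfloor>log 2 (vector_derivative f (at_right 0))\<rfloor>, \<lfloor>log 2 (vector_derivative f (at_left 1))\<rfloor>)"

lemma dyadic_0 [simp]: "0 \<in> dyadic"
  unfolding dyadic_def by (auto intro!: exI[of _ 0])

lemma dyadic_uminus: "x \<in> dyadic \<Longrightarrow> - x \<in> dyadic"
  unfolding dyadic_def by clarsimp (metis minus_divide_left of_int_minus)

lemma dyadic_add: "x \<in> dyadic \<Longrightarrow> y \<in> dyadic \<Longrightarrow> x + y \<in> dyadic"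
proof -
  assume "x \<in> dyadic" "y \<in> dyadic"
  then obtain m n m' n' where "x = of_int m / 2 ^ n" "y = of_int m' / 2 ^ n'"
    unfolding dyadic_def by blast
  then have "x + y = of_int (m * 2 ^ n' + m' * 2 ^ n) / 2 ^ (n + n')"
    by (simp add: add_divide_distrib power_add)
  then show ?thesis unfolding dyadic_def by blast
qed

lemma dyadic_diff: "x \<in> dyadic \<Longrightarrow> y \<in> dyadic \<Longrightarrow> x - y \<in> dyadic"
  using dyadic_add[of x "- y"] dyadic_uminus by simp

lemma dyadic_scale: "x \<in> dyadic \<Longrightarrow> 2 powi k * x \<in> dyadic"
proof -
  assume "x \<in> dyadic"
  then obtain m n where x: "x = of_int m / 2 ^ n"
    unfolding dyadic_def by blast
  show ?thesis
  proof (cases "k \<ge> 0")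
    case True
    then have "2 powi k * x = of_int (m * 2 ^ nat k) / 2 ^ n"
      by (simp add: x power_int_def)
    then show ?thesis unfolding dyadic_def by blast
  next
    case False
    then have "2 powi k * x = of_int m / 2 ^ (nat (- k) + n)"
      by (simp add: x power_int_def power_add field_simps)
    then show ?thesis unfolding dyadic_def by blast
  qed
qed

lemma dyadic_scale_iff: "2 powi k * x \<in> dyadic \<longleftrightarrow> x \<in> dyadic"
proof
  assume "2 powi k * x \<in> dyadic"
  then have "2 powi (- k) * (2 powi k * x) \<in> dyadic" by (rule dyadic_scale)
  moreover have "2 powi (- k) * (2 powi k * x) = x"
    by (simp add: power_int_minus)
  ultimately show "x \<in> dyadic" by simp
qed (rule dyadic_scale)

lemma PL_breaks_affine:
  assumes "PL_breaks f B" "0 \<le> a" "a < b" "b \<le> 1" "{a<..<b} \<inter> B = {}"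
  obtains k :: int and c where "\<And>x. x \<in> {a..b} \<Longrightarrow> f x = 2 powi k * x + c"
  using assms unfolding PL_breaks_def by blast

lemma PL_breaks_less:
  assumes "PL_breaks f B" "0 \<le> x" "x < y" "y \<le> 1"
  shows "f x < f y"
  using assms(2-)
proof (induction "card ({x<..<y} \<inter> B)" arbitrary: x y rule: less_induct)
  case less
  have fin: "finite B" using assms(1) by (simp add: PL_breaks_def)
  show ?case
  proof (cases "{x<..<y} \<inter> B = {}")
    case True
    obtain k :: int and c where "\<And>z. z \<in> {x..y} \<Longrightarrow> f z = 2 powi k * z + c"
      using PL_breaks_affine[OF assms(1) less.prems True] by metis
    then show ?thesis using less.prems by simp
  next
    case False
    then obtain b where b: "b \<in> {x<..<y} \<inter> B" by blast
    then have "{x<..<b} \<inter> B \<subset> {x<..<y} \<inter> B" "{b<..<y} \<inter> B \<subset> {x<..<y} \<inter> B"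
      by auto
    then have "card ({x<..<b} \<inter> B) < card ({x<..<y} \<inter> B)"
      "card ({b<..<y} \<inter> B) < card ({x<..<y} \<inter> B)"
      using fin by (simp_all add: psubset_card_mono)
    then have "f x < f b" "f b < f y"
      using less.hyps b less.prems by auto
    then show ?thesis by simp
  qed
qed

lemma PL_breaks_dyadic_iff:
  assumes "PL_breaks f B" "f 0 = 0" "0 \<le> x" "x \<le> 1"
  shows "f x \<in> dyadic \<longleftrightarrow> x \<in> dyadic"
  using assms(3-)
proof (induction "card ({0<..<x} \<inter> B)" arbitrary: x rule: less_induct)
  case less
  have fin: "finite B" and sub: "B \<subseteq> dyadic \<inter> {0<..<1}"
    using assms(1) by (simp_all add: PL_breaks_def)
  show ?case
  proof (cases "x = 0")
    case True
    then show ?thesis using assms(2) by simp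
  next
    case False
    define b where "b = Max (insert 0 ({0<..<x} \<inter> B))"
    have b_in: "b \<in> insert 0 ({0<..<x} \<inter> B)"
      unfolding b_def using fin by (intro Max_in) auto
    have b_max: "\<And>z. z \<in> {0<..<x} \<inter> B \<Longrightarrow> z \<le> b"
      unfolding b_def using fin by (intro Max_ge) auto
    have bx: "0 \<le> b" "b < x" "b \<in> dyadic"
      using b_in False less.prems sub by auto
    have emp: "{b<..<x} \<inter> B = {}"
    proof -
      have False if "z \<in> {b<..<x}" "z \<in> B" for z
        using b_max[of z] bx(1) that by simp
      then show ?thesis by blast
    qed
    obtain k :: int and c where k: "\<And>z. z \<in> {b..x} \<Longrightarrow> f z = 2 powi k * z + c"
      using PL_breaks_affine[OF assms(1) bx(1,2) less.prems(2) emp] by metis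
    have fb: "f b \<in> dyadic"
    proof (cases "b = 0")
      case True
      then show ?thesis using assms(2) by simp
    next
      case False
      then have "{0<..<b} \<inter> B \<subset> {0<..<x} \<inter> B" using b_in by auto
      then have "card ({0<..<b} \<inter> B) < card ({0<..<x} \<inter> B)"
        using fin by (simp add: psubset_card_mono)
      then show ?thesis using less.hyps[of b] bx less.prems by simp
    qed
    have "f x - f b = 2 powi k * (x - b)" using k bx by (simp add: algebra_simps)
    then have 1: "f x - f b \<in> dyadic \<longleftrightarrow> x - b \<in> dyadic"
      using dyadic_scale_iff by simp
    have 2: "f x - f b \<in> dyadic \<longleftrightarrow> f x \<in> dyadic"
      using fb dyadic_add[of "f x - f b" "f b"] dyadic_diff by auto
    have 3: "x - b \<in> dyadic \<longleftrightarrow> x \<in> dyadic"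
      using bx dyadic_add[of "x - b" b] dyadic_diff by auto
    show ?thesis using 1 2 3 by simp
  qed
qed

lemma thompson_F_iff:
  "f \<in> carrier thompson_F \<longleftrightarrow>
     f \<in> Bij {0..1} \<and> (\<exists>g. homeomorphism {0..1} {0..1} f g) \<and> thompson_PL f"
  by (simp add: thompson_F_def)

lemma Bij_PL_breaks:
  assumes "f \<in> Bij {0..1}" "PL_breaks f B"
  shows "f 0 = 0" "f 1 = 1"
    and "\<And>x. x \<in> {0..1} \<Longrightarrow> f x \<in> {0..1}"
    and "\<And>x y. x \<in> {0..1} \<Longrightarrow> y \<in> {0..1} \<Longrightarrow> f x < f y \<longleftrightarrow> x < y"
    and "\<And>x. x \<in> {0..1} \<Longrightarrow> f x \<in> dyadic \<longleftrightarrow> x \<in> dyadic"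
proof -
  have im: "f ` {0..1} = {0..1}"
    using assms(1) by (simp add: Bij_def bij_betw_def)
  show rng: "f x \<in> {0..1}" if "x \<in> {0..1}" for x using im that by blast
  show lt: "f x < f y \<longleftrightarrow> x < y" if "x \<in> {0..1}" "y \<in> {0..1}" for x y
    using PL_breaks_less[OF assms(2), of x y] PL_breaks_less[OF assms(2), of y x] that
    by (cases x y rule: linorder_cases) auto
  have z: "(0::real) \<in> f ` {0..1}" and o: "(1::real) \<in> f ` {0..1}" using im by auto
  obtain z where z: "z \<in> {0..1}" "f z = 0" using z by auto
  have "\<not> f 0 < 0" "\<not> f z < f 0" using lt[of z 0] rng[of 0] z by auto
  then show f0: "f 0 = 0" using z by simp
  obtain w where w: "w \<in> {0..1}" "f w = 1" using o by auto
  have "\<not> f 1 > 1" "\<not> f w > f 1" using lt[of 1 w] rng[of 1] w by auto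
  then show "f 1 = 1" using w by simp
  show "f x \<in> dyadic \<longleftrightarrow> x \<in> dyadic" if "x \<in> {0..1}" for x
    using PL_breaks_dyadic_iff[OF assms(2) f0] that by simp
qed

lemma thompson_PL_compose:
  assumes "f \<in> Bij {0..1}" "g \<in> Bij {0..1}" "thompson_PL f" "thompson_PL g"
  shows "thompson_PL (compose {0..1} g f)"
proof -
  obtain B C where B: "PL_breaks f B" and C: "PL_breaks g C"
    using assms(3,4) by (auto simp: thompson_PL_def)
  note f = Bij_PL_breaks[OF assms(1) B]
  have inj: "inj_on f {0..1}" using assms(1) by (simp add: Bij_def bij_betw_def)
  define D where "D = B \<union> {x \<in> {0<..<1}. f x \<in> C}"
  have finB: "finite B" "B \<subseteq> dyadic \<inter> {0<..<1}" using B by (simp_all add: PL_breaks_def)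
  have finC: "finite C" "C \<subseteq> dyadic \<inter> {0<..<1}" using C by (simp_all add: PL_breaks_def)
  have "finite (f -` C \<inter> {0..1})" using finC(1) inj by (rule finite_vimage_IntI)
  then have "finite {x \<in> {0<..<1}. f x \<in> C}"
    by (rule rev_finite_subset) auto
  then have "finite D" using finB D_def by simp
  moreover have "D \<subseteq> dyadic \<inter> {0<..<1}"
  proof
    fix x assume x: "x \<in> D"
    show "x \<in> dyadic \<inter> {0<..<1}"
    proof (cases "x \<in> B")
      case True
      then show ?thesis using finB(2) by blast
    next
      case False
      then have "x \<in> {0<..<1}" "f x \<in> dyadic" using x finC(2) by (auto simp: D_def)
      then show ?thesis using f(5)[of x] by simp
    qed
  qed
  moreover have "\<exists>(k :: int) c. \<forall>x\<in>{a..b}. compose {0..1} g f x = 2 powi k * x + c"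
    if ab: "0 \<le> a" "a < b" "b \<le> 1" "{a<..<b} \<inter> D = {}" for a b
  proof -
    obtain k :: int and c where k: "\<And>x. x \<in> {a..b} \<Longrightarrow> f x = 2 powi k * x + c"
      using PL_breaks_affine[OF B ab(1-3)] ab(4) D_def by (metis Int_Un_distrib Un_empty)
    have fa: "0 \<le> f a" "f a < f b" "f b \<le> 1"
      using f(3)[of a] f(3)[of b] f(4)[of a b] ab by auto
    have "{f a<..<f b} \<inter> C = {}"
    proof -
      have False if "y \<in> {f a<..<f b}" "y \<in> C" for y
      proof -
        have "y \<in> f ` {0..1}"
          using assms(1) that fa by (auto simp: Bij_def bij_betw_def)
        then obtain x where x: "x \<in> {0..1}" "y = f x" by blast
        then have "a < x" "x < b" using f(4)[of a x] f(4)[of x b] ab that by auto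
        then show False using x that ab unfolding D_def by auto
      qed
      then show ?thesis by blast
    qed
    then obtain l :: int and d where l: "\<And>y. y \<in> {f a..f b} \<Longrightarrow> g y = 2 powi l * y + d"
      using PL_breaks_affine[OF C fa] by metis
    have "compose {0..1} g f x = 2 powi (l + k) * x + (2 powi l * c + d)" if "x \<in> {a..b}" for x
    proof -
      have x: "x \<in> {0..1}" using that ab by auto
      have "f x \<in> {f a..f b}"
        using that ab x f(4)[of x a] f(4)[of b x] by auto
      then show ?thesis using x k[OF that] l[of "f x"]
        by (simp add: compose_eq power_int_add algebra_simps)
    qed
    then show ?thesis by blast
  qed
  ultimately have "PL_breaks (compose {0..1} g f) D" by (simp add: PL_breaks_def)
  then show ?thesis by (auto simp: thompson_PL_def)
qed

lemma thompson_PL_inverse: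
  assumes "f \<in> Bij {0..1}" "thompson_PL f"
  shows "thompson_PL (\<lambda>x\<in>{0..1}. inv_into {0..1} f x)" (is "thompson_PL ?g")
proof -
  obtain B where B: "PL_breaks f B" using assms(2) by (auto simp: thompson_PL_def)
  note f = Bij_PL_breaks[OF assms(1) B]
  have bij: "inj_on f {0..1}" "f ` {0..1} = {0..1}"
    using assms(1) by (simp_all add: Bij_def bij_betw_def)
  have gf: "?g (f x) = x" if "x \<in> {0..1}" for x
    using that f(3)[of x] bij(1) by simp
  have finB: "finite B" "B \<subseteq> dyadic \<inter> {0<..<1}" using B by (simp_all add: PL_breaks_def)
  have "f ` B \<subseteq> dyadic \<inter> {0<..<1}"
  proof
    fix y assume "y \<in> f ` B"
    then obtain x where x: "x \<in> B" "y = f x" by blast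
    then have "x \<in> {0<..<1}" "x \<in> dyadic" using finB(2) by auto
    then show "y \<in> dyadic \<inter> {0<..<1}"
      using f(4)[of 0 x] f(4)[of x 1] f(5)[of x] f(1,2) x by simp
  qed
  moreover have "\<exists>(k :: int) c. \<forall>y\<in>{u..v}. ?g y = 2 powi k * y + c"
    if uv: "0 \<le> u" "u < v" "v \<le> 1" "{u<..<v} \<inter> f ` B = {}" for u v
  proof -
    have "u \<in> f ` {0..1}" "v \<in> f ` {0..1}" using uv bij by auto
    then obtain a b where a: "a \<in> {0..1}" "u = f a" and b: "b \<in> {0..1}" "v = f b" by blast
    have ab: "0 \<le> a" "a < b" "b \<le> 1" using a b f(4)[of a b] uv by auto
    have "{a<..<b} \<inter> B = {}"
    proof -
      have False if "x \<in> {a<..<b}" "x \<in> B" for x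
        using that uv(4) f(4)[of a x] f(4)[of x b] a b by auto
      then show ?thesis by blast
    qed
    then obtain k :: int and c where k: "\<And>x. x \<in> {a..b} \<Longrightarrow> f x = 2 powi k * x + c"
      using PL_breaks_affine[OF B ab] by metis
    have "?g y = 2 powi (- k) * y + (- (2 powi (- k) * c))" if "y \<in> {u..v}" for y
    proof -
      have "y \<in> f ` {0..1}" using that uv bij by auto
      then obtain x where x: "x \<in> {0..1}" "y = f x" by blast
      then have "x \<in> {a..b}" using that a b f(4)[of x a] f(4)[of b x] by auto
      then have "y = 2 powi k * x + c" using k x by simp
      then have "2 powi (- k) * y + (- (2 powi (- k) * c)) = x"
        by (simp add: power_int_minus field_simps)
      then show ?thesis using gf[OF x(1)] x(2) by simp
    qed
    then show ?thesis by blast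
  qed
  ultimately have "PL_breaks ?g (f ` B)" using finB by (simp add: PL_breaks_def)
  then show ?thesis by (auto simp: thompson_PL_def)
qed

lemma homeomorphism_ext:
  assumes "homeomorphism S T f g" "\<And>x. x \<in> S \<Longrightarrow> f' x = f x"
  shows "homeomorphism S T f' g"
  using homeomorphism_cong[OF assms(1) refl refl, of f' g] assms(2) by simp

lemma subgroup_thompson_F: "subgroup (carrier thompson_F) (BijGroup {0..1})"
proof (rule group.subgroupI[OF group_BijGroup])
  show "carrier thompson_F \<subseteq> carrier (BijGroup {0..1})"
    by (auto simp: thompson_F_iff BijGroup_def)
  have "homeomorphism {0..1::real} {0..1} (\<lambda>x\<in>{0..1}. x) id"
    by (rule homeomorphism_ext[OF homeomorphism_ident[of "{0..1}", folded id_def]]) simp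
  moreover have "PL_breaks (\<lambda>x\<in>{0..1}. x) {}"
    unfolding PL_breaks_def by (auto intro!: exI[of _ "0::int"] exI[of _ "0::real"])
  ultimately have "(\<lambda>x\<in>{0..1}. x) \<in> carrier thompson_F"
    unfolding thompson_F_iff thompson_PL_def using id_Bij by blast
  then show "carrier thompson_F \<noteq> {}" by blast
next
  fix f assume f: "f \<in> carrier thompson_F"
  then have B: "f \<in> Bij {0..1}" by (simp add: thompson_F_iff)
  obtain g where g: "homeomorphism {0..1} {0..1} f g" using f by (auto simp: thompson_F_iff)
  have inj: "inj_on f {0..1}" using B by (simp add: Bij_def bij_betw_def)
  have eq: "(\<lambda>x\<in>{0..1}. inv_into {0..1} f x) x = g x" if "x \<in> {0..1}" for x
  proof -
    have "g x \<in> {0..1}" "f (g x) = x" using g that by (auto simp: homeomorphism_def)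
    then show ?thesis using inv_into_f_f[OF inj, of "g x"] that by simp
  qed
  have "homeomorphism {0..1} {0..1} (\<lambda>x\<in>{0..1}. inv_into {0..1} f x) f"
    by (rule homeomorphism_ext[OF homeomorphism_symD[OF g] eq])
  then show "inv\<^bsub>BijGroup {0..1}\<^esub> f \<in> carrier thompson_F"
    using f B restrict_inv_into_Bij[OF B] thompson_PL_inverse[OF B]
    by (auto simp: inv_BijGroup thompson_F_iff)
next
  fix f g assume fg: "f \<in> carrier thompson_F" "g \<in> carrier thompson_F"
  then have B: "f \<in> Bij {0..1}" "g \<in> Bij {0..1}" by (simp_all add: thompson_F_iff)
  obtain f' g' where "homeomorphism {0..1} {0..1} f f'" "homeomorphism {0..1} {0..1} g g'"
    using fg by (auto simp: thompson_F_iff)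
  then have "homeomorphism {0..1} {0..1} (f \<circ> g) (g' \<circ> f')"
    by (meson homeomorphism_compose)
  then have "homeomorphism {0..1} {0..1} (compose {0..1} f g) (g' \<circ> f')"
    by (rule homeomorphism_ext) (simp add: compose_eq)
  then show "f \<otimes>\<^bsub>BijGroup {0..1}\<^esub> g \<in> carrier thompson_F"
    using fg B compose_Bij[OF B] thompson_PL_compose[OF B(2,1)]
    by (auto simp: BijGroup_def thompson_F_iff)
qed

lemma thompson_F_alt: "thompson_F = (BijGroup {0..1})\<lparr>carrier := carrier thompson_F\<rparr>"
  by (simp add: thompson_F_def)

lemma group_thompson_F: "group thompson_F"
  using group.subgroup_imp_group[OF group_BijGroup subgroup_thompson_F] thompson_F_alt by simp

lemma thompson_F_end_slopes:
  assumes "f \<in> carrier thompson_F"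
  obtains e k l where "0 < e" "e < 1"
    "\<And>x. x \<in> {0..e} \<Longrightarrow> f x = 2 powi k * x"
    "\<And>x. x \<in> {1 - e..1} \<Longrightarrow> f x = 1 - 2 powi l * (1 - x)"
proof -
  obtain B where B: "PL_breaks f B" using assms by (auto simp: thompson_F_iff thompson_PL_def)
  have f: "f 0 = 0" "f 1 = 1" using Bij_PL_breaks(1,2)[OF _ B] assms by (simp_all add: thompson_F_iff)
  have fin: "finite B" and sub: "B \<subseteq> {0<..<1}" using B by (auto simp: PL_breaks_def)
  define e where "e = Min (insert (1/2) (B \<union> (\<lambda>b. 1 - b) ` B))"
  have "e \<in> insert (1/2) (B \<union> (\<lambda>b. 1 - b) ` B)"
    unfolding e_def using fin by (intro Min_in) auto
  then have e: "0 < e" "e < 1" using sub by auto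
  have min: "e \<le> b" "e \<le> 1 - b" if "b \<in> B" for b
    unfolding e_def using fin that by (intro Min_le; auto)+
  have "False" if "b \<in> {0<..<e} \<union> {1 - e<..<1}" "b \<in> B" for b
    using min[of b] that by auto
  then have "{0<..<e} \<inter> B = {}" "{1 - e<..<1} \<inter> B = {}" by blast+
  then obtain k l :: int and c d where
    k: "\<And>x. x \<in> {0..e} \<Longrightarrow> f x = 2 powi k * x + c" and
    l: "\<And>x. x \<in> {1 - e..1} \<Longrightarrow> f x = 2 powi l * x + d"
    using PL_breaks_affine[OF B, of 0 e] PL_breaks_affine[OF B, of "1 - e" 1] e
    by (metis less_eq_real_def diff_ge_0_iff_ge diff_less_eq less_add_same_cancel1 order_refl)
  have "c = 0" "d = 1 - 2 powi l" using k[of 0] l[of 1] f e by auto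
  then show thesis using that[of e k l] e k l by (auto simp: algebra_simps)
qed

lemma pi_ab_germs:
  assumes "0 < e" and k: "\<And>x. x \<in> {0..e} \<Longrightarrow> f x = 2 powi k * x"
    and l: "\<And>x. x \<in> {1 - e..1} \<Longrightarrow> f x = 1 - 2 powi l * (1 - x)"
  shows "vector_derivative f (at_right 0) = 2 powi k"
    and "vector_derivative f (at_left 1) = 2 powi l"
    and "pi_ab f = (k, l)"
proof -
  have "((\<lambda>x. 2 powi k * x) has_vector_derivative 2 powi k) (at_right 0)"
    by (auto intro!: derivative_eq_intros)
  moreover have "\<forall>\<^sub>F x in nhds 0. x \<in> {0<..} \<longrightarrow> f x = 2 powi k * x"
    using eventually_nhds_in_open[of "{- e<..<e}" 0] assms(1) k
    by (auto elim!: eventually_mono)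
  ultimately have "(f has_vector_derivative 2 powi k) (at_right 0)"
    using has_vector_derivative_cong_ev[of "{0<..}" f "\<lambda>x. 2 powi k * x" 0] k[of 0] assms(1)
    by simp
  then show 1: "vector_derivative f (at_right 0) = 2 powi k"
    by (intro vector_derivative_within) auto
  have "((\<lambda>x. 1 - 2 powi l * (1 - x)) has_vector_derivative 2 powi l) (at_left 1)"
    by (auto intro!: derivative_eq_intros)
  moreover have "\<forall>\<^sub>F x in nhds 1. x \<in> {..<1} \<longrightarrow> f x = 1 - 2 powi l * (1 - x)"
    using eventually_nhds_in_open[of "{1 - e<..<1 + e}" 1] assms(1) l
    by (auto elim!: eventually_mono)
  ultimately have "(f has_vector_derivative 2 powi l) (at_left 1)"
    using has_vector_derivative_cong_ev[of "{..<1}" f "\<lambda>x. 1 - 2 powi l * (1 - x)" 1] l[of 1] assms(1)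
    by simp
  then show 2: "vector_derivative f (at_left 1) = 2 powi l"
    by (intro vector_derivative_within) auto
  have "log 2 (2 powi m) = of_int m" for m :: int
    by (simp flip: powr_real_of_int')
  then show "pi_ab f = (k, l)" by (simp add: pi_ab_def 1 2)
qed

lemma pi_ab_exact:
  assumes "f \<in> carrier thompson_F"
  shows "real_of_int (fst (pi_ab f)) = log 2 (vector_derivative f (at_right 0))"
    and "real_of_int (snd (pi_ab f)) = log 2 (vector_derivative f (at_left 1))"
proof -
  obtain e k l where *: "0 < e" "\<And>x. x \<in> {0..e} \<Longrightarrow> f x = 2 powi k * x"
    "\<And>x. x \<in> {1 - e..1} \<Longrightarrow> f x = 1 - 2 powi l * (1 - x)"
    using thompson_F_end_slopes[OF assms] by metis
  have "log 2 (2 powi m) = of_int m" for m :: int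
    by (simp flip: powr_real_of_int')
  then show "real_of_int (fst (pi_ab f)) = log 2 (vector_derivative f (at_right 0))"
    and "real_of_int (snd (pi_ab f)) = log 2 (vector_derivative f (at_left 1))"
    using pi_ab_germs[OF *] by simp_all
qed

lemma pi_ab_hom: "pi_ab \<in> hom thompson_F Z2"
proof (rule homI)
  fix f g assume fg: "f \<in> carrier thompson_F" "g \<in> carrier thompson_F"
  obtain e k l where f: "0 < e" "e < 1" "\<And>x. x \<in> {0..e} \<Longrightarrow> f x = 2 powi k * x"
    "\<And>x. x \<in> {1 - e..1} \<Longrightarrow> f x = 1 - 2 powi l * (1 - x)"
    using thompson_F_end_slopes[OF fg(1)] by metis
  obtain e' k' l' where g: "0 < e'" "e' < 1" "\<And>x. x \<in> {0..e'} \<Longrightarrow> g x = 2 powi k' * x"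
    "\<And>x. x \<in> {1 - e'..1} \<Longrightarrow> g x = 1 - 2 powi l' * (1 - x)"
    using thompson_F_end_slopes[OF fg(2)] by metis
  have fg': "f \<otimes>\<^bsub>thompson_F\<^esub> g = compose {0..1} f g"
    using fg by (simp add: thompson_F_iff thompson_F_def BijGroup_def)
  define d where "d = min e' (min (e / 2 powi k') (e / 2 powi l'))"
  have d: "0 < d" "d \<le> e'" "d \<le> e / 2 powi k'" "d \<le> e / 2 powi l'"
    using f g by (auto simp: d_def)
  have d': "2 powi k' * x \<le> e" "2 powi l' * x \<le> e" if "x \<le> d" for x
  proof -
    have "2 powi k' * x \<le> 2 powi k' * d" "2 powi l' * x \<le> 2 powi l' * d"
      using that by (intro mult_left_mono; simp)+
    moreover have "2 powi k' * d \<le> e" "2 powi l' * d \<le> e"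
      using d(3,4) by (simp_all add: field_simps)
    ultimately show "2 powi k' * x \<le> e" "2 powi l' * x \<le> e" by linarith+
  qed
  have "pi_ab (compose {0..1} f g) = (k + k', l + l')"
  proof (rule pi_ab_germs(3)[OF d(1)])
    show "compose {0..1} f g x = 2 powi (k + k') * x" if "x \<in> {0..d}" for x
      using that d d'(1)[of x] f g by (simp add: compose_eq power_int_add)
    show "compose {0..1} f g x = 1 - 2 powi (l + l') * (1 - x)" if "x \<in> {1 - d..1}" for x
      using that d d'(2)[of "1 - x"] f(4)[of "g x"] g by (simp add: compose_eq power_int_add)
  qed
  moreover have "pi_ab f = (k, l)" using f by (intro pi_ab_germs(3)[of e]) auto
  moreover have "pi_ab g = (k', l')" using g by (intro pi_ab_germs(3)[of e']) auto
  ultimately show "pi_ab (f \<otimes>\<^bsub>thompson_F\<^esub> g) = pi_ab f \<otimes>\<^bsub>Z2\<^esub> pi_ab g"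
    by (simp add: fg')
qed simp

end

theory Submission
  imports Defs
begin

text \<open>
  Extending the elements of \<open>F\<close> by the identity turns \<open>F\<close> into a group \<open>Th_group\<close> of homeomorphisms of
  the real line in which products and inverses are composition and inversion of functions. Most
  arguments take place there. The hypothesis excludes \<open>pi_ab f = (0, 0)\<close>, so that, up to the flip
  \<open>x \<mapsto> 1 - x\<close> and to replacing \<open>f\<close> by its inverse, \<open>f\<close> is multiplication by some \<open>K = 2 ^ a\<close> with
  \<open>a \<ge> 1\<close> near \<open>0\<close>.

  \<^emph>\<open>When is a subgroup everything?\<close> A subgroup that \<open>pi_ab\<close> maps onto \<open>Z2\<close> is all of \<open>F\<close> if it contains
  the kernel of \<open>pi_ab\<close>, that is, the elements that are the identity near \<open>0\<close> and near \<open>1\<close>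
  (\<open>gen_eq_Th\<close>). It contains the kernel as soon as it contains all elements supported in one interval
  \<open>J\<close> and each of its orbits in \<open>{0<..<1}\<close> meets the interior of \<open>J\<close>: then \<open>J\<close> can be stretched inside
  the subgroup over any compact part of \<open>{0<..<1}\<close> (\<open>compact_support_in_gen\<close>).

  \<^emph>\<open>The cogenerator\<close> is \<open>g = \<gamma> \<circ> s\<close>. Here \<open>\<gamma>\<close> has the slopes at \<open>0\<close> and \<open>1\<close> that complement those of \<open>f\<close>,
  has no fixed point in \<open>{0<..<1}\<close> in common with \<open>f\<close> and does not commute with \<open>f\<close>
  (\<open>exists_partner\<close>), and \<open>s\<close> is supported close to \<open>0\<close>. The commutator of \<open>\<gamma>\<close> and \<open>f\<close> is not the
  identity but is supported away from \<open>0\<close> and \<open>1\<close>. If \<open>M\<close> is the top of its support, it or its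
  inverse fixes everything above \<open>M\<close> and pushes points just below \<open>M\<close> towards \<open>M\<close> (\<open>top_bump\<close>). Since
  \<open>f\<close> and \<open>\<gamma>\<close> have no common fixed point, some word in them moves \<open>M\<close> close to \<open>0\<close>, and powers of the
  inverse of \<open>f\<close> move it further down, to a point \<open>\<tau>\<close> as small as desired. If \<open>s\<close> lives far enough below
  the points involved, the same word in \<open>f\<close> and \<open>g\<close> has the same effect there (\<open>gen_stable\<close>). So
  \<open>f\<close> and \<open>g\<close> generate an element \<open>t\<close> that is the identity above \<open>\<tau>\<close> and pushes points just below \<open>\<tau>\<close>
  towards \<open>\<tau>\<close>.

  The commutator of \<open>g\<close> and \<open>f\<close> equals \<open>s\<inverse>\<close> below \<open>\<tau>\<close> and is uncontrolled only above \<open>\<tau>\<close>, where \<open>t\<close> is the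
  identity. Commuting it with powers of \<open>t\<close> therefore produces elements that depend on \<open>s\<close> and \<open>t\<close> alone.

  \<^emph>\<open>The perturbation\<close> \<open>s\<close> has two parts. The part \<open>s1\<close> consists of copies of the two generators of \<open>F\<close>
  (\<open>gen_vine_gens\<close>), one in an interval \<open>I\<close> just below \<open>\<tau>\<close> and the other in \<open>t I\<close>. Two of the elements
  just produced carry one generator each on a common interval and commute elsewhere, which
  suffices to obtain copies in \<open>I\<close> of all elements of the kernel of \<open>pi_ab\<close>
  (\<open>shifted_copies_generate\<close>). The part \<open>s0\<close> is a single bump that, together with the image of \<open>I\<close> under
  a power of \<open>f\<close>, covers a fundamental domain of \<open>f\<close>, so that every orbit reaches \<open>I\<close>
  (\<open>perturbation_generates\<close>).
\<close>

section \<open>Gluing piecewise linear maps\<close>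

text \<open>Piecewise linearity as in \<open>PL_breaks\<close>, but on an arbitrary interval, so that maps can be assembled from
  pieces (\<open>PL_on_glue\<close>). Breakpoints outside the interval are allowed.\<close>

definition PL_on :: "real \<Rightarrow> real \<Rightarrow> (real \<Rightarrow> real) \<Rightarrow> bool" where
  "PL_on p q \<phi> \<longleftrightarrow> (\<exists>B. finite B \<and> B \<subseteq> dyadic \<and>
     (\<forall>a b. p \<le> a \<and> a < b \<and> b \<le> q \<and> {a<..<b} \<inter> B = {} \<longrightarrow>
        (\<exists>(k :: int) c. \<forall>x\<in>{a..b}. \<phi> x = 2 powi k * x + c)))"

lemma PL_onI:
  assumes "finite B" "B \<subseteq> dyadic"
    and "\<And>a b. p \<le> a \<Longrightarrow> a < b \<Longrightarrow> b \<le> q \<Longrightarrow> {a<..<b} \<inter> B = {} \<Longrightarrow>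
        \<exists>(k :: int) c. \<forall>x\<in>{a..b}. \<phi> x = 2 powi k * x + c"
  shows "PL_on p q \<phi>"
  unfolding PL_on_def by (intro exI[of _ B] conjI allI impI) (use assms in simp_all)

lemma PL_onE:
  assumes "PL_on p q \<phi>"
  obtains B where "finite B" "B \<subseteq> dyadic"
    "\<And>a b. p \<le> a \<Longrightarrow> a < b \<Longrightarrow> b \<le> q \<Longrightarrow> {a<..<b} \<inter> B = {} \<Longrightarrow>
        \<exists>(k :: int) c. \<forall>x\<in>{a..b}. \<phi> x = 2 powi k * x + c"
  using assms unfolding PL_on_def by (elim exE conjE) simp

lemma thompson_PL_iff_PL_on: "thompson_PL \<phi> \<longleftrightarrow> PL_on 0 1 \<phi>"
proof
  assume "thompson_PL \<phi>"
  then obtain B where "PL_breaks \<phi> B" unfolding thompson_PL_def by blast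
  then show "PL_on 0 1 \<phi>"
    unfolding PL_breaks_def by (intro PL_onI[of B]) simp_all
next
  assume "PL_on 0 1 \<phi>"
  then obtain B where B: "finite B" "B \<subseteq> dyadic"
    "\<And>a b. 0 \<le> a \<Longrightarrow> a < b \<Longrightarrow> b \<le> 1 \<Longrightarrow> {a<..<b} \<inter> B = {} \<Longrightarrow>
        \<exists>(k :: int) c. \<forall>x\<in>{a..b}. \<phi> x = 2 powi k * x + c"
    using PL_onE by metis
  have "PL_breaks \<phi> (B \<inter> {0<..<1})"
    unfolding PL_breaks_def
  proof (intro conjI allI impI)
    fix a b :: real
    assume ab: "0 \<le> a \<and> a < b \<and> b \<le> 1 \<and> {a<..<b} \<inter> (B \<inter> {0<..<1}) = {}"
    then have "{a<..<b} \<inter> B = {}" by fastforce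
    then show "\<exists>(k :: int) c. \<forall>x\<in>{a..b}. \<phi> x = 2 powi k * x + c" using B(3) ab by blast
  qed (use B in auto)
  then show "thompson_PL \<phi>" unfolding thompson_PL_def by blast
qed

lemma PL_on_affine:
  assumes "\<And>x. p \<le> x \<Longrightarrow> x \<le> q \<Longrightarrow> \<phi> x = 2 powi (k :: int) * x + c"
  shows "PL_on p q \<phi>"
  by (rule PL_onI[of "{}"]) (use assms in \<open>auto intro!: exI[of _ k] exI[of _ c]\<close>)

lemma PL_on_cong:
  assumes "PL_on p q \<phi>" "\<And>x. p \<le> x \<Longrightarrow> x \<le> q \<Longrightarrow> \<psi> x = \<phi> x"
  shows "PL_on p q \<psi>"
proof -
  obtain B where B: "finite B" "B \<subseteq> dyadic"
    "\<And>a b. p \<le> a \<Longrightarrow> a < b \<Longrightarrow> b \<le> q \<Longrightarrow> {a<..<b} \<inter> B = {} \<Longrightarrow>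
        \<exists>(k :: int) c. \<forall>x\<in>{a..b}. \<phi> x = 2 powi k * x + c"
    using PL_onE[OF assms(1)] by metis
  show ?thesis
  proof (rule PL_onI[OF B(1,2)])
    fix a b assume ab: "p \<le> a" "a < b" "b \<le> q" "{a<..<b} \<inter> B = {}"
    then obtain k :: int and c where "\<forall>x\<in>{a..b}. \<phi> x = 2 powi k * x + c" using B(3) by blast
    then have "\<forall>x\<in>{a..b}. \<psi> x = 2 powi k * x + c" using assms(2) ab by simp
    then show "\<exists>(k :: int) c. \<forall>x\<in>{a..b}. \<psi> x = 2 powi k * x + c" by blast
  qed
qed

lemma PL_on_subinterval:
  assumes "PL_on p q \<phi>" "p \<le> p'" "q' \<le> q"
  shows "PL_on p' q' \<phi>"
  using assms unfolding PL_on_def by (meson order_trans)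

lemma PL_on_glue:
  assumes "PL_on p q \<phi>" "PL_on q r \<phi>" "q \<in> dyadic"
  shows "PL_on p r \<phi>"
proof -
  obtain B where B: "finite B" "B \<subseteq> dyadic"
    "\<And>a b. p \<le> a \<Longrightarrow> a < b \<Longrightarrow> b \<le> q \<Longrightarrow> {a<..<b} \<inter> B = {} \<Longrightarrow>
        \<exists>(k :: int) c. \<forall>x\<in>{a..b}. \<phi> x = 2 powi k * x + c"
    using PL_onE[OF assms(1)] by metis
  obtain C where C: "finite C" "C \<subseteq> dyadic"
    "\<And>a b. q \<le> a \<Longrightarrow> a < b \<Longrightarrow> b \<le> r \<Longrightarrow> {a<..<b} \<inter> C = {} \<Longrightarrow>
        \<exists>(k :: int) c. \<forall>x\<in>{a..b}. \<phi> x = 2 powi k * x + c"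
    using PL_onE[OF assms(2)] by metis
  show ?thesis
  proof (rule PL_onI[of "insert q (B \<union> C)"])
    fix a b assume ab: "p \<le> a" "a < b" "b \<le> r" "{a<..<b} \<inter> insert q (B \<union> C) = {}"
    then have "b \<le> q \<or> q \<le> a" by auto
    then show "\<exists>(k :: int) c. \<forall>x\<in>{a..b}. \<phi> x = 2 powi k * x + c"
      using B(3)[of a b] C(3)[of a b] ab by blast
  qed (use B C assms in auto)
qed

lemma dyadic_mult: "x \<in> dyadic \<Longrightarrow> y \<in> dyadic \<Longrightarrow> x * y \<in> dyadic"
proof -
  assume "x \<in> dyadic" "y \<in> dyadic"
  then obtain m n m' n' where "x = of_int m / 2 ^ n" "y = of_int m' / 2 ^ n'"
    unfolding dyadic_def by blast
  then have "x * y = of_int (m * m') / 2 ^ (n + n')"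
    by (simp add: power_add)
  then show ?thesis unfolding dyadic_def by blast
qed

lemma dyadic_of_int [simp]: "of_int m \<in> dyadic"
  unfolding dyadic_def by (auto intro: exI[of _ "0::nat"] simp: exI[of _ m]) (metis div_by_1 power_0)

lemma dyadic_1 [simp]: "1 \<in> dyadic" using dyadic_of_int[of 1] by simp

lemma dyadic_powi [simp]: "2 powi k \<in> dyadic" using dyadic_scale[of 1 k] by simp

lemma dyadic_numeral [simp]: "numeral m \<in> dyadic" using dyadic_of_int[of "numeral m"] by simp

lemma dyadic_half: "x \<in> dyadic \<Longrightarrow> x / 2 \<in> dyadic"
  using dyadic_scale[of x "-1"] by (simp add: power_int_minus field_simps)

text \<open>Some multiple of \<open>1 / 2 ^ n\<close> lies in the interval once \<open>2 ^ n\<close> exceeds the reciprocal of its length.\<close>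

lemma dyadic_between:
  fixes x y :: real assumes "x < y"
  obtains d where "d \<in> dyadic" "x < d" "d < y"
proof -
  obtain n where n: "1 / (y - x) < 2 ^ n" using real_arch_pow[of 2 "1 / (y - x)"] by auto
  define m where "m = \<lfloor>2 ^ n * x\<rfloor> + 1"
  have "2 ^ n * (y - x) > 1" using n assms by (simp add: field_simps)
  moreover have "of_int m > 2 ^ n * x" "of_int m \<le> 2 ^ n * x + 1" unfolding m_def by linarith+
  ultimately have "x < of_int m / 2 ^ n" "of_int m / 2 ^ n < y"
    by (simp_all add: field_simps)
  moreover have "of_int m / 2 ^ n \<in> dyadic" unfolding dyadic_def by blast
  ultimately show ?thesis using that by blast
qed

text \<open>Slopes are unchanged by an affine conjugation, and breakpoints are mapped by \<open>x \<mapsto> c + L * x\<close>; this is why \<open>L\<close>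
  may be any positive dyadic number, not only a power of \<open>2\<close>.\<close>

lemma PL_on_conj_affine:
  assumes "PL_on p q \<phi>" "L \<in> dyadic" "c \<in> dyadic" "L > 0"
  shows "PL_on (c + L * p) (c + L * q) (\<lambda>x. c + L * \<phi> ((x - c) / L))"
proof -
  obtain B where B: "finite B" "B \<subseteq> dyadic"
    "\<And>a b. p \<le> a \<Longrightarrow> a < b \<Longrightarrow> b \<le> q \<Longrightarrow> {a<..<b} \<inter> B = {} \<Longrightarrow>
        \<exists>(k :: int) c. \<forall>x\<in>{a..b}. \<phi> x = 2 powi k * x + c"
    using PL_onE[OF assms(1)] by metis
  show ?thesis
  proof (rule PL_onI[of "(\<lambda>x. c + L * x) ` B"])
    show "(\<lambda>x. c + L * x) ` B \<subseteq> dyadic"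
      using B(2) assms(2,3) by (auto intro!: dyadic_add dyadic_mult)
    fix a b assume ab: "c + L * p \<le> a" "a < b" "b \<le> c + L * q" "{a<..<b} \<inter> (\<lambda>x. c + L * x) ` B = {}"
    have "{(a - c) / L<..<(b - c) / L} \<inter> B = {}"
    proof -
      have "c + L * x \<in> {a<..<b}" if "x \<in> {(a - c) / L<..<(b - c) / L}" for x
        using that \<open>L > 0\<close> by (auto simp: field_simps)
      then show ?thesis using ab(4) by blast
    qed
    moreover have "p \<le> (a - c) / L" "(b - c) / L \<le> q" "(a - c) / L < (b - c) / L"
      using ab(1-3) \<open>L > 0\<close> by (simp_all add: field_simps)
    ultimately obtain k :: int and d
      where kd: "\<forall>x\<in>{(a - c) / L..(b - c) / L}. \<phi> x = 2 powi k * x + d"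
      using B(3) by meson
    have "c + L * \<phi> ((x - c) / L) = 2 powi k * x + (c + L * d - 2 powi k * c)" if "x \<in> {a..b}" for x
    proof -
      have "(x - c) / L \<in> {(a - c) / L..(b - c) / L}"
        using that \<open>L > 0\<close> by (auto simp: field_simps)
      then have "\<phi> ((x - c) / L) = 2 powi k * ((x - c) / L) + d" using kd by blast
      then show ?thesis using \<open>L > 0\<close> by (simp add: field_simps)
    qed
    then show "\<exists>(k :: int) d. \<forall>x\<in>{a..b}. c + L * \<phi> ((x - c) / L) = 2 powi k * x + d" by blast
  qed (use B in auto)
qed

lemma PL_on_flip:
  assumes "PL_on p q \<phi>"
  shows "PL_on (1 - q) (1 - p) (\<lambda>x. 1 - \<phi> (1 - x))"
proof -
  obtain B where B: "finite B" "B \<subseteq> dyadic"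
    "\<And>a b. p \<le> a \<Longrightarrow> a < b \<Longrightarrow> b \<le> q \<Longrightarrow> {a<..<b} \<inter> B = {} \<Longrightarrow>
        \<exists>(k :: int) c. \<forall>x\<in>{a..b}. \<phi> x = 2 powi k * x + c"
    using PL_onE[OF assms(1)] by metis
  show ?thesis
  proof (rule PL_onI[of "(\<lambda>x. 1 - x) ` B"])
    show "(\<lambda>x. 1 - x) ` B \<subseteq> dyadic" using B(2) by (auto intro!: dyadic_diff)
    fix a b assume ab: "1 - q \<le> a" "a < b" "b \<le> 1 - p" "{a<..<b} \<inter> (\<lambda>x. 1 - x) ` B = {}"
    have "{1 - b<..<1 - a} \<inter> B = {}"
    proof -
      have "1 - x \<in> {a<..<b}" if "x \<in> {1 - b<..<1 - a}" for x using that by auto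
      then show ?thesis using ab(4) by blast
    qed
    then obtain k :: int and d where kd: "\<forall>x\<in>{1 - b..1 - a}. \<phi> x = 2 powi k * x + d"
      using B(3)[of "1 - b" "1 - a"] ab by auto
    have "1 - \<phi> (1 - x) = 2 powi k * x + (1 - 2 powi k - d)" if "x \<in> {a..b}" for x
      using kd that by (simp add: algebra_simps)
    then show "\<exists>(k :: int) d. \<forall>x\<in>{a..b}. 1 - \<phi> (1 - x) = 2 powi k * x + d" by blast
  qed (use B in auto)
qed

lemma PL_breaks_continuous_on:
  assumes "PL_breaks f B" "0 \<le> x" "x \<le> y" "y \<le> 1"
  shows "continuous_on {x..y} f"
  using assms(2-)
proof (induction "card ({x<..<y} \<inter> B)" arbitrary: x y rule: less_induct)
  case less
  have fin: "finite B" using assms(1) by (simp add: PL_breaks_def)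
  show ?case
  proof (cases "x = y \<or> {x<..<y} \<inter> B = {}")
    case True
    show ?thesis
    proof (cases "x = y")
      case False
      then obtain k :: int and c where k: "\<And>z. z \<in> {x..y} \<Longrightarrow> f z = 2 powi k * z + c"
        using PL_breaks_affine[OF assms(1), of x y] less.prems True by (metis less_eq_real_def)
      have "continuous_on {x..y} (\<lambda>z. 2 powi k * z + c)" by (intro continuous_intros)
      then show ?thesis using k by (subst continuous_on_cong[OF refl]) auto
    qed simp
  next
    case False
    then obtain b where b: "b \<in> {x<..<y} \<inter> B" by blast
    then have "{x<..<b} \<inter> B \<subset> {x<..<y} \<inter> B" "{b<..<y} \<inter> B \<subset> {x<..<y} \<inter> B"
      by auto
    then have "card ({x<..<b} \<inter> B) < card ({x<..<y} \<inter> B)"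
      "card ({b<..<y} \<inter> B) < card ({x<..<y} \<inter> B)"
      using fin by (simp_all add: psubset_card_mono)
    then have "continuous_on {x..b} f" "continuous_on {b..y} f"
      using less.hyps b less.prems by auto
    then have "continuous_on ({x..b} \<union> {b..y}) f"
      by (intro continuous_on_closed_Un) auto
    then show ?thesis using b by (simp add: ivl_disj_un_two_touch)
  qed
qed

section \<open>Thompson's group acting on the real line\<close>

text \<open>The elements of \<open>F\<close>, extended by the identity to the real line.\<close>

definition Th :: "(real \<Rightarrow> real) set" where
  "Th = {\<phi>. PL_on 0 1 \<phi> \<and> (\<forall>x. x \<le> 0 \<or> 1 \<le> x \<longrightarrow> \<phi> x = x)}"

abbreviation minv :: "(real \<Rightarrow> real) \<Rightarrow> real \<Rightarrow> real" where
  "minv \<equiv> inv_into UNIV"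

lemma Th_fix: "\<phi> \<in> Th \<Longrightarrow> x \<le> 0 \<or> 1 \<le> x \<Longrightarrow> \<phi> x = x"
  by (auto simp: Th_def)

lemma Th_obtain_breaks:
  assumes "\<phi> \<in> Th" obtains B where "PL_breaks \<phi> B"
  using assms by (auto simp: Th_def thompson_PL_iff_PL_on[symmetric] thompson_PL_def)

lemma Th_strict_mono:
  assumes "\<phi> \<in> Th" shows "strict_mono \<phi>"
proof (rule strict_monoI)
  obtain B where B: "PL_breaks \<phi> B" using assms by (rule Th_obtain_breaks)
  have mono: "\<phi> x < \<phi> y" if "0 \<le> x" "x < y" "y \<le> 1" for x y
    using PL_breaks_less[OF B that] .
  fix x y :: real assume "x < y"
  have lo: "\<phi> 0 = 0" "\<phi> 1 = 1" using Th_fix[OF assms] by auto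
  have bd: "0 \<le> \<phi> z" "\<phi> z \<le> 1" if "0 \<le> z" "z \<le> 1" for z
    using mono[of 0 z] mono[of z 1] that lo by (cases "z = 0"; cases "z = 1"; force)+
  consider "y \<le> 0 \<or> 1 \<le> x" | "x < 0 \<and> 0 \<le> y" | "0 \<le> x \<and> x \<le> 1 \<and> y > 1" | "0 \<le> x \<and> y \<le> 1"
    by linarith
  then show "\<phi> x < \<phi> y"
  proof cases
    case 1 then show ?thesis using \<open>x < y\<close> Th_fix[OF assms] by auto
  next
    case 2 then show ?thesis using Th_fix[OF assms, of x] Th_fix[OF assms, of y] bd(1)[of y]
      by (cases "y \<le> 1") auto
  next
    case 3 then show ?thesis using Th_fix[OF assms, of y] bd(2)[of x] by auto
  next
    case 4 then show ?thesis using mono \<open>x < y\<close> by auto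
  qed
qed

lemma Th_less_iff: "\<phi> \<in> Th \<Longrightarrow> \<phi> x < \<phi> y \<longleftrightarrow> x < y"
  using Th_strict_mono strict_mono_less by blast

lemma Th_le_iff: "\<phi> \<in> Th \<Longrightarrow> \<phi> x \<le> \<phi> y \<longleftrightarrow> x \<le> y"
  using Th_strict_mono strict_mono_less_eq by blast

lemma Th_inj: "\<phi> \<in> Th \<Longrightarrow> inj \<phi>"
  using Th_strict_mono strict_mono_imp_inj_on by blast

text \<open>The intermediate value theorem between the fixed points \<open>0\<close> and \<open>1\<close>.\<close>

lemma Th_surj:
  assumes "\<phi> \<in> Th" shows "surj \<phi>"
proof -
  obtain B where B: "PL_breaks \<phi> B" using assms by (rule Th_obtain_breaks)
  have "continuous_on {0..1} \<phi>" using PL_breaks_continuous_on[OF B, of 0 1] by simp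
  moreover have "\<phi> 0 = 0" "\<phi> 1 = 1" using Th_fix[OF assms] by auto
  ultimately have "\<exists>x. \<phi> x = y" for y
    using IVT'[of \<phi> 0 y 1] Th_fix[OF assms, of y] by (cases "0 \<le> y \<and> y \<le> 1") force+
  then show ?thesis by (metis surjI)
qed

lemma Th_bij: "\<phi> \<in> Th \<Longrightarrow> bij \<phi>"
  using Th_inj Th_surj by (simp add: bij_def)

text \<open>A monotone surjection of the line has no jumps.\<close>

lemma Th_continuous:
  assumes "\<phi> \<in> Th" shows "continuous_on A \<phi>"
proof -
  have "continuous_on UNIV \<phi>"
    by (rule continuous_onI_mono) (use Th_surj[OF assms] Th_le_iff[OF assms] in auto)
  then show ?thesis using continuous_on_subset by blast
qed

lemma Th_minv_f [simp]: "\<phi> \<in> Th \<Longrightarrow> minv \<phi> (\<phi> x) = x"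
  using Th_inj by (simp add: inv_f_f)

lemma Th_f_minv [simp]: "\<phi> \<in> Th \<Longrightarrow> \<phi> (minv \<phi> x) = x"
  using Th_surj by (simp add: surj_f_inv_f)

lemma Th_o_minv [simp]: "\<phi> \<in> Th \<Longrightarrow> \<phi> \<circ> minv \<phi> = id" by auto

lemma Th_restrict_Bij:
  assumes "\<phi> \<in> Th" shows "restrict \<phi> {0..1} \<in> Bij {0..1}"
proof -
  have "\<phi> 0 = 0" "\<phi> 1 = 1" using Th_fix[OF assms] by auto
  then have "\<phi> x \<in> {0..1} \<longleftrightarrow> x \<in> {0..1}" for x
    using Th_le_iff[OF assms, of 0 x] Th_le_iff[OF assms, of x 1] by auto
  moreover have "\<exists>x. \<phi> x = y" for y using Th_surj[OF assms] by (metis surjD)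
  ultimately have "\<phi> ` {0..1} = {0..1}" by (auto simp: image_iff) (metis atLeastAtMost_iff)
  then have "bij_betw \<phi> {0..1} {0..1}"
    using Th_inj[OF assms] inj_on_subset[of \<phi> UNIV "{0..1}"] by (simp add: bij_betw_def)
  then show ?thesis by (simp add: Bij_def)
qed

lemma Th_restrict:
  assumes "\<phi> \<in> Th" shows "restrict \<phi> {0..1} \<in> carrier thompson_F"
proof -
  have B: "restrict \<phi> {0..1} \<in> Bij {0..1}" by (rule Th_restrict_Bij[OF assms])
  have "continuous_on {0..1} (restrict \<phi> {0..1})"
    using Th_continuous[OF assms, of "{0..1}"] by (subst continuous_on_cong[OF refl, of _ _ \<phi>]) auto
  moreover have "restrict \<phi> {0..1} ` {0..1} = {0..1}" "inj_on (restrict \<phi> {0..1}) {0..1}"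
    using B unfolding Bij_def bij_betw_def by blast+
  ultimately have "\<exists>g. homeomorphism {0..1} {0..1} (restrict \<phi> {0..1}) g"
    using homeomorphism_compact[of "{0..1}" "restrict \<phi> {0..1}" "{0..1}"] by auto
  moreover have "PL_on 0 1 (restrict \<phi> {0..1})"
    using assms PL_on_cong[of 0 1 \<phi> "restrict \<phi> {0..1}"] by (simp add: Th_def)
  ultimately show ?thesis using B by (simp add: thompson_F_iff thompson_PL_iff_PL_on)
qed

definition extend :: "(real \<Rightarrow> real) \<Rightarrow> real \<Rightarrow> real" where
  "extend f x = (if x \<in> {0..1} then f x else x)"

lemma extend_Th:
  assumes "f \<in> carrier thompson_F" shows "extend f \<in> Th"
proof -
  have Bij: "f \<in> Bij {0..1}" and PL: "thompson_PL f" using assms by (auto simp: thompson_F_iff)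
  have "f 0 = 0" "f 1 = 1" using PL Bij_PL_breaks(1,2)[OF Bij] by (auto simp: thompson_PL_def)
  moreover have "PL_on 0 1 (extend f)"
    using PL PL_on_cong[of 0 1 f "extend f"] by (simp add: thompson_PL_iff_PL_on extend_def)
  ultimately show ?thesis by (auto simp: Th_def extend_def)
qed

lemma restrict_extend:
  assumes "f \<in> carrier thompson_F" shows "restrict (extend f) {0..1} = f"
proof -
  have "f \<in> extensional {0..1}" using assms by (simp add: thompson_F_iff Bij_def)
  then show ?thesis by (intro extensionalityI[of _ "{0..1}"]) (auto simp: extend_def)
qed

lemma Th_id [simp]: "id \<in> Th"
  unfolding Th_def by (auto intro!: PL_on_affine[of _ _ _ 0 0])

lemma Th_comp:
  assumes "\<phi> \<in> Th" "\<psi> \<in> Th" shows "\<phi> \<circ> \<psi> \<in> Th"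
proof -
  have "thompson_PL (compose {0..1} (restrict \<phi> {0..1}) (restrict \<psi> {0..1}))"
    using assms[THEN Th_restrict] by (intro thompson_PL_compose) (auto simp: thompson_F_iff)
  then have "PL_on 0 1 (compose {0..1} (restrict \<phi> {0..1}) (restrict \<psi> {0..1}))"
    by (simp add: thompson_PL_iff_PL_on)
  moreover have "\<psi> x \<in> {0..1}" if "x \<in> {0..1}" for x
    using Th_restrict_Bij[OF assms(2)] that unfolding Bij_def bij_betw_def by auto
  ultimately have "PL_on 0 1 (\<phi> \<circ> \<psi>)"
    using PL_on_cong[of 0 1 "compose {0..1} (restrict \<phi> {0..1}) (restrict \<psi> {0..1})" "\<phi> \<circ> \<psi>"]
    by (simp add: compose_def)
  then show ?thesis using assms by (auto simp: Th_def)
qed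

lemma Th_minv:
  assumes "\<phi> \<in> Th" shows "minv \<phi> \<in> Th"
proof -
  define r where "r = restrict \<phi> {0..1}"
  have B: "r \<in> Bij {0..1}" unfolding r_def by (rule Th_restrict_Bij[OF assms])
  have fix': "minv \<phi> x = x" if "x \<le> 0 \<or> 1 \<le> x" for x
    using Th_minv_f[OF assms, of x] Th_fix[OF assms that] by simp
  have "thompson_PL (\<lambda>x\<in>{0..1}. inv_into {0..1} r x)"
    using Th_restrict[OF assms] B by (intro thompson_PL_inverse) (auto simp: thompson_F_iff r_def)
  then have "PL_on 0 1 (\<lambda>x\<in>{0..1}. inv_into {0..1} r x)" unfolding thompson_PL_iff_PL_on .
  moreover have "minv \<phi> x = inv_into {0..1} r x" if "x \<in> {0..1}" for x
  proof -
    have "x \<in> r ` {0..1}" using B that unfolding Bij_def bij_betw_def by auto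
    then have "inv_into {0..1} r x \<in> {0..1}" "r (inv_into {0..1} r x) = x"
      by (rule inv_into_into, rule f_inv_into_f)
    then show ?thesis by (metis Th_minv_f[OF assms] r_def restrict_apply')
  qed
  ultimately have "PL_on 0 1 (minv \<phi>)"
    using PL_on_cong[of 0 1 "\<lambda>x\<in>{0..1}. inv_into {0..1} r x" "minv \<phi>"] by simp
  then show ?thesis using fix' by (auto simp: Th_def)
qed

definition Th_group :: "(real \<Rightarrow> real) monoid" where
  "Th_group = \<lparr>carrier = Th, monoid.mult = (\<circ>), one = id\<rparr>"

lemma Th_group_simps [simp]:
  "carrier Th_group = Th" "\<phi> \<otimes>\<^bsub>Th_group\<^esub> \<psi> = \<phi> \<circ> \<psi>" "\<one>\<^bsub>Th_group\<^esub> = id"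
  by (simp_all add: Th_group_def)

lemma group_Th_group: "group Th_group"
  by (rule groupI) (auto simp: Th_comp comp_assoc intro!: bexI[of _ "minv _"] Th_minv)

interpretation Th_group: group Th_group by (rule group_Th_group)

lemma inv_Th_group: "\<phi> \<in> Th \<Longrightarrow> inv\<^bsub>Th_group\<^esub> \<phi> = minv \<phi>"
  by (rule Th_group.inv_equality) (auto simp: Th_minv)

lemma Th_minv_minv [simp]: "\<phi> \<in> Th \<Longrightarrow> minv (minv \<phi>) = \<phi>"
  using inv_Th_group[of \<phi>] inv_Th_group[of "minv \<phi>"] Th_group.inv_inv[of \<phi>] Th_minv[of \<phi>] by simp

lemma Th_minv_comp: "\<phi> \<in> Th \<Longrightarrow> \<psi> \<in> Th \<Longrightarrow> minv (\<phi> \<circ> \<psi>) = minv \<psi> \<circ> minv \<phi>"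
  by (simp add: o_inv_distrib Th_bij)

lemma minv_eq_iff: "\<phi> \<in> Th \<Longrightarrow> minv \<phi> x = y \<longleftrightarrow> x = \<phi> y"
  by (metis Th_f_minv Th_minv_f)

lemma Th_eq_iff: "\<phi> \<in> Th \<Longrightarrow> \<phi> x = \<phi> y \<longleftrightarrow> x = y"
  using Th_inj by (simp add: inj_eq)

lemma Th_funpow: "\<phi> \<in> Th \<Longrightarrow> \<phi> ^^ n \<in> Th"
  by (induction n) (auto simp: Th_comp)

lemma Th_unit_iff [simp]:
  assumes "\<phi> \<in> Th" shows "0 < \<phi> x \<longleftrightarrow> 0 < x" "\<phi> x < 1 \<longleftrightarrow> x < 1"
    "0 \<le> \<phi> x \<longleftrightarrow> 0 \<le> x" "\<phi> x \<le> 1 \<longleftrightarrow> x \<le> 1"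
  using Th_less_iff[OF assms, of 0 x] Th_less_iff[OF assms, of x 1]
    Th_le_iff[OF assms, of 0 x] Th_le_iff[OF assms, of x 1] Th_fix[OF assms, of 0] Th_fix[OF assms, of 1]
  by auto

abbreviation gen :: "(real \<Rightarrow> real) set \<Rightarrow> (real \<Rightarrow> real) set" where
  "gen \<equiv> generate Th_group"

lemma gen_Th: "S \<subseteq> Th \<Longrightarrow> \<phi> \<in> gen S \<Longrightarrow> \<phi> \<in> Th"
  using Th_group.generate_in_carrier by simp

lemma gen_comp: "\<phi> \<in> gen S \<Longrightarrow> \<psi> \<in> gen S \<Longrightarrow> \<phi> \<circ> \<psi> \<in> gen S"
  using generate.eng[of \<phi> Th_group S \<psi>] by simp

lemma gen_id: "id \<in> gen S"
  using generate.one[of Th_group S] by simp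

lemma gen_minv: "S \<subseteq> Th \<Longrightarrow> \<phi> \<in> gen S \<Longrightarrow> minv \<phi> \<in> gen S"
  using Th_group.generate_m_inv_closed[of S \<phi>] gen_Th inv_Th_group by simp

lemma gen_funpow: "\<phi> \<in> gen S \<Longrightarrow> \<phi> ^^ n \<in> gen S"
  by (induction n) (auto simp: gen_comp gen_id)

lemma gen_subset:
  assumes "T \<subseteq> gen S" "S \<subseteq> Th" shows "gen T \<subseteq> gen S"
  using Th_group.generate_subgroup_incl[OF assms(1)] Th_group.generate_is_subgroup assms(2) by simp

lemma thompson_F_mult: 
  "f \<in> carrier thompson_F \<Longrightarrow> g \<in> carrier thompson_F \<Longrightarrow> f \<otimes>\<^bsub>thompson_F\<^esub> g = compose {0..1} f g"
  by (simp add: thompson_F_iff thompson_F_def BijGroup_def)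

lemma restrict_hom: "group_hom Th_group thompson_F (\<lambda>\<phi>. restrict \<phi> {0..1})"
proof -
  have "(\<lambda>\<phi>. restrict \<phi> {0..1}) \<in> hom Th_group thompson_F"
  proof (rule homI)
    fix \<phi> \<psi> assume *: "\<phi> \<in> carrier Th_group" "\<psi> \<in> carrier Th_group"
    then have "\<phi> \<in> Th" "\<psi> \<in> Th" by auto
    moreover from this have "compose {0..1} (restrict \<phi> {0..1}) (restrict \<psi> {0..1}) = restrict (\<phi> \<circ> \<psi>) {0..1}"
      by (auto simp: compose_def restrict_def fun_eq_iff)
    ultimately show "restrict (\<phi> \<otimes>\<^bsub>Th_group\<^esub> \<psi>) {0..1} = restrict \<phi> {0..1} \<otimes>\<^bsub>thompson_F\<^esub> restrict \<psi> {0..1}"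
      by (simp add: thompson_F_mult Th_restrict)
  qed (simp add: Th_restrict)
  then show ?thesis using group_Th_group group_thompson_F by (simp add: group_hom_def group_hom_axioms_def)
qed

lemma Th_image_restrict: "(\<lambda>\<phi>. restrict \<phi> {0..1}) ` Th = carrier thompson_F"
proof
  show "carrier thompson_F \<subseteq> (\<lambda>\<phi>. restrict \<phi> {0..1}) ` Th"
  proof
    fix f assume f: "f \<in> carrier thompson_F"
    show "f \<in> (\<lambda>\<phi>. restrict \<phi> {0..1}) ` Th"
      by (rule image_eqI[of f _ "extend f"]) (simp_all add: restrict_extend[OF f] extend_Th[OF f])
  qed
qed (use Th_restrict in blast)

section \<open>Slopes at the end points\<close>

lemma pi_ab_restrict:
  assumes "\<phi> \<in> Th" shows "pi_ab (restrict \<phi> {0..1}) = pi_ab \<phi>"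
proof -
  obtain e k l where *: "0 < e" "e < 1" "\<And>x. x \<in> {0..e} \<Longrightarrow> restrict \<phi> {0..1} x = 2 powi k * x"
    "\<And>x. x \<in> {1 - e..1} \<Longrightarrow> restrict \<phi> {0..1} x = 1 - 2 powi l * (1 - x)"
    using thompson_F_end_slopes[OF Th_restrict[OF assms]] by metis
  have "pi_ab (restrict \<phi> {0..1}) = (k, l)" by (rule pi_ab_germs(3)[OF *(1,3,4)])
  moreover have "pi_ab \<phi> = (k, l)" by (rule pi_ab_germs(3)[OF *(1)]) (use * in force)+
  ultimately show ?thesis by simp
qed

lemma Th_germs:
  assumes "\<phi> \<in> Th"
  obtains e where "0 < e" "e < 1" "\<And>x. 0 \<le> x \<Longrightarrow> x \<le> e \<Longrightarrow> \<phi> x = 2 powi fst (pi_ab \<phi>) * x"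
    "\<And>x. 1 - e \<le> x \<Longrightarrow> x \<le> 1 \<Longrightarrow> \<phi> x = 1 - 2 powi snd (pi_ab \<phi>) * (1 - x)"
proof -
  obtain e k l where *: "0 < e" "e < 1" "\<And>x. x \<in> {0..e} \<Longrightarrow> restrict \<phi> {0..1} x = 2 powi k * x"
    "\<And>x. x \<in> {1 - e..1} \<Longrightarrow> restrict \<phi> {0..1} x = 1 - 2 powi l * (1 - x)"
    using thompson_F_end_slopes[OF Th_restrict[OF assms]] by metis
  have "pi_ab (restrict \<phi> {0..1}) = (k, l)" by (rule pi_ab_germs(3)[OF *(1,3,4)])
  then have "pi_ab \<phi> = (k, l)" using pi_ab_restrict[OF assms] by simp
  then show ?thesis using * by (intro that[of e]) force+
qed

lemma group_Z2: "group Z2" by (simp add: DirProd_group)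

lemma pi_ab_group_hom: "group_hom Th_group Z2 pi_ab"
proof -
  have "pi_ab \<in> hom Th_group Z2"
  proof (rule homI)
    fix \<phi> \<psi> assume *: "\<phi> \<in> carrier Th_group" "\<psi> \<in> carrier Th_group"
    then have T: "\<phi> \<in> Th" "\<psi> \<in> Th" "\<phi> \<circ> \<psi> \<in> Th" by (auto simp: Th_comp)
    have "pi_ab (restrict (\<phi> \<circ> \<psi>) {0..1}) = pi_ab (restrict \<phi> {0..1}) \<otimes>\<^bsub>Z2\<^esub> pi_ab (restrict \<psi> {0..1})"
      using group_hom.hom_mult[OF restrict_hom, of \<phi> \<psi>] hom_mult[OF pi_ab_hom] T Th_restrict by simp
    then show "pi_ab (\<phi> \<otimes>\<^bsub>Th_group\<^esub> \<psi>) = pi_ab \<phi> \<otimes>\<^bsub>Z2\<^esub> pi_ab \<psi>"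
      using T by (simp add: pi_ab_restrict)
  qed simp
  then show ?thesis using group_Th_group group_Z2 by (simp add: group_hom_def group_hom_axioms_def)
qed

lemma pi_ab_comp:
  "\<phi> \<in> Th \<Longrightarrow> \<psi> \<in> Th \<Longrightarrow> pi_ab (\<phi> \<circ> \<psi>) = (fst (pi_ab \<phi>) + fst (pi_ab \<psi>), snd (pi_ab \<phi>) + snd (pi_ab \<psi>))"
  using group_hom.hom_mult[OF pi_ab_group_hom, of \<phi> \<psi>] by (simp add: mult_DirProd' split: prod.splits)

lemma pi_ab_id: "pi_ab id = (0, 0)"
  using group_hom.hom_one[OF pi_ab_group_hom] by simp

lemma pi_ab_minv:
  assumes "\<phi> \<in> Th" shows "pi_ab (minv \<phi>) = (- fst (pi_ab \<phi>), - snd (pi_ab \<phi>))"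
  using pi_ab_comp[OF assms Th_minv[OF assms]] pi_ab_id assms
  by (metis Th_o_minv add_eq_0_iff fst_conv prod.collapse snd_conv)

text \<open>Slope \<open>1\<close> at a fixed end point means that the map is the identity near this point.\<close>

lemma pi_ab_zero_support:
  assumes "\<phi> \<in> Th" "pi_ab \<phi> = (0, 0)"
  obtains e where "0 < e" "e < 1/2" "\<And>x. x \<le> e \<or> 1 - e \<le> x \<Longrightarrow> \<phi> x = x"
proof -
  obtain e where e: "0 < e" "e < 1" "\<And>x. 0 \<le> x \<Longrightarrow> x \<le> e \<Longrightarrow> \<phi> x = 2 powi fst (pi_ab \<phi>) * x"
    "\<And>x. 1 - e \<le> x \<Longrightarrow> x \<le> 1 \<Longrightarrow> \<phi> x = 1 - 2 powi snd (pi_ab \<phi>) * (1 - x)"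
    using Th_germs[OF assms(1)] by metis
  show ?thesis
  proof (rule that[of "e / 3"])
    fix x assume "x \<le> e / 3 \<or> 1 - e / 3 \<le> x"
    then show "\<phi> x = x" using e(3,4)[of x] assms(2) Th_fix[OF assms(1), of x] \<open>0 < e\<close>
      by (cases "0 \<le> x"; cases "x \<le> 1") auto
  qed (use e in auto)
qed

lemma pi_ab_zero_if_support:
  assumes "0 < e" "\<And>x. x \<le> e \<or> 1 - e \<le> x \<Longrightarrow> \<phi> x = x"
  shows "pi_ab \<phi> = (0, 0)"
  by (rule pi_ab_germs(3)[OF assms(1)]) (use assms in auto)

section \<open>Conjugation by affine maps and by the flip\<close>

lemma PL_on_id: "PL_on p q (\<lambda>x. x)"
  by (rule PL_on_affine[of _ _ _ 0 0]) simp

text \<open>Outside the unit interval the map is the identity, so it can be glued there; this allows an affine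
  conjugation to move the unit interval anywhere.\<close>

lemma Th_PL_on:
  assumes "\<phi> \<in> Th" shows "PL_on p q \<phi>"
proof -
  have "PL_on (min p 0) 0 \<phi>" "PL_on 1 (max q 1) \<phi>" 
    by (rule PL_on_cong[OF PL_on_id]; simp add: Th_fix[OF assms])+
  moreover have "PL_on 0 1 \<phi>" using assms by (simp add: Th_def)
  ultimately have "PL_on (min p 0) (max q 1) \<phi>"
    using PL_on_glue[of "min p 0" 0 \<phi> 1] PL_on_glue[of "min p 0" 1 \<phi> "max q 1"] by simp
  then show ?thesis by (rule PL_on_subinterval) auto
qed

text \<open>The conjugate of \<open>\<phi>\<close> by \<open>x \<mapsto> c + L * x\<close>, that is, a copy of \<open>\<phi>\<close> on the interval \<open>{c..c + L}\<close>.\<close>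

definition affine_conj :: "real \<Rightarrow> real \<Rightarrow> (real \<Rightarrow> real) \<Rightarrow> real \<Rightarrow> real" where
  "affine_conj c L \<phi> x = c + L * \<phi> ((x - c) / L)"

lemma affine_conj_Th:
  assumes "\<phi> \<in> Th" "c \<in> dyadic" "L \<in> dyadic" "L > 0"
    and "\<And>x. x \<le> 0 \<or> 1 \<le> x \<Longrightarrow> \<phi> ((x - c) / L) = (x - c) / L"
  shows "affine_conj c L \<phi> \<in> Th"
proof -
  have "PL_on (c + L * ((0 - c) / L)) (c + L * ((1 - c) / L)) (\<lambda>x. c + L * \<phi> ((x - c) / L))"
    by (rule PL_on_conj_affine[OF Th_PL_on[OF assms(1)] assms(3,2,4)])
  then have "PL_on 0 1 (affine_conj c L \<phi>)" using \<open>L > 0\<close> by (simp add: affine_conj_def[abs_def])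
  moreover have "affine_conj c L \<phi> x = x" if "x \<le> 0 \<or> 1 \<le> x" for x
    using assms(5)[OF that] \<open>L > 0\<close> by (simp add: affine_conj_def)
  ultimately show ?thesis by (simp add: Th_def)
qed

lemma affine_conj_Th_shrink:
  assumes "\<phi> \<in> Th" "c \<in> dyadic" "L \<in> dyadic" "L > 0" "0 \<le> c" "c + L \<le> 1"
  shows "affine_conj c L \<phi> \<in> Th"
proof (rule affine_conj_Th[OF assms(1-4)])
  fix x :: real assume "x \<le> 0 \<or> 1 \<le> x"
  then show "\<phi> ((x - c) / L) = (x - c) / L"
    using assms by (intro Th_fix) (auto simp: field_simps)
qed

lemma affine_conj_comp: "L > 0 \<Longrightarrow> affine_conj c L (\<phi> \<circ> \<psi>) = affine_conj c L \<phi> \<circ> affine_conj c L \<psi>"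
  by (auto simp: affine_conj_def fun_eq_iff)

lemma affine_conj_outside:
  assumes "\<phi> \<in> Th" "L > 0" "x \<le> c \<or> c + L \<le> x"
  shows "affine_conj c L \<phi> x = x"
proof -
  have "\<phi> ((x - c) / L) = (x - c) / L"
    using assms by (intro Th_fix) (auto simp: field_simps)
  then show ?thesis using \<open>L > 0\<close> by (simp add: affine_conj_def)
qed

lemma affine_conj_minv:
  assumes "\<phi> \<in> Th" "affine_conj c L \<phi> \<in> Th" "L > 0"
  shows "affine_conj c L (minv \<phi>) = minv (affine_conj c L \<phi>)"
proof
  fix x
  have "affine_conj c L \<phi> (affine_conj c L (minv \<phi>) x) = x" using assms by (simp add: affine_conj_def)
  then show "affine_conj c L (minv \<phi>) x = minv (affine_conj c L \<phi>) x" using assms(2) by (metis Th_minv_f)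
qed

definition flip :: "(real \<Rightarrow> real) \<Rightarrow> real \<Rightarrow> real" where
  "flip \<phi> x = 1 - \<phi> (1 - x)"

lemma flip_flip [simp]: "flip (flip \<phi>) = \<phi>" by (simp add: flip_def fun_eq_iff)

lemma flip_Th: "\<phi> \<in> Th \<Longrightarrow> flip \<phi> \<in> Th"
  using PL_on_flip[of 0 1 \<phi>] by (auto simp: Th_def flip_def[abs_def])

lemma flip_hom: "group_hom Th_group Th_group flip"
  using group_Th_group flip_Th by (auto simp: group_hom_def group_hom_axioms_def hom_def flip_def fun_eq_iff)

lemma flip_image_Th: "flip ` Th = Th"
  using flip_Th flip_flip by (metis image_subset_iff subset_antisym subsetI image_eqI)

lemma pi_ab_flip:
  assumes "\<phi> \<in> Th" shows "pi_ab (flip \<phi>) = (snd (pi_ab \<phi>), fst (pi_ab \<phi>))"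
proof -
  obtain e where e: "0 < e" "e < 1" "\<And>x. 0 \<le> x \<Longrightarrow> x \<le> e \<Longrightarrow> \<phi> x = 2 powi fst (pi_ab \<phi>) * x"
    "\<And>x. 1 - e \<le> x \<Longrightarrow> x \<le> 1 \<Longrightarrow> \<phi> x = 1 - 2 powi snd (pi_ab \<phi>) * (1 - x)"
    using Th_germs[OF assms(1)] by metis
  show ?thesis by (rule pi_ab_germs(3)[OF e(1)]) (use e in \<open>auto simp: flip_def\<close>)
qed

section \<open>Two generators of the group\<close>

text \<open>The inverse of the standard generator \<open>x\<^sub>0\<close> of \<open>F\<close>.\<close>

definition bump :: "real \<Rightarrow> real" where
  "bump x = (if x \<le> 0 then x else if x \<le> 1/4 then 2 * x else if x \<le> 1/2 then x + 1/4
           else if x \<le> 1 then (1 + x) / 2 else x)"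

lemma bump_Th: "bump \<in> Th"
proof -
  have "PL_on 0 (1/4) bump" by (rule PL_on_affine[of _ _ _ 1 0]) (simp add: bump_def)
  moreover have "PL_on (1/4) (1/2) bump" by (rule PL_on_affine[of _ _ _ 0 "1/4"]) (simp add: bump_def)
  moreover have "PL_on (1/2) 1 bump"
    by (rule PL_on_affine[of _ _ _ "-1" "1/2"]) (auto simp: bump_def power_int_minus field_simps)
  ultimately have "PL_on 0 1 bump"
    using PL_on_glue[of 0 "1/4" bump "1/2"] PL_on_glue[of 0 "1/2" bump 1]
      dyadic_half[of 1] dyadic_half[of "1/2"] by simp
  then show ?thesis by (auto simp: Th_def bump_def)
qed

lemma pi_ab_bump: "pi_ab bump = (1, -1)"
  by (rule pi_ab_germs(3)[of "1/4"]) (auto simp: bump_def power_int_minus field_simps)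

text \<open>Copies of \<open>bump\<close> on the intervals \<open>{1 - 1 / 2 ^ i..1}\<close>; they are the inverses of the standard infinite
  generating sequence of \<open>F\<close>.\<close>

definition vine_gen :: "nat \<Rightarrow> real \<Rightarrow> real" where
  "vine_gen i = affine_conj (1 - 1 / 2 ^ i) (1 / 2 ^ i) bump"

lemma dyadic_inverse_power [simp]: "1 / 2 ^ i \<in> dyadic"
  unfolding dyadic_def by (auto intro: exI[of _ 1])

lemma vine_gen_Th: "vine_gen i \<in> Th"
  unfolding vine_gen_def by (rule affine_conj_Th_shrink[OF bump_Th]) (auto intro!: dyadic_diff)

lemma vine_gen_0: "vine_gen 0 = bump"
  by (simp add: vine_gen_def affine_conj_def[abs_def])

lemma affine_conj_bump:
  assumes "0 < r"
  shows "x \<le> 1 - r \<Longrightarrow> affine_conj (1 - r) r bump x = x"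
    "1 - r \<le> x \<Longrightarrow> x \<le> 1 - 3 * r / 4 \<Longrightarrow> affine_conj (1 - r) r bump x = 1 - r + 2 * (x - (1 - r))"
    "1 - 3 * r / 4 \<le> x \<Longrightarrow> x \<le> 1 - r / 2 \<Longrightarrow> affine_conj (1 - r) r bump x = x + r / 4"
    "1 - r / 2 \<le> x \<Longrightarrow> x \<le> 1 \<Longrightarrow> affine_conj (1 - r) r bump x = (1 + x) / 2"
    "1 \<le> x \<Longrightarrow> affine_conj (1 - r) r bump x = x"
proof -
  have *: "x = (1 - r) + r * ((x - (1 - r)) / r)" using assms by simp
  define z where "z = (x - (1 - r)) / r"
  have x: "x = 1 - r + r * z" using * by (simp add: z_def)
  have a: "affine_conj (1 - r) r bump x = 1 - r + r * bump z" by (simp add: affine_conj_def z_def)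
  show "x \<le> 1 - r \<Longrightarrow> affine_conj (1 - r) r bump x = x"
    using affine_conj_outside[OF bump_Th assms] by simp
  show "1 \<le> x \<Longrightarrow> affine_conj (1 - r) r bump x = x"
    using affine_conj_outside[OF bump_Th assms] by simp
  show "affine_conj (1 - r) r bump x = 1 - r + 2 * (x - (1 - r))" if h: "1 - r \<le> x" "x \<le> 1 - 3 * r / 4"
  proof -
    have "0 \<le> z" "z \<le> 1/4" using h assms by (auto simp: z_def field_simps)
    then show ?thesis unfolding a by (simp add: bump_def x)
  qed
  show "affine_conj (1 - r) r bump x = x + r / 4" if h: "1 - 3 * r / 4 \<le> x" "x \<le> 1 - r / 2"
  proof -
    have "1/4 \<le> z" "z \<le> 1/2" using h assms by (auto simp: z_def field_simps)
    then have "bump z = z + 1/4" by (auto simp: bump_def)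
    then show ?thesis unfolding a by (simp add: x algebra_simps)
  qed
  show "affine_conj (1 - r) r bump x = (1 + x) / 2" if h: "1 - r / 2 \<le> x" "x \<le> 1"
  proof -
    have "1/2 \<le> z" "z \<le> 1" using h assms by (auto simp: z_def field_simps)
    then have "bump z = (1 + z) / 2" by (auto simp: bump_def)
    then show ?thesis unfolding a by (simp add: x field_simps)
  qed
qed

text \<open>On \<open>{1/2..1}\<close> the map \<open>vine_gen 0\<close> is \<open>x \<mapsto> (1 + x) / 2\<close>, which carries the interval of each later \<open>vine_gen i\<close>
  affinely onto that of \<open>vine_gen (Suc i)\<close>.\<close>

lemma vine_gen_conj:
  assumes "1 \<le> i"
  shows "vine_gen (Suc i) = vine_gen 0 \<circ> vine_gen i \<circ> minv (vine_gen 0)"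
proof -
  have r: "(0::real) < 1 / 2 ^ i" "1 / 2 ^ i \<le> (1/2 :: real)"
    using assms power_increasing[of 1 i "2::real"] by (simp_all add: field_simps)
  have y: "vine_gen 0 x = (1 + x) / 2" if "1/2 \<le> x" "x \<le> 1" for x
    using that affine_conj_bump(4)[of 1 x] by (simp add: vine_gen_def)
  have "vine_gen (Suc i) (vine_gen 0 x) = vine_gen 0 (vine_gen i x)" for x
  proof (cases "1/2 \<le> x \<and> x \<le> 1")
    case True
    have "vine_gen i (1/2) = 1/2" unfolding vine_gen_def by (rule affine_conj_bump(1)) (use r(2) in \<open>auto simp: field_simps\<close>)
    then have "1/2 \<le> vine_gen i x" "vine_gen i x \<le> 1"
      using Th_le_iff[OF vine_gen_Th[of i], of "1/2" x] Th_unit_iff(4)[OF vine_gen_Th[of i], of x] True by auto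
    then have e': "vine_gen 0 (vine_gen i x) = (1 + vine_gen i x) / 2" by (rule y)
    define z where "z = (x - (1 - 1 / 2 ^ i)) / (1 / 2 ^ i)"
    have "((1 + x) / 2 - (1 - 1 / 2 ^ Suc i)) / (1 / 2 ^ Suc i) = z"
      by (simp add: z_def field_simps)
    then have "vine_gen (Suc i) ((1 + x) / 2) = 1 - 1 / 2 ^ Suc i + 1 / 2 ^ Suc i * bump z"
      by (simp only: vine_gen_def affine_conj_def)
    moreover have "vine_gen i x = 1 - 1 / 2 ^ i + 1 / 2 ^ i * bump z"
      by (simp only: vine_gen_def affine_conj_def z_def)
    moreover define r :: real where "r = 1 / 2 ^ i"
    moreover have "1 / 2 ^ Suc i = r / 2" by (simp add: r_def)
    ultimately have e: "vine_gen (Suc i) ((1 + x) / 2) = 1 - r / 2 + r / 2 * bump z" "vine_gen i x = 1 - r + r * bump z"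
      by simp_all
    have "vine_gen (Suc i) ((1 + x) / 2) = (1 + vine_gen i x) / 2" unfolding e by (simp add: field_simps)
    then show ?thesis using e' y[of x] True by (simp only:)
  next
    case False
    show ?thesis
    proof (cases "x > 1")
      case True
      then show ?thesis using Th_fix[OF vine_gen_Th] by simp
    next
      case False
      then have x: "x < 1/2" using \<open>\<not> (1/2 \<le> x \<and> x \<le> 1)\<close> by simp
      have "vine_gen 0 x < vine_gen 0 (1/2)" using Th_less_iff[OF vine_gen_Th] x by blast
      then have "vine_gen 0 x < 3 / 4" using y[of "1/2"] by simp
      moreover have "3 / 4 \<le> 1 - 1 / (2 :: real) ^ Suc i" using r(2) by (simp add: field_simps)
      ultimately have "vine_gen 0 x \<le> 1 - 1 / 2 ^ Suc i" by (rule less_imp_le[OF less_le_trans])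
      then have "vine_gen (Suc i) (vine_gen 0 x) = vine_gen 0 x"
        unfolding vine_gen_def[of "Suc i"] by (intro affine_conj_bump(1)) auto
      moreover have "1 / 2 \<le> 1 - 1 / (2 :: real) ^ i" using r(2) by (simp add: field_simps)
      then have "x \<le> 1 - 1 / 2 ^ i" by (rule less_imp_le[OF less_le_trans[OF x]])
      then have "vine_gen i x = x" unfolding vine_gen_def by (intro affine_conj_bump(1)) auto
      ultimately show ?thesis by simp
    qed
  qed
  then have "vine_gen (Suc i) (vine_gen 0 (minv (vine_gen 0) x)) = vine_gen 0 (vine_gen i (minv (vine_gen 0) x))" for x by blast
  then show ?thesis by (auto simp: fun_eq_iff vine_gen_Th)
qed

abbreviation "Y \<equiv> {vine_gen 0, vine_gen 1}"

lemma Y_subset_Th: "Y \<subseteq> Th" using vine_gen_Th by auto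

lemma vine_gen_in_gen: "vine_gen i \<in> gen Y"
proof (induction i rule: less_induct)
  case (less i)
  have b: "vine_gen 0 \<in> gen Y" "vine_gen 1 \<in> gen Y" by (auto intro: generate.incl)
  show ?case
  proof (cases "i \<le> 1")
    case True
    then show ?thesis using b by (cases "i = 0") (auto simp: le_Suc_eq)
  next
    case False
    then obtain j where j: "i = Suc j" "1 \<le> j" by (cases i) auto
    have "vine_gen 0 \<circ> vine_gen j \<circ> minv (vine_gen 0) \<in> gen Y"
      using less[of j] j b gen_minv[OF Y_subset_Th] by (intro gen_comp) auto
    then show ?thesis unfolding j(1) vine_gen_conj[OF j(2)] .
  qed
qed

text \<open>The parametrization by \<open>\<theta>\<close> makes composition immediate and needs no division by the length of the
  interval.\<close>

definition affine_onto :: "(real \<Rightarrow> real) \<Rightarrow> real \<Rightarrow> real \<Rightarrow> real \<Rightarrow> real \<Rightarrow> bool" where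
  "affine_onto g p q r s \<longleftrightarrow> (\<forall>\<theta>\<in>{0..1}. g (p + \<theta> * (q - p)) = r + \<theta> * (s - r))"

lemma affine_onto_comp: "affine_onto g p q r s \<Longrightarrow> affine_onto h r s u v \<Longrightarrow> affine_onto (h \<circ> g) p q u v"
  by (simp add: affine_onto_def)

lemma affine_onto_halves:
  assumes "affine_onto g p q r s"
  shows "affine_onto g p ((p + q) / 2) r ((r + s) / 2)" "affine_onto g ((p + q) / 2) q ((r + s) / 2) s"
proof -
  have *: "g (p + \<theta> * (q - p)) = r + \<theta> * (s - r)" if "\<theta> \<in> {0..1}" for \<theta>
    using assms that by (simp add: affine_onto_def)
  show "affine_onto g p ((p + q) / 2) r ((r + s) / 2)"
    unfolding affine_onto_def
  proof
    fix \<theta> :: real assume "\<theta> \<in> {0..1}"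
    then show "g (p + \<theta> * ((p + q) / 2 - p)) = r + \<theta> * ((r + s) / 2 - r)"
      using *[of "\<theta> / 2"] by (simp add: field_simps)
  qed
  show "affine_onto g ((p + q) / 2) q ((r + s) / 2) s"
    unfolding affine_onto_def
  proof
    fix \<theta> :: real assume \<theta>: "\<theta> \<in> {0..1}"
    have "(p + q) / 2 + \<theta> * (q - (p + q) / 2) = p + ((1 + \<theta>) / 2) * (q - p)"
      "(r + s) / 2 + \<theta> * (s - (r + s) / 2) = r + ((1 + \<theta>) / 2) * (s - r)"
      by (simp_all add: field_simps)
    then show "g ((p + q) / 2 + \<theta> * (q - (p + q) / 2)) = (r + s) / 2 + \<theta> * (s - (r + s) / 2)"
      using *[of "(1 + \<theta>) / 2"] \<theta> by simp
  qed
qed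

lemma affine_ontoI:
  assumes "\<And>x. p \<le> x \<Longrightarrow> x \<le> q \<Longrightarrow> g x = k * x + c" "p \<le> q" "r = k * p + c" "s = k * q + c"
  shows "affine_onto g p q r s"
  unfolding affine_onto_def
proof
  fix \<theta> :: real assume \<theta>: "\<theta> \<in> {0..1}"
  then have "0 \<le> \<theta> * (q - p)" "\<theta> * (q - p) \<le> 1 * (q - p)"
    using assms(2) mult_right_mono[of \<theta> 1 "q - p"] by auto
  then have "g (p + \<theta> * (q - p)) = k * (p + \<theta> * (q - p)) + c" using assms(1) by simp
  then show "g (p + \<theta> * (q - p)) = r + \<theta> * (s - r)" using assms(3,4) by (simp add: algebra_simps)
qed

text \<open>The standard dyadic intervals, which are the vertices of the infinite binary tree; two intervals
  with the same parent are called siblings.\<close>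

definition dyadic_interval :: "real \<Rightarrow> real \<Rightarrow> bool" where
  "dyadic_interval p q \<longleftrightarrow> (\<exists>(m::nat) (j::int). p = of_int j / 2 ^ m \<and> q = of_int (j + 1) / 2 ^ m)"

lemma dyadic_interval_less: "dyadic_interval p q \<Longrightarrow> p < q"
  by (auto simp: dyadic_interval_def divide_strict_right_mono)

lemma dyadic_fraction_eq:
  fixes a b :: int
  assumes "of_int a / 2 ^ l = (of_int b / 2 ^ M :: real)" "l \<le> M"
  shows "b = a * 2 ^ (M - l)"
proof -
  have "(2::real) ^ M = 2 ^ l * 2 ^ (M - l)" using assms(2) by (simp flip: power_add)
  then have "of_int b = (of_int (a * 2 ^ (M - l)) :: real)" using assms(1) by (simp add: field_simps)
  then show ?thesis by (simp only: of_int_eq_iff)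
qed

text \<open>Take the leftmost among the shortest intervals of the partition. If its numerator were odd, the
  interval to its left would be equally short; so the numerator is even. For the same parity reason
  the interval to its right exists and is equally short, and both are halves of one dyadic interval.\<close>

lemma partition_has_siblings:
  fixes b :: "nat \<Rightarrow> real"
  assumes "b 0 = 0" "b (Suc (Suc n)) = 1" "\<And>i. i \<le> Suc n \<Longrightarrow> dyadic_interval (b i) (b (Suc i))"
  obtains i where "i \<le> n" "dyadic_interval (b i) (b (Suc (Suc i)))" "b (Suc i) = (b i + b (Suc (Suc i))) / 2"
proof -
  have "\<forall>i. \<exists>m j. i \<le> Suc n \<longrightarrow> b i = of_int j / 2 ^ (m::nat) \<and> b (Suc i) = of_int (j + 1) / 2 ^ m"
    using assms(3) unfolding dyadic_interval_def by metis
  then obtain level num where ln: "\<And>i. i \<le> Suc n \<Longrightarrow> b i = of_int (num i) / 2 ^ (level i :: nat)"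
      "\<And>i. i \<le> Suc n \<Longrightarrow> b (Suc i) = of_int (num i + 1) / 2 ^ level i"
    by metis
  define M where "M = Max (level ` {..Suc n})"
  have le: "level i \<le> M" if "i \<le> Suc n" for i
    unfolding M_def using that by (intro Max_ge) auto
  have "M \<in> level ` {..Suc n}" unfolding M_def by (intro Max_in) auto
  then have ex: "\<exists>i. i \<le> Suc n \<and> level i = M" by auto
  define i where "i = (LEAST i. i \<le> Suc n \<and> level i = M)"
  have i: "i \<le> Suc n" "level i = M" using LeastI_ex[OF ex] by (auto simp: i_def)
  have least: "level k \<noteq> M" if "k < i" for k
    using not_less_Least[of k "\<lambda>i. i \<le> Suc n \<and> level i = M"] that i by (simp add: i_def)
  have mono: "b k < b (Suc k)" if "k \<le> Suc n" for k using dyadic_interval_less assms(3) that by blast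
  have lift: "b k < b l" if "k < l" "l \<le> Suc (Suc n)" for k l
    using that
  proof (induction l)
    case (Suc l)
    then show ?case using mono[of l] by (cases "k = l") force+
  qed simp
  have "M \<noteq> 0"
  proof
    assume "M = 0"
    then have "level 0 = 0" using le[of 0] by simp
    then have "b 1 = 1" using ln[of 0] assms(1) by simp
    then show False using lift[of 1 "Suc (Suc n)"] assms(2) by simp
  qed
  have even: "even (num i)"
  proof (cases i)
    case 0
    then show ?thesis using ln(1)[of 0] assms(1) by simp
  next
    case (Suc k)
    then have k: "level k < M" using least[of k] le[of k] i by simp
    have "of_int (num k + 1) / 2 ^ level k = (of_int (num i) / 2 ^ M :: real)"
      using ln(2)[of k] ln(1)[of i] i Suc by simp
    then have "num i = (num k + 1) * 2 ^ (M - level k)" using k by (intro dyadic_fraction_eq) auto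
    then show ?thesis using k by simp
  qed
  have "i \<noteq> Suc n"
  proof
    assume "i = Suc n"
    then have "of_int 1 / 2 ^ 0 = (of_int (num i + 1) / 2 ^ M :: real)"
      by (metis assms(2) div_by_1 i(2) ln(2)[OF i(1)] of_int_1 power_0)
    then have "num i + 1 = 1 * 2 ^ (M - 0)" by (rule dyadic_fraction_eq) simp
    then have "even (num i + 1)" using \<open>M \<noteq> 0\<close> by simp
    then show False using even by simp
  qed
  then have i': "i \<le> n" "Suc i \<le> Suc n" using i by auto
  have "of_int (num (Suc i)) / 2 ^ level (Suc i) = (of_int (num i + 1) / 2 ^ M :: real)"
    using ln(2)[of i] ln(1)[of "Suc i"] i i' by simp
  then have eq: "num i + 1 = num (Suc i) * 2 ^ (M - level (Suc i))"
    by (rule dyadic_fraction_eq) (rule le[OF i'(2)])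
  have "M - level (Suc i) = 0"
  proof (rule ccontr)
    assume "M - level (Suc i) \<noteq> 0"
    then have "even (num i + 1)" unfolding eq by simp
    then show False using even by simp
  qed
  then have level: "level (Suc i) = M" "num (Suc i) = num i + 1" using eq le[OF i'(2)] by auto
  obtain N where N: "M = Suc N" using \<open>M \<noteq> 0\<close> by (cases M) auto
  obtain j where j: "num i = 2 * j" using even by blast
  have b: "b i = of_int j / 2 ^ N" "b (Suc (Suc i)) = of_int (j + 1) / 2 ^ N"
    "b (Suc i) = of_int (2 * j + 1) / 2 ^ Suc N"
    using ln(1)[of i] ln(2)[of "Suc i"] ln(2)[of i] level i i' j N by (simp_all add: field_simps)
  show ?thesis
  proof (rule that[OF i'(1)])
    show "dyadic_interval (b i) (b (Suc (Suc i)))" unfolding dyadic_interval_def using b by blast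
    show "b (Suc i) = (b i + b (Suc (Suc i))) / 2" unfolding b by (simp add: field_simps)
  qed
qed

text \<open>The end points of the leaves of the right vine with \<open>n\<close> carets, the binary tree that branches only at its
  rightmost vertex.\<close>

definition vine_pt :: "nat \<Rightarrow> nat \<Rightarrow> real" where
  "vine_pt n i = (if i \<le> n then 1 - 1 / 2 ^ i else 1)"

text \<open>Merge two siblings, the \<open>i\<close>-th and the next interval, and map the coarser partition to the smaller vine
  by induction. The \<open>i\<close>-th leaf of that vine then has to be split again. If it is the last leaf, halving it
  gives the larger vine; otherwise \<open>vine_gen i\<close> stretches its halves to the \<open>i\<close>-th leaf and the next one, and
  shifts all later leaves by one.\<close>

lemma partition_to_vine:
  fixes b :: "nat \<Rightarrow> real"
  assumes "b 0 = 0" "b (Suc n) = 1" "\<And>i. i \<le> n \<Longrightarrow> dyadic_interval (b i) (b (Suc i))"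
  shows "\<exists>g\<in>gen Y. \<forall>i\<le>n. affine_onto g (b i) (b (Suc i)) (vine_pt n i) (vine_pt n (Suc i))"
  using assms
proof (induction n arbitrary: b)
  case 0
  then have "affine_onto id (b 0) (b 1) (vine_pt 0 0) (vine_pt 0 1)" by (simp add: affine_onto_def vine_pt_def)
  then show ?case using gen_id by auto
next
  case (Suc n)
  obtain i where i: "i \<le> n" "dyadic_interval (b i) (b (Suc (Suc i)))" "b (Suc i) = (b i + b (Suc (Suc i))) / 2"
    using partition_has_siblings[OF Suc.prems] by metis
  define b' where "b' k = (if k \<le> i then b k else b (Suc k))" for k
  have "\<exists>g\<in>gen Y. \<forall>k\<le>n. affine_onto g (b' k) (b' (Suc k)) (vine_pt n k) (vine_pt n (Suc k))"
  proof (rule Suc.IH)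
    fix k assume "k \<le> n"
    then show "dyadic_interval (b' k) (b' (Suc k))"
      using i Suc.prems(3)[of k] Suc.prems(3)[of "Suc k"] by (cases k i rule: linorder_cases) (auto simp: b'_def)
  qed (use Suc.prems i in \<open>auto simp: b'_def\<close>)
  then obtain g where g: "g \<in> gen Y" "\<And>k. k \<le> n \<Longrightarrow> affine_onto g (b' k) (b' (Suc k)) (vine_pt n k) (vine_pt n (Suc k))"
    by blast
  have gi: "affine_onto g (b i) (b (Suc (Suc i))) (vine_pt n i) (vine_pt n (Suc i))"
    using g(2)[OF i(1)] by (simp add: b'_def)
  note halves = affine_onto_halves[OF gi, folded i(3)]
  show ?case
  proof (cases "i = n")
    case True
    have "affine_onto g (b k) (b (Suc k)) (vine_pt (Suc n) k) (vine_pt (Suc n) (Suc k))" if k: "k \<le> Suc n" for k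
    proof -
      consider "k < n" | "k = n" | "k = Suc n" using k by linarith
      then show ?thesis
      proof cases
        case 1
        then show ?thesis using g(2)[of k] True by (simp add: b'_def vine_pt_def)
      next
        case 2
        then show ?thesis using halves(1) True by (simp add: vine_pt_def field_simps)
      next
        case 3
        then show ?thesis using halves(2) True by (simp add: vine_pt_def field_simps)
      qed
    qed
    then show ?thesis using g(1) by blast
  next
    case False
    then have "i < n" using i(1) by simp
    define r :: real where "r = 1 / 2 ^ i"
    have r: "r > 0" by (simp add: r_def)
    have yr: "vine_gen i = affine_conj (1 - r) r bump" by (simp add: vine_gen_def r_def)
    have vr: "vine_pt n i = 1 - r" "vine_pt (Suc n) i = 1 - r" "vine_pt n (Suc i) = 1 - r / 2" "vine_pt (Suc n) (Suc i) = 1 - r / 2"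
      "vine_pt (Suc n) (Suc (Suc i)) = 1 - r / 4"
      using \<open>i < n\<close> by (simp_all add: vine_pt_def r_def)
    have "affine_onto (vine_gen i \<circ> g) (b k) (b (Suc k)) (vine_pt (Suc n) k) (vine_pt (Suc n) (Suc k))" if k: "k \<le> Suc n" for k
    proof -
      consider "k < i" | "k = i" | "k = Suc i" | "Suc i < k" using k by linarith
      then show ?thesis
      proof cases
        case 1
        have "vine_pt n (Suc k) \<le> 1 - r"
          using 1 \<open>i < n\<close> power_increasing[of "Suc k" i "2::real"] by (simp add: vine_pt_def r_def field_simps)
        moreover have "vine_pt n k \<le> vine_pt n (Suc k)" using 1 \<open>i < n\<close> by (simp add: vine_pt_def field_simps)
        ultimately have "affine_onto (vine_gen i) (vine_pt n k) (vine_pt n (Suc k)) (vine_pt n k) (vine_pt n (Suc k))"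
          by (intro affine_ontoI[of _ _ _ 1 0]) (auto simp: yr intro!: affine_conj_bump(1)[OF r])
        then show ?thesis using affine_onto_comp[OF g(2)[of k]] 1 \<open>i < n\<close> by (simp add: b'_def vine_pt_def)
      next
        case 2
        have "affine_onto (vine_gen i) (vine_pt n i) ((vine_pt n i + vine_pt n (Suc i)) / 2) (vine_pt n i) (vine_pt n (Suc i))"
          using r by (intro affine_ontoI[of _ _ _ 2 "- (1 - r)"]) (simp_all add: yr vr affine_conj_bump(2)[OF r] diff_divide_distrib)
        then show ?thesis using affine_onto_comp[OF halves(1)] 2 by (simp add: vr)
      next
        case 3
        have "affine_onto (vine_gen i) ((vine_pt n i + vine_pt n (Suc i)) / 2) (vine_pt n (Suc i)) (vine_pt n (Suc i)) (vine_pt (Suc n) (Suc (Suc i)))"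
          using r by (intro affine_ontoI[of _ _ _ 1 "r / 4"]) (simp_all add: yr vr affine_conj_bump(3)[OF r] diff_divide_distrib)
        then show ?thesis using affine_onto_comp[OF halves(2)] 3 by (simp add: vr)
      next
        case 4
        then obtain l where l: "k = Suc l" "i < l" by (cases k) auto
        then have ln: "l \<le> n" using k by simp
        have "(2::real) ^ Suc i \<le> 2 ^ l" using l by (intro power_increasing) auto
        then have "1 - r / 2 \<le> vine_pt n l" using ln by (simp add: vine_pt_def r_def field_simps)
        moreover have "vine_pt n l \<le> vine_pt n (Suc l)" "vine_pt n (Suc l) \<le> 1" using ln by (auto simp: vine_pt_def field_simps)
        moreover have "vine_pt (Suc n) (Suc l) = (1 + vine_pt n l) / 2" "vine_pt (Suc n) (Suc (Suc l)) = (1 + vine_pt n (Suc l)) / 2"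
          using ln by (auto simp: vine_pt_def field_simps)
        ultimately have "affine_onto (vine_gen i) (vine_pt n l) (vine_pt n (Suc l)) (vine_pt (Suc n) (Suc l)) (vine_pt (Suc n) (Suc (Suc l)))"
          by (intro affine_ontoI[of _ _ _ "1/2" "1/2"]) (simp_all add: yr affine_conj_bump(4)[OF r])
        then show ?thesis using affine_onto_comp[OF g(2)[OF ln]] l by (simp add: b'_def)
      qed
    qed
    then show ?thesis using gen_comp[OF vine_gen_in_gen g(1)] by blast
  qed
qed

lemma Th_dyadic:
  assumes "\<phi> \<in> Th" "x \<in> dyadic" "0 \<le> x" "x \<le> 1"
  shows "\<phi> x \<in> dyadic"
proof -
  obtain B where "PL_breaks \<phi> B" using Th_obtain_breaks[OF assms(1)] by blast
  then show ?thesis using PL_breaks_dyadic_iff[of \<phi> B x] Th_fix[OF assms(1), of 0] assms by simp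
qed

lemma dyadic_eventually_int:
  assumes "d \<in> dyadic" shows "eventually (\<lambda>n. d * 2 ^ n \<in> \<int>) sequentially"
proof -
  obtain m k where d: "d = of_int m / 2 ^ k" using assms by (auto simp: dyadic_def)
  show ?thesis unfolding eventually_sequentially
  proof (intro exI[of _ k] allI impI)
    fix n assume "k \<le> n"
    then have "(2::real) ^ n = 2 ^ k * 2 ^ (n - k)" by (simp flip: power_add)
    then have "d * 2 ^ n = of_int (m * 2 ^ (n - k))" by (simp add: d)
    then show "d * 2 ^ n \<in> \<int>" using Ints_of_int by metis
  qed
qed

text \<open>For large \<open>n\<close> all breakpoints are multiples of \<open>1 / 2 ^ n\<close>. On each piece \<open>\<phi> x = 2 powi k * x + c\<close> with dyadic
  \<open>c\<close>, and \<open>c\<close> is a multiple of \<open>2 powi k / 2 ^ n\<close> for large \<open>n\<close>, so that the images of the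
  intervals of length \<open>1 / 2 ^ n\<close> are standard dyadic intervals.\<close>

lemma Th_uniform_partition:
  assumes "\<phi> \<in> Th"
  obtains n :: nat where "\<And>l. l < 2 ^ n \<Longrightarrow> dyadic_interval (\<phi> (real l / 2 ^ n)) (\<phi> (real (Suc l) / 2 ^ n)) \<and>
     (\<exists>k c. \<forall>x. real l / 2 ^ n \<le> x \<and> x \<le> real (Suc l) / 2 ^ n \<longrightarrow> \<phi> x = k * x + c)"
proof -
  obtain B where B: "PL_breaks \<phi> B" using Th_obtain_breaks[OF assms] by blast
  then have fin: "finite B" "B \<subseteq> dyadic" by (auto simp: PL_breaks_def)
  have "eventually (\<lambda>n. \<forall>d\<in>B. d * 2 ^ n \<in> \<int>) sequentially"
    using fin dyadic_eventually_int by (intro eventually_ball_finite) auto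
  then obtain n0 where n0: "\<And>d. d \<in> B \<Longrightarrow> d * 2 ^ n0 \<in> \<int>" by (auto simp: eventually_sequentially)
  have "\<exists>(k::int) c. \<forall>x\<in>{real i / 2 ^ n0..real (Suc i) / 2 ^ n0}. \<phi> x = 2 powi k * x + c" if "i < 2 ^ n0" for i
  proof -
    have "{real i / 2 ^ n0<..<real (Suc i) / 2 ^ n0} \<inter> B = {}"
    proof -
      have False if d: "d \<in> B" "real i / 2 ^ n0 < d" "d < real (Suc i) / 2 ^ n0" for d
      proof -
        obtain z where z: "d * 2 ^ n0 = of_int z" using n0[OF d(1)] by (auto elim: Ints_cases)
        have "real i < d * 2 ^ n0" "d * 2 ^ n0 < real (Suc i)" using d by (auto simp: field_simps)
        then have "int i < z" "z < int i + 1" unfolding z by linarith+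
        then show False by simp
      qed
      then show ?thesis by auto
    qed
    moreover have "real (Suc i) \<le> 2 ^ n0" using that by (metis Suc_leI of_nat_le_iff of_nat_numeral of_nat_power)
    moreover have "0 \<le> real i / 2 ^ n0" "real i / 2 ^ n0 < real (Suc i) / 2 ^ n0"
      by (simp_all add: divide_strict_right_mono)
    moreover have "real (Suc i) / 2 ^ n0 \<le> 1" using \<open>real (Suc i) \<le> 2 ^ n0\<close> by simp
    ultimately show ?thesis using B unfolding PL_breaks_def by blast
  qed
  then obtain k c where kc: "\<And>i x. i < 2 ^ n0 \<Longrightarrow> x \<in> {real i / 2 ^ n0..real (Suc i) / 2 ^ n0} \<Longrightarrow>
      \<phi> x = 2 powi (k i :: int) * x + c i" by metis
  have cd: "2 powi (- k i) * c i \<in> dyadic" if "i < 2 ^ n0" for i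
  proof -
    have x: "real i / 2 ^ n0 \<in> dyadic" unfolding dyadic_def by (auto intro: exI[of _ "int i"])
    have "real i \<le> 2 ^ n0" using that by (metis less_imp_le of_nat_le_iff of_nat_numeral of_nat_power)
    then have "\<phi> (real i / 2 ^ n0) \<in> dyadic" using Th_dyadic[OF assms x] by simp
    moreover have "c i = \<phi> (real i / 2 ^ n0) - 2 powi k i * (real i / 2 ^ n0)"
      using kc[OF that, of "real i / 2 ^ n0"] by (simp add: divide_right_mono)
    ultimately have "c i \<in> dyadic" using dyadic_diff dyadic_scale x by metis
    then show ?thesis by (rule dyadic_scale)
  qed
  have "eventually (\<lambda>n. \<forall>i\<in>{..<2 ^ n0}. (2 powi (- k i) * c i) * 2 ^ n \<in> \<int>) sequentially"
    using cd dyadic_eventually_int by (intro eventually_ball_finite) auto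
  then obtain n where n: "n0 \<le> n" "\<And>i. i < 2 ^ n0 \<Longrightarrow> (2 powi (- k i) * c i) * 2 ^ n \<in> \<int>"
    unfolding eventually_sequentially by (metis le_cases lessThan_iff)
  show ?thesis
  proof (rule that[of n])
    fix l :: nat assume l: "l < 2 ^ n"
    define i where "i = l div 2 ^ (n - n0)"
    have pw: "(2::nat) ^ n = 2 ^ n0 * 2 ^ (n - n0)" "(2::real) ^ n = 2 ^ n0 * 2 ^ (n - n0)"
      using n(1) by (simp_all flip: power_add)
    have i: "i < 2 ^ n0" using l unfolding i_def pw by (simp add: less_mult_imp_div_less)
    have "i * 2 ^ (n - n0) \<le> l" "Suc l \<le> Suc i * 2 ^ (n - n0)"
      unfolding i_def using dividend_less_div_times[of "2 ^ (n - n0)" l] by (auto simp: algebra_simps)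
    then have "real (i * 2 ^ (n - n0)) \<le> real l" "real (Suc l) \<le> real (Suc i * 2 ^ (n - n0))"
      using of_nat_le_iff by blast+
    moreover have "real i / 2 ^ n0 = real (i * 2 ^ (n - n0)) / 2 ^ n"
      "real (Suc i) / 2 ^ n0 = real (Suc i * 2 ^ (n - n0)) / 2 ^ n"
      unfolding pw of_nat_mult by simp_all
    ultimately have "real i / 2 ^ n0 \<le> real l / 2 ^ n" "real (Suc l) / 2 ^ n \<le> real (Suc i) / 2 ^ n0"
      by (simp_all only: divide_right_mono zero_le_power zero_le_numeral)
    then have aff: "\<phi> x = 2 powi k i * x + c i" if "real l / 2 ^ n \<le> x" "x \<le> real (Suc l) / 2 ^ n" for x
      using kc[OF i, of x] that by simp
    obtain z where z: "2 powi (- k i) * c i * 2 ^ n = of_int z" using n(2)[OF i] by (auto elim: Ints_cases)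
    have ci: "c i = 2 powi k i * of_int z / 2 ^ n"
      by (simp add: z[symmetric] power_int_minus)
    have "real l / 2 ^ n \<le> real (Suc l) / 2 ^ n" by (simp add: divide_right_mono)
    then have v: "\<phi> (real l / 2 ^ n) = 2 powi k i * of_int (int l + z) / 2 ^ n"
      "\<phi> (real (Suc l) / 2 ^ n) = 2 powi k i * of_int (int l + z + 1) / 2 ^ n"
      using aff[of "real l / 2 ^ n"] aff[of "real (Suc l) / 2 ^ n"] unfolding ci
      by (simp_all add: field_simps)
    have sl: "real (Suc l) \<le> 2 ^ n" using l by (metis Suc_leI of_nat_le_iff of_nat_numeral of_nat_power)
    have "0 \<le> \<phi> (real l / 2 ^ n)" "\<phi> (real (Suc l) / 2 ^ n) \<le> 1"
      using assms sl by (simp_all add: divide_le_eq)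
    then have "\<phi> (real (Suc l) / 2 ^ n) - \<phi> (real l / 2 ^ n) \<le> 1" by linarith
    then have "2 powi k i / 2 ^ n \<le> (1::real)" unfolding v by (simp add: field_simps)
    then have "2 powi k i \<le> (2::real) powi int n" by (simp add: power_int_def)
    then have kn: "k i \<le> int n" using power_int_strict_increasing[of "int n" "k i" "2::real"] by linarith
    define m where "m = nat (int n - k i)"
    have "2 powi k i / 2 ^ n = (1 / 2 ^ m :: real)"
    proof -
      have "2 powi k i * 2 ^ m = (2::real) powi (k i + int m)" by (simp add: power_int_add)
      also have "k i + int m = int n" using kn by (simp add: m_def)
      finally show ?thesis by (simp add: field_simps)
    qed
    then have "2 powi k i * y / 2 ^ n = y / 2 ^ m" for y :: real
      by (metis mult.commute mult_1 times_divide_eq_left times_divide_eq_right)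
    then have "dyadic_interval (\<phi> (real l / 2 ^ n)) (\<phi> (real (Suc l) / 2 ^ n))"
      unfolding dyadic_interval_def v by blast
    then show "dyadic_interval (\<phi> (real l / 2 ^ n)) (\<phi> (real (Suc l) / 2 ^ n)) \<and>
       (\<exists>k c. \<forall>x. real l / 2 ^ n \<le> x \<and> x \<le> real (Suc l) / 2 ^ n \<longrightarrow> \<phi> x = k * x + c)"
      using aff by blast
  qed
qed

text \<open>A fine uniform partition and its image under \<open>\<phi>\<close> are carried onto the same vine by elements \<open>g\<close> and \<open>h\<close> of
  the generated group. Then \<open>h \<circ> \<phi>\<close> and \<open>g\<close> agree on each interval of the partition.\<close>

lemma gen_vine_gens: "gen Y = Th"
proof
  show "gen Y \<subseteq> Th" using gen_Th[OF Y_subset_Th] by blast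
  show "Th \<subseteq> gen Y"
  proof
    fix \<phi> assume \<phi>: "\<phi> \<in> Th"
    obtain n :: nat where n: "\<And>l. l < 2 ^ n \<Longrightarrow> dyadic_interval (\<phi> (real l / 2 ^ n)) (\<phi> (real (Suc l) / 2 ^ n)) \<and>
     (\<exists>k c. \<forall>x. real l / 2 ^ n \<le> x \<and> x \<le> real (Suc l) / 2 ^ n \<longrightarrow> \<phi> x = k * x + c)"
      using Th_uniform_partition[OF \<phi>] by blast
    define N where "N = 2 ^ n - (1::nat)"
    have N: "Suc N = 2 ^ n" by (simp add: N_def)
    define b where "b l = real l / 2 ^ n" for l
    have ends: "b 0 = 0" "b (Suc N) = 1" unfolding b_def N by simp_all
    have "dyadic_interval (b l) (b (Suc l))" for l
      unfolding dyadic_interval_def b_def by (intro exI[of _ n] exI[of _ "int l"]) simp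
    then obtain g where g: "g \<in> gen Y" "\<And>i. i \<le> N \<Longrightarrow> affine_onto g (b i) (b (Suc i)) (vine_pt N i) (vine_pt N (Suc i))"
      using partition_to_vine[of b N] ends by blast
    have "\<And>i. i \<le> N \<Longrightarrow> dyadic_interval (\<phi> (b i)) (\<phi> (b (Suc i)))" using n N by (metis b_def less_Suc_eq_le)
    then obtain h where h: "h \<in> gen Y" "\<And>i. i \<le> N \<Longrightarrow> affine_onto h (\<phi> (b i)) (\<phi> (b (Suc i))) (vine_pt N i) (vine_pt N (Suc i))"
      using partition_to_vine[of "\<lambda>i. \<phi> (b i)" N] ends Th_fix[OF \<phi>] by auto
    have gT: "g \<in> Th" "h \<in> Th" using g(1) h(1) gen_Th[OF Y_subset_Th] by auto
    have "h (\<phi> x) = g x" for x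
    proof (cases "0 \<le> x \<and> x < 1")
      case False
      then show ?thesis using Th_fix[OF \<phi>, of x] Th_fix[OF gT(1), of x] Th_fix[OF gT(2), of x] by auto
    next
      case True
      define l where "l = nat \<lfloor>x * 2 ^ n\<rfloor>"
      have "0 \<le> x * 2 ^ n" using True by simp
      then have l: "real l \<le> x * 2 ^ n" "x * 2 ^ n < real l + 1" unfolding l_def by linarith+
      have "x * 2 ^ n < 2 ^ n" using True by simp
      then have "real l < 2 ^ n" using l(1) by (rule order.strict_trans1[rotated])
      then have lN: "l < 2 ^ n" by (metis of_nat_less_iff of_nat_numeral of_nat_power)
      define \<theta> where "\<theta> = x * 2 ^ n - real l"
      have \<theta>: "\<theta> \<in> {0..1}" using l by (auto simp: \<theta>_def)
      have "x = b l + \<theta> * (b (Suc l) - b l)" by (simp add: \<theta>_def b_def field_simps)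
      moreover have "affine_onto \<phi> (b l) (b (Suc l)) (\<phi> (b l)) (\<phi> (b (Suc l)))"
      proof -
        obtain k c where "\<And>x. b l \<le> x \<Longrightarrow> x \<le> b (Suc l) \<Longrightarrow> \<phi> x = k * x + c"
          using n[OF lN] unfolding b_def by blast
        moreover have "b l \<le> b (Suc l)" by (simp add: b_def divide_right_mono)
        ultimately show ?thesis by (intro affine_ontoI[of _ _ _ k c]) auto
      qed
      then have "affine_onto (h \<circ> \<phi>) (b l) (b (Suc l)) (vine_pt N l) (vine_pt N (Suc l))"
        using h(2)[of l] lN N affine_onto_comp by auto
      ultimately show ?thesis using g(2)[of l] \<theta> lN N by (simp add: affine_onto_def)
    qed
    then have "\<phi> = minv h \<circ> g" using gT by (auto simp: fun_eq_iff) (metis Th_minv_f)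
    then show "\<phi> \<in> gen Y" using g(1) h(1) gen_comp gen_minv[OF Y_subset_Th] by simp
  qed
qed

lemma pi_ab_vine_gen_1: "pi_ab (vine_gen 1) = (0, -1)"
proof (rule pi_ab_germs(3)[of "1/4"])
  show "vine_gen 1 x = 2 powi 0 * x" if "x \<in> {0..1/4}" for x
    using that affine_conj_bump(1)[of "1/2" x] by (simp add: vine_gen_def)
  show "vine_gen 1 x = 1 - 2 powi (- 1) * (1 - x)" if "x \<in> {1 - 1/4..1}" for x
    using that affine_conj_bump(4)[of "1/2" x] by (simp add: vine_gen_def power_int_minus field_simps)
qed simp

section \<open>Pushing points\<close>

lemma bump_gt: "0 < x \<Longrightarrow> x < 1 \<Longrightarrow> x < bump x"
  by (auto simp: bump_def field_simps)

lemma affine_bump_gt: "0 < L \<Longrightarrow> c < x \<Longrightarrow> x < c + L \<Longrightarrow> x < affine_conj c L bump x"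
  using bump_gt[of "(x - c) / L"] by (simp add: affine_conj_def field_simps)

text \<open>The iterates increase; a bound \<open>z < q\<close> would make them converge to a fixed point in \<open>{y..z}\<close>.\<close>

lemma push_up:
  assumes "\<phi> \<in> Th" "\<phi> q = q" "\<And>x. y \<le> x \<Longrightarrow> x < q \<Longrightarrow> x < \<phi> x" "y < q" "z < q"
  shows "\<exists>n. z < (\<phi> ^^ n) y"
proof (rule ccontr)
  assume "\<not> (\<exists>n. z < (\<phi> ^^ n) y)"
  then have le: "(\<phi> ^^ n) y \<le> z" for n by (meson not_le)
  define s where "s n = (\<phi> ^^ n) y" for n
  have ge: "y \<le> s n" for n
  proof (induction n)
    case (Suc n)
    then show ?case using assms(3)[of "s n"] le[of n] assms(5) by (simp add: s_def)
  qed (simp add: s_def)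
  have "s n \<le> s (Suc n)" for n
    using assms(3)[of "s n"] le[of n] assms(5) ge[of n] by (simp add: s_def)
  then have inc: "incseq s" by (simp add: incseq_SucI)
  obtain l where l: "s \<longlonglongrightarrow> l" "\<And>n. s n \<le> l"
    using incseq_convergent[OF inc, of z] le by (auto simp: s_def)
  have "l \<le> z" using l(1) le by (intro LIMSEQ_le_const2[OF l(1)]) (auto simp: s_def)
  have "y \<le> l" using ge l(2) order_trans by blast
  have "(\<lambda>n. \<phi> (s n)) \<longlonglongrightarrow> \<phi> l"
    using continuous_on_tendsto_compose[OF Th_continuous[OF assms(1), of UNIV] l(1)] by simp
  moreover have "(\<lambda>n. \<phi> (s n)) \<longlonglongrightarrow> l"
    using LIMSEQ_Suc[OF l(1)] by (simp add: s_def)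
  ultimately have "\<phi> l = l" using LIMSEQ_unique by blast
  then show False using assms(3)[of l] \<open>y \<le> l\<close> \<open>l \<le> z\<close> assms(5) by simp
qed

lemma flip_funpow: "(flip \<phi> ^^ n) x = 1 - (\<phi> ^^ n) (1 - x)"
  by (induction n) (auto simp: flip_def)

lemma push_down:
  assumes "\<phi> \<in> Th" "\<phi> p = p" "\<And>x. p < x \<Longrightarrow> x \<le> y \<Longrightarrow> \<phi> x < x" "p < y" "p < z"
  shows "\<exists>n. (\<phi> ^^ n) y < z"
proof -
  have "\<exists>n. 1 - z < (flip \<phi> ^^ n) (1 - y)"
  proof (rule push_up[OF flip_Th[OF assms(1)], of "1 - p"])
    fix x assume "1 - y \<le> x" "x < 1 - p"
    then show "x < flip \<phi> x" using assms(3)[of "1 - x"] by (simp add: flip_def)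
  qed (use assms(2,4,5) in \<open>auto simp: flip_def\<close>)
  then show ?thesis by (auto simp: flip_funpow)
qed

lemma funpow_fix: "f x = x \<Longrightarrow> (f ^^ n) x = x"
  by (induction n) auto

lemma Th_push:
  assumes "0 \<le> p" "p < y" "y < z" "z < q" "q \<le> 1"
  obtains \<psi> where "\<psi> \<in> Th" "\<And>x. x \<le> p \<or> q \<le> x \<Longrightarrow> \<psi> x = x" "z < \<psi> y"
proof -
  obtain p' where p': "p' \<in> dyadic" "p < p'" "p' < y" using dyadic_between[OF assms(2)] .
  obtain q' where q': "q' \<in> dyadic" "z < q'" "q' < q" using dyadic_between[OF assms(4)] .
  define \<beta> where "\<beta> = affine_conj p' (q' - p') bump"
  have L: "0 < q' - p'" using p' q' assms by auto
  have \<beta>: "\<beta> \<in> Th" unfolding \<beta>_def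
    by (rule affine_conj_Th_shrink[OF bump_Th]) (use p' q' assms in \<open>auto intro: dyadic_diff\<close>)
  have out: "\<beta> x = x" if "x \<le> p' \<or> q' \<le> x" for x
    unfolding \<beta>_def by (rule affine_conj_outside[OF bump_Th L]) (use that in auto)
  have "\<exists>n. z < (\<beta> ^^ n) y"
  proof (rule push_up[OF \<beta>, of q'])
    fix x assume "y \<le> x" "x < q'"
    then show "x < \<beta> x" unfolding \<beta>_def using affine_bump_gt[OF L, of p' x] p' by simp
  qed (use out[of q'] p' q' assms in auto)
  then obtain n where "z < (\<beta> ^^ n) y" by blast
  moreover have "(\<beta> ^^ n) x = x" if "x \<le> p \<or> q \<le> x" for x
    by (rule funpow_fix) (use out[of x] that p' q' in auto)
  ultimately show ?thesis using that Th_funpow[OF \<beta>] by blast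
qed

section \<open>Criteria for a subgroup to be the whole group\<close>

lemma Th_conj_support:
  assumes "h \<in> Th" "\<phi> \<in> Th" "\<And>x. x \<le> h a \<or> h b \<le> x \<Longrightarrow> \<phi> x = x" "x \<le> a \<or> b \<le> x"
  shows "(minv h \<circ> \<phi> \<circ> h) x = x"
  using assms(3)[of "h x"] assms(1,4) Th_le_iff[OF assms(1)] by auto

text \<open>An element of the subgroup that moves \<open>J = {j1..j2}\<close> to an interval \<open>J'\<close> conjugates the elements supported in
  \<open>J\<close> to those supported in \<open>J'\<close>, so these belong to the subgroup as well. Let \<open>b\<close> be the supremum of the
  upper ends of images of \<open>J\<close> whose lower end does not exceed \<open>j1\<close>. If \<open>b < 1\<close>, some image of \<open>J\<close> contains \<open>b\<close> in
  its interior, and an element supported in it pushes an upper end close to \<open>b\<close> beyond \<open>b\<close> without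
  moving the lower end. So the upper end comes arbitrarily close to \<open>1\<close>. In the same way the lower end comes
  arbitrarily close to \<open>0\<close> while the upper end stays above a given bound.\<close>

lemma compact_support_in_gen:
  assumes S: "S \<subseteq> Th" and j: "0 < j1" "j1 < j2" "j2 < 1"
    and J: "\<And>\<phi>. \<phi> \<in> Th \<Longrightarrow> (\<And>x. x \<le> j1 \<or> j2 \<le> x \<Longrightarrow> \<phi> x = x) \<Longrightarrow> \<phi> \<in> gen S"
    and orbit: "\<And>x. 0 < x \<Longrightarrow> x < 1 \<Longrightarrow> \<exists>h\<in>gen S. j1 < h x \<and> h x < j2"
    and \<phi>: "\<phi> \<in> Th" "0 < e" "e < 1/2" "\<And>x. x \<le> e \<or> 1 - e \<le> x \<Longrightarrow> \<phi> x = x"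
  shows "\<phi> \<in> gen S"
proof -
  let ?H = "gen S"
  have HT: "h \<in> Th" if "h \<in> ?H" for h using gen_Th[OF S that] .
  have transported: "\<psi> \<in> ?H" if h: "h \<in> ?H" and \<psi>: "\<psi> \<in> Th"
    and out: "\<And>x. x \<le> h j1 \<or> h j2 \<le> x \<Longrightarrow> \<psi> x = x" for h \<psi>
  proof -
    have hT: "h \<in> Th" using HT[OF h] .
    have "minv h \<circ> \<psi> \<circ> h \<in> ?H"
    proof (rule J)
      show "minv h \<circ> \<psi> \<circ> h \<in> Th" using hT \<psi> by (intro Th_comp Th_minv)
      show "(minv h \<circ> \<psi> \<circ> h) x = x" if "x \<le> j1 \<or> j2 \<le> x" for x
        by (rule Th_conj_support[OF hT \<psi> out that])
    qed
    then have "h \<circ> (minv h \<circ> \<psi> \<circ> h) \<circ> minv h \<in> ?H"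
      by (rule gen_comp[OF gen_comp[OF h] gen_minv[OF S h]])
    moreover have "h \<circ> (minv h \<circ> \<psi> \<circ> h) \<circ> minv h = \<psi>" using hT by (auto simp: fun_eq_iff)
    ultimately show ?thesis by simp
  qed
  have near: "\<exists>h\<in>?H. h j1 < x \<and> x < h j2" if x: "0 < x" "x < 1" for x
  proof -
    obtain k where k: "k \<in> ?H" "j1 < k x" "k x < j2" using orbit[OF x] by blast
    have "minv k \<in> ?H" using gen_minv[OF S k(1)] .
    moreover have "minv k j1 < x \<and> x < minv k j2"
      using Th_less_iff[OF HT[OF k(1)], of "minv k j1" x] Th_less_iff[OF HT[OF k(1)], of x "minv k j2"] k HT[OF k(1)]
      by simp
    ultimately show ?thesis by blast
  qed
  \<comment> \<open>The maximum with \<open>h j1\<close> keeps the lower end fixed while the upper end is pushed.\<close>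
  have up: "\<exists>h\<in>?H. h j1 \<le> j1 \<and> z < h j2" if z: "z < 1" for z
  proof (rule ccontr)
    assume neg: "\<not> (\<exists>h\<in>?H. h j1 \<le> j1 \<and> z < h j2)"
    define B where "B = {h j2 | h. h \<in> ?H \<and> h j1 \<le> j1}"
    have bdd: "bdd_above B" using neg unfolding B_def by (intro bdd_aboveI[of _ z]) force
    have "j2 \<in> B" unfolding B_def using gen_id[of S] by (auto intro!: exI[of _ id])
    define b where "b = Sup B"
    have ub: "x \<le> b" if "x \<in> B" for x using cSup_upper[OF that bdd] by (simp add: b_def)
    have "b \<le> z" unfolding b_def using \<open>j2 \<in> B\<close> neg by (intro cSup_least) (auto simp: B_def not_less)
    then have b01: "0 < b" "b < 1" using ub[OF \<open>j2 \<in> B\<close>] j z by auto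
    obtain k where k: "k \<in> ?H" "k j1 < b" "b < k j2" using near[OF b01] by blast
    obtain h where h: "h \<in> ?H" "h j1 \<le> j1" "k j1 < h j2"
      using less_cSupE[of "k j1" B] k(2) \<open>j2 \<in> B\<close> unfolding b_def B_def by blast
    have hb: "h j2 \<le> b" using ub h unfolding B_def by blast
    have p: "max (k j1) (h j1) < h j2" using h(3) Th_less_iff[OF HT[OF h(1)]] j(2) by simp
    obtain \<psi> where \<psi>: "\<psi> \<in> Th" "\<And>x. x \<le> max (k j1) (h j1) \<or> k j2 \<le> x \<Longrightarrow> \<psi> x = x"
      "(b + k j2) / 2 < \<psi> (h j2)"
      using Th_push[of "max (k j1) (h j1)" "h j2" "(b + k j2) / 2" "k j2"] p hb k(3) j HT[OF k(1)] HT[OF h(1)]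
      by (auto simp: less_imp_le max_def)
    have "\<psi> \<in> ?H" by (rule transported[OF k(1) \<psi>(1)]) (use \<psi>(2) in \<open>auto simp: le_max_iff_disj min_le_iff_disj\<close>)
    then have "\<psi> \<circ> h \<in> ?H" using h(1) gen_comp by blast
    moreover have "(\<psi> \<circ> h) j1 \<le> j1" using \<psi>(2)[of "h j1"] h(2) by simp
    ultimately have "\<psi> (h j2) \<in> B" unfolding B_def by (auto intro!: exI[of _ "\<psi> \<circ> h"])
    then show False using ub \<psi>(3) k(3) by fastforce
  qed
  have down: "\<exists>h\<in>?H. h j1 < w \<and> z < h j2" if z: "z < 1" and w: "0 < w" for z w
  proof (rule ccontr)
    assume neg: "\<not> (\<exists>h\<in>?H. h j1 < w \<and> z < h j2)"
    define A where "A = {h j1 | h. h \<in> ?H \<and> z < h j2}"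
    have bdd: "bdd_below A" using neg unfolding A_def by (intro bdd_belowI[of _ w]) force
    obtain h0 where h0: "h0 \<in> ?H" "h0 j1 \<le> j1" "z < h0 j2" using up[OF z] by blast
    then have "h0 j1 \<in> A" unfolding A_def by blast
    define a where "a = Inf A"
    have lb: "a \<le> x" if "x \<in> A" for x using cInf_lower[OF that bdd] by (simp add: a_def)
    have "w \<le> a" unfolding a_def using \<open>h0 j1 \<in> A\<close> neg by (intro cInf_greatest) (auto simp: A_def not_less)
    then have a01: "0 < a" "a < 1" using lb[OF \<open>h0 j1 \<in> A\<close>] h0(2) j w by auto
    obtain k where k: "k \<in> ?H" "k j1 < a" "a < k j2" using near[OF a01] by blast
    obtain h where h: "h \<in> ?H" "z < h j2" "h j1 < k j2"
      using cInf_lessD[of A "k j2"] k(3) \<open>h0 j1 \<in> A\<close> unfolding a_def A_def by blast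
    have ha: "a \<le> h j1" using lb h unfolding A_def by blast
    have q: "h j1 < min (k j2) (h j2)" using h(3) Th_less_iff[OF HT[OF h(1)]] j(2) by simp
    obtain \<psi> where \<psi>: "\<psi> \<in> Th" "\<And>x. x \<le> k j1 \<or> min (k j2) (h j2) \<le> x \<Longrightarrow> \<psi> x = x"
      "h j1 < \<psi> ((k j1 + a) / 2)"
      using Th_push[of "k j1" "(k j1 + a) / 2" "h j1" "min (k j2) (h j2)"] q ha k(2) j HT[OF k(1)] HT[OF h(1)]
      by (auto simp: less_imp_le min_def split: if_splits)
    have "\<psi> \<in> ?H" by (rule transported[OF k(1) \<psi>(1)]) (use \<psi>(2) in \<open>auto simp: le_max_iff_disj min_le_iff_disj\<close>)
    then have "minv \<psi> \<circ> h \<in> ?H" using h(1) gen_comp gen_minv[OF S] by blast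
    moreover have "(minv \<psi> \<circ> h) j2 = h j2" using \<psi>(2)[of "h j2"] minv_eq_iff[OF \<psi>(1)] by simp
    ultimately have "minv \<psi> (h j1) \<in> A" unfolding A_def using h(2) by (auto intro!: exI[of _ "minv \<psi> \<circ> h"])
    then have "a \<le> minv \<psi> (h j1)" by (rule lb)
    moreover have "minv \<psi> (h j1) < (k j1 + a) / 2"
      using \<psi>(1,3) Th_less_iff[OF \<psi>(1), of "minv \<psi> (h j1)" "(k j1 + a) / 2"] by simp
    ultimately show False using k(2) by simp
  qed
  obtain h where h: "h \<in> ?H" "h j1 < e" "1 - e < h j2" using down[of "1 - e" e] \<phi>(2) by auto
  show ?thesis by (rule transported[OF h(1) \<phi>(1)]) (use \<phi>(4) h in auto)
qed

text \<open>Every \<open>\<phi>\<close> differs from an element of the subgroup with the same slopes at the end points by an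
  element of the kernel.\<close>

lemma gen_eq_Th:
  assumes "S \<subseteq> Th" "generate Z2 (pi_ab ` S) = UNIV"
    and ker: "\<And>\<phi>. \<phi> \<in> Th \<Longrightarrow> pi_ab \<phi> = (0, 0) \<Longrightarrow> \<phi> \<in> gen S"
  shows "gen S = Th"
proof
  show "gen S \<subseteq> Th" using gen_Th[OF assms(1)] by blast
  show "Th \<subseteq> gen S"
  proof
    fix \<phi> assume \<phi>: "\<phi> \<in> Th"
    have "pi_ab ` gen S = UNIV"
      using group_hom.generate_img[OF pi_ab_group_hom, of S] assms(1,2) by simp
    then obtain h where h: "h \<in> gen S" "pi_ab h = pi_ab \<phi>" by (metis UNIV_I imageE)
    then have hT: "h \<in> Th" using gen_Th[OF assms(1)] by blast
    have "pi_ab (minv h \<circ> \<phi>) = (0, 0)"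
      using pi_ab_comp[OF Th_minv[OF hT] \<phi>] pi_ab_minv[OF hT] h(2) by simp
    then have "minv h \<circ> \<phi> \<in> gen S" using ker Th_comp Th_minv hT \<phi> by blast
    then have "h \<circ> (minv h \<circ> \<phi>) \<in> gen S" using h(1) gen_comp by blast
    then show "\<phi> \<in> gen S" using hT by (simp flip: comp_assoc)
  qed
qed

section \<open>Recovering two generators from shifted copies\<close>

lemma (in group) commutes_int_pow:
  assumes "x \<otimes> y = y \<otimes> x" "x \<in> carrier G" "y \<in> carrier G"
  shows "x \<otimes> y [^] (n::int) = y [^] n \<otimes> x"
proof (cases "n < 0")
  case False
  then show ?thesis unfolding int_pow_def2 using group_commutes_pow[OF assms(1)[symmetric] assms(3,2), of "nat n"] by simp
next
  case True
  define z where "z = y [^] nat (- n)"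
  have z: "z \<in> carrier G" "z \<otimes> x = x \<otimes> z"
    unfolding z_def using group_commutes_pow[OF assms(1)[symmetric] assms(3,2)] assms(3) by simp_all
  have "inv z \<otimes> x = inv z \<otimes> (x \<otimes> z) \<otimes> inv z" using z(1) assms(2) by (simp add: m_assoc)
  also have "\<dots> = inv z \<otimes> (z \<otimes> x) \<otimes> inv z" unfolding z(2) ..
  also have "\<dots> = x \<otimes> inv z" using z(1) assms(2) by (simp flip: m_assoc)
  finally show ?thesis unfolding int_pow_def2 using True by (simp add: z_def)
qed

text \<open>Multiplying a homomorphism by commuting elements raised to additive exponents gives a homomorphism again. Where
  the exponents vanish it agrees with the original one, so that unwanted factors \<open>r\<^sub>1\<close> and \<open>r\<^sub>2\<close> attached
  to two generators disappear on the common kernel of the exponents.\<close>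

lemma (in group) twisted_hom:
  fixes \<chi>\<^sub>1 \<chi>\<^sub>2 :: "'c \<Rightarrow> int"
  assumes K: "group_hom K G h" and r: "r\<^sub>1 \<in> carrier G" "r\<^sub>2 \<in> carrier G" "r\<^sub>1 \<otimes> r\<^sub>2 = r\<^sub>2 \<otimes> r\<^sub>1"
    and comm: "\<And>x. x \<in> carrier K \<Longrightarrow> h x \<otimes> r\<^sub>1 = r\<^sub>1 \<otimes> h x" "\<And>x. x \<in> carrier K \<Longrightarrow> h x \<otimes> r\<^sub>2 = r\<^sub>2 \<otimes> h x"
    and \<chi>: "\<And>x y. x \<in> carrier K \<Longrightarrow> y \<in> carrier K \<Longrightarrow> \<chi>\<^sub>1 (x \<otimes>\<^bsub>K\<^esub> y) = \<chi>\<^sub>1 x + \<chi>\<^sub>1 y"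
      "\<And>x y. x \<in> carrier K \<Longrightarrow> y \<in> carrier K \<Longrightarrow> \<chi>\<^sub>2 (x \<otimes>\<^bsub>K\<^esub> y) = \<chi>\<^sub>2 x + \<chi>\<^sub>2 y"
  shows "group_hom K G (\<lambda>x. h x \<otimes> (r\<^sub>1 [^] \<chi>\<^sub>1 x \<otimes> r\<^sub>2 [^] \<chi>\<^sub>2 x))"
proof -
  interpret K: group_hom K G h by (rule K)
  define c where "c m n = r\<^sub>1 [^] (m::int) \<otimes> r\<^sub>2 [^] (n::int)" for m n
  have cc: "c m n \<in> carrier G" for m n using r by (simp add: c_def)
  have hc: "h x \<otimes> c m n = c m n \<otimes> h x" if x: "x \<in> carrier K" for x m n
  proof -
    have hx: "h x \<in> carrier G" using x by simp
    have "h x \<otimes> (r\<^sub>1 [^] m \<otimes> r\<^sub>2 [^] n) = h x \<otimes> r\<^sub>1 [^] m \<otimes> r\<^sub>2 [^] n" using hx r by (simp add: m_assoc)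
    also have "\<dots> = r\<^sub>1 [^] m \<otimes> h x \<otimes> r\<^sub>2 [^] n" using commutes_int_pow[OF comm(1)[OF x] hx r(1)] by simp
    also have "\<dots> = r\<^sub>1 [^] m \<otimes> (h x \<otimes> r\<^sub>2 [^] n)" using hx r by (simp add: m_assoc)
    also have "\<dots> = r\<^sub>1 [^] m \<otimes> (r\<^sub>2 [^] n \<otimes> h x)" using commutes_int_pow[OF comm(2)[OF x] hx r(2)] by simp
    also have "\<dots> = r\<^sub>1 [^] m \<otimes> r\<^sub>2 [^] n \<otimes> h x" using hx r by (simp add: m_assoc)
    finally show ?thesis unfolding c_def .
  qed
  have c_add: "c m n \<otimes> c m' n' = c (m + m') (n + n')" for m n m' n'
  proof -
    have r21: "r\<^sub>2 [^] n \<otimes> r\<^sub>1 [^] m' = r\<^sub>1 [^] m' \<otimes> r\<^sub>2 [^] n"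
      using r by (intro commutes_int_pow commutes_int_pow[symmetric]) auto
    have "c m n \<otimes> c m' n' = r\<^sub>1 [^] m \<otimes> (r\<^sub>2 [^] n \<otimes> r\<^sub>1 [^] m') \<otimes> r\<^sub>2 [^] n'"
      using r by (simp add: c_def m_assoc)
    also have "\<dots> = r\<^sub>1 [^] m \<otimes> (r\<^sub>1 [^] m' \<otimes> r\<^sub>2 [^] n) \<otimes> r\<^sub>2 [^] n'" unfolding r21 ..
    also have "\<dots> = c (m + m') (n + n')" using r by (simp add: c_def int_pow_mult m_assoc)
    finally show ?thesis .
  qed
  have "(\<lambda>x. h x \<otimes> c (\<chi>\<^sub>1 x) (\<chi>\<^sub>2 x)) \<in> hom K G"
  proof (rule homI)
    fix x y assume xy: "x \<in> carrier K" "y \<in> carrier K"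
    have "(h x \<otimes> c (\<chi>\<^sub>1 x) (\<chi>\<^sub>2 x)) \<otimes> (h y \<otimes> c (\<chi>\<^sub>1 y) (\<chi>\<^sub>2 y))
      = h x \<otimes> (c (\<chi>\<^sub>1 x) (\<chi>\<^sub>2 x) \<otimes> h y) \<otimes> c (\<chi>\<^sub>1 y) (\<chi>\<^sub>2 y)" using xy cc by (simp add: m_assoc)
    also have "\<dots> = h x \<otimes> (h y \<otimes> c (\<chi>\<^sub>1 x) (\<chi>\<^sub>2 x)) \<otimes> c (\<chi>\<^sub>1 y) (\<chi>\<^sub>2 y)" using hc[OF xy(2)] by simp
    also have "\<dots> = h x \<otimes> h y \<otimes> (c (\<chi>\<^sub>1 x) (\<chi>\<^sub>2 x) \<otimes> c (\<chi>\<^sub>1 y) (\<chi>\<^sub>2 y))" using xy cc by (simp add: m_assoc)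
    finally show "h (x \<otimes>\<^bsub>K\<^esub> y) \<otimes> c (\<chi>\<^sub>1 (x \<otimes>\<^bsub>K\<^esub> y)) (\<chi>\<^sub>2 (x \<otimes>\<^bsub>K\<^esub> y)) =
      (h x \<otimes> c (\<chi>\<^sub>1 x) (\<chi>\<^sub>2 x)) \<otimes> (h y \<otimes> c (\<chi>\<^sub>1 y) (\<chi>\<^sub>2 y))"
      using xy by (simp add: c_add \<chi>)
  qed (use cc in simp)
  then show ?thesis unfolding c_def by (simp add: group_hom_def group_hom_axioms_def K.G.group_axioms group_axioms)
qed

lemma disjoint_support_commute:
  assumes "\<phi> \<in> Th" "\<psi> \<in> Th" "\<And>x. \<phi> x = x \<or> \<psi> x = x"
  shows "\<phi> \<circ> \<psi> = \<psi> \<circ> \<phi>"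
proof
  fix x
  have "\<phi> x = x \<Longrightarrow> \<phi> (\<psi> x) = \<psi> x"
    using assms(3)[of "\<psi> x"] Th_eq_iff[OF assms(2), of "\<psi> x" x] by auto
  moreover have "\<psi> x = x \<Longrightarrow> \<psi> (\<phi> x) = \<phi> x"
    using assms(3)[of "\<phi> x"] Th_eq_iff[OF assms(1), of "\<phi> x" x] by auto
  ultimately show "(\<phi> \<circ> \<psi>) x = (\<psi> \<circ> \<phi>) x" using assms(3)[of x] by auto
qed

text \<open>If \<open>t\<close> moves an interval \<open>I\<close> off itself and \<open>\<phi>\<close> is supported in \<open>I\<close>, these are copies of \<open>\<phi>\<close> in the
  successive images of \<open>I\<close> (\<open>pow_conj_commute\<close>).\<close>

definition pow_conj :: "(real \<Rightarrow> real) \<Rightarrow> nat \<Rightarrow> (real \<Rightarrow> real) \<Rightarrow> real \<Rightarrow> real" where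
  "pow_conj t r \<phi> = (t ^^ r) \<circ> \<phi> \<circ> minv (t ^^ r)"

lemma pow_conj_Th: "t \<in> Th \<Longrightarrow> \<phi> \<in> Th \<Longrightarrow> pow_conj t r \<phi> \<in> Th"
  by (simp add: pow_conj_def Th_comp Th_minv Th_funpow)

lemma pow_conj_comp: "t \<in> Th \<Longrightarrow> pow_conj t r (\<phi> \<circ> \<psi>) = pow_conj t r \<phi> \<circ> pow_conj t r \<psi>"
  by (auto simp: pow_conj_def fun_eq_iff Th_funpow)

lemma pow_conj_pow_conj: "t \<in> Th \<Longrightarrow> pow_conj t r (pow_conj t s \<phi>) = pow_conj t (r + s) \<phi>"
  by (auto simp: pow_conj_def fun_eq_iff Th_funpow funpow_add Th_minv_comp)

lemma pow_conj_0: "pow_conj t 0 \<phi> = \<phi>"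
  by (auto simp: pow_conj_def fun_eq_iff inv_id[unfolded id_def] id_def)

lemma pow_conj_minv: "t \<in> Th \<Longrightarrow> \<phi> \<in> Th \<Longrightarrow> pow_conj t r (minv \<phi>) = minv (pow_conj t r \<phi>)"
  by (simp add: pow_conj_def Th_minv_comp Th_comp Th_minv Th_funpow comp_assoc)

lemma pow_conj_commute:
  assumes "t \<in> Th" "p < q" "q \<le> t p" "\<phi> \<in> Th" "\<psi> \<in> Th"
    and "\<And>x. x \<le> p \<or> q \<le> x \<Longrightarrow> \<phi> x = x" "\<And>x. x \<le> p \<or> q \<le> x \<Longrightarrow> \<psi> x = x" "r \<noteq> s"
  shows "pow_conj t r \<phi> \<circ> pow_conj t s \<psi> = pow_conj t s \<psi> \<circ> pow_conj t r \<phi>"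
proof -
  have mono: "(t ^^ a) p \<le> (t ^^ b) p" if "a \<le> b" for a b
    using that
  proof (induction b)
    case (Suc b)
    have "(t ^^ b) p \<le> (t ^^ b) (t p)" using assms(2,3) Th_le_iff[OF Th_funpow[OF assms(1)]] by simp
    then show ?case using Suc by (cases "a = Suc b") (auto simp: funpow_swap1)
  qed simp
  have step: "(t ^^ a) q \<le> (t ^^ Suc a) p" for a
    using Th_le_iff[OF Th_funpow[OF assms(1)], of a q "t p"] assms(3) by (simp add: funpow_swap1)
  have sep: "(t ^^ a) q \<le> (t ^^ b) p" if "a < b" for a b
    using step[of a] mono[of "Suc a" b] that by simp
  have out: "pow_conj t a \<eta> x = x" if "x \<le> (t ^^ a) p \<or> (t ^^ a) q \<le> x" "\<And>x. x \<le> p \<or> q \<le> x \<Longrightarrow> \<eta> x = x" for a \<eta> x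
  proof -
    have "minv (t ^^ a) x \<le> p \<or> q \<le> minv (t ^^ a) x"
      using that(1) Th_le_iff[OF Th_funpow[OF assms(1)], of a] Th_f_minv[OF Th_funpow[OF assms(1)]] by metis
    then show ?thesis using that(2) by (simp add: pow_conj_def Th_funpow assms(1))
  qed
  have "pow_conj t r \<phi> x = x \<or> pow_conj t s \<psi> x = x" for x
    using out[of x r \<phi>] out[of x s \<psi>] assms(6-8) sep[of r s] sep[of s r] by (metis le_cases linorder_neqE_nat order_trans)
  then show ?thesis using assms by (intro disjoint_support_commute pow_conj_Th) auto
qed

text \<open>Write \<open>u\<close> and \<open>v\<close> for the copies in \<open>I = {c..c + L}\<close> of the two generators of \<open>F\<close>, and say that
  a conjugate by \<open>t ^^ r\<close> is on level \<open>r\<close>. Elements on different levels commute. The element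
  \<open>s \<circ> pow_conj t 3 (minv s)\<close> carries \<open>v\<close> on level \<open>0\<close>, \<open>u\<close> on level \<open>1\<close>, and their inverses on the
  levels \<open>3\<close> and \<open>4\<close>. The \<open>t\<close>-conjugate of \<open>s \<circ> pow_conj t 4 (minv s)\<close> carries \<open>v\<close> on level \<open>1\<close>, \<open>u\<close> on
  level \<open>2\<close>, and their inverses on the levels \<open>5\<close> and \<open>6\<close>. Only level \<open>1\<close> is shared, and there the two elements
  are the generators \<open>u\<close> and \<open>v\<close>; the remaining factors \<open>r1\<close> and \<open>r2\<close> commute with each other
  and with everything on level \<open>1\<close>. The exponents of \<open>u\<close> and \<open>v\<close> in a word can be read off from
  \<open>pi_ab\<close>, so by \<open>twisted_hom\<close> the factors \<open>r1\<close> and \<open>r2\<close> cancel for elements of its kernel.\<close>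

lemma shifted_copies_generate:
  assumes t: "t \<in> Th" and A: "0 \<le> c" "0 < L" "c + L \<le> 1" "c \<in> dyadic" "L \<in> dyadic" "c + L \<le> t c"
    and S: "S \<subseteq> Th" "t \<in> gen S"
    and s: "s = affine_conj c L (vine_gen 1) \<circ> pow_conj t 1 (affine_conj c L (vine_gen 0))"
    and D: "\<And>n. s \<circ> pow_conj t n (minv s) \<in> gen S"
    and \<kappa>: "\<kappa> \<in> Th" "pi_ab \<kappa> = (0, 0)"
  shows "affine_conj c L \<kappa> \<in> gen S"
proof -
  let ?\<iota> = "affine_conj c L"
  have \<iota>T: "?\<iota> \<phi> \<in> Th" if "\<phi> \<in> Th" for \<phi> using affine_conj_Th_shrink[OF that] A by blast
  have \<iota>o: "?\<iota> \<phi> x = x" if "\<phi> \<in> Th" "x \<le> c \<or> c + L \<le> x" for \<phi> x using affine_conj_outside that A by blast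
  define l where "l r \<phi> = pow_conj t r (?\<iota> \<phi>)" for r \<phi>
  have lT: "l r \<phi> \<in> Th" if "\<phi> \<in> Th" for r \<phi> using pow_conj_Th[OF t \<iota>T[OF that]] by (simp add: l_def)
  have lc: "l r (\<phi> \<circ> \<psi>) = l r \<phi> \<circ> l r \<psi>" for r \<phi> \<psi>
    using pow_conj_comp[OF t] affine_conj_comp[OF A(2)] by (simp add: l_def)
  have ll: "pow_conj t r (l q \<phi>) = l (r + q) \<phi>" for r q \<phi> using pow_conj_pow_conj[OF t] by (simp add: l_def)
  have lcomm: "l r \<phi> \<circ> l q \<psi> = l q \<psi> \<circ> l r \<phi>" if "\<phi> \<in> Th" "\<psi> \<in> Th" "r \<noteq> q" for r q \<phi> \<psi>
    unfolding l_def using pow_conj_commute[OF t _ A(6) \<iota>T \<iota>T] that \<iota>o A(2) by simp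
  let ?u = "vine_gen 0" and ?v = "vine_gen 1"
  let ?u' = "minv (vine_gen 0)" and ?v' = "minv (vine_gen 1)"
  have T: "?u \<in> Th" "?v \<in> Th" "?u' \<in> Th" "?v' \<in> Th" using vine_gen_Th Th_minv by auto
  have s: "s = l 0 ?v \<circ> l 1 ?u" using s by (simp add: l_def pow_conj_0)
  have inv: "minv (l r \<phi>) = l r (minv \<phi>)" if "\<phi> \<in> Th" for r \<phi>
    using pow_conj_minv[OF t \<iota>T[OF that]] affine_conj_minv[OF that \<iota>T[OF that] A(2)] by (simp add: l_def)
  have s': "minv s = l 1 ?u' \<circ> l 0 ?v'"
    unfolding s using T lT by (simp add: Th_minv_comp inv)
  define r1 where "r1 = l 0 ?v \<circ> l 4 ?u' \<circ> l 3 ?v'"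
  define r2 where "r2 = l 2 ?u \<circ> l 6 ?u' \<circ> l 5 ?v'"
  have rT: "r1 \<in> Th" "r2 \<in> Th" unfolding r1_def r2_def using T lT by (auto intro!: Th_comp)
  have comm3: "\<phi> \<circ> (a \<circ> b \<circ> d) = (a \<circ> b \<circ> d) \<circ> \<phi>" if "\<phi> \<circ> a = a \<circ> \<phi>" "\<phi> \<circ> b = b \<circ> \<phi>" "\<phi> \<circ> d = d \<circ> \<phi>"
    for \<phi> a b d :: "real \<Rightarrow> real" using that by (metis comp_assoc)
  have c1: "l 1 \<phi> \<circ> r1 = r1 \<circ> l 1 \<phi>" if "\<phi> \<in> Th" for \<phi>
    unfolding r1_def by (intro comm3 lcomm) (use that T in auto)
  have c2: "l 1 \<phi> \<circ> r2 = r2 \<circ> l 1 \<phi>" if "\<phi> \<in> Th" for \<phi>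
    unfolding r2_def by (intro comm3 lcomm) (use that T in auto)
  have c21: "l k \<phi> \<circ> r1 = r1 \<circ> l k \<phi>" if "\<phi> \<in> Th" "k \<in> {2, 5, 6}" for \<phi> k
    unfolding r1_def by (intro comm3 lcomm) (use that T in auto)
  have c12: "r1 \<circ> r2 = r2 \<circ> r1"
    unfolding r2_def by (intro comm3) (use c21 T in simp_all)
  have "s \<circ> pow_conj t 3 (minv s) = l 0 ?v \<circ> l 1 ?u \<circ> (l 4 ?u' \<circ> l 3 ?v')"
    unfolding s' using pow_conj_comp[OF t] ll by (simp add: s)
  also have "\<dots> = l 1 ?u \<circ> r1"
    unfolding r1_def using lcomm[of ?v ?u 0 1] T by (simp add: comp_assoc[symmetric])
  finally have e1: "l 1 ?u \<circ> r1 \<in> gen S" using D[of 3] by simp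
  have "pow_conj t 1 (s \<circ> pow_conj t 4 (minv s)) = l 1 ?v \<circ> l 2 ?u \<circ> (l 6 ?u' \<circ> l 5 ?v')"
    unfolding s' using pow_conj_comp[OF t] ll by (simp add: s numeral_2_eq_2)
  also have "\<dots> = l 1 ?v \<circ> r2" unfolding r2_def by (simp add: comp_assoc)
  finally have "pow_conj t 1 (s \<circ> pow_conj t 4 (minv s)) = l 1 ?v \<circ> r2" .
  moreover have "pow_conj t 1 (s \<circ> pow_conj t 4 (minv s)) \<in> gen S"
    unfolding pow_conj_def[of t 1] using D[of 4] S gen_minv[OF S] by (auto intro!: gen_comp)
  ultimately have e2: "l 1 ?v \<circ> r2 \<in> gen S" by simp
  define \<Psi> where "\<Psi> x = l 1 x \<circ> (r1 [^]\<^bsub>Th_group\<^esub> fst (pi_ab x) \<circ> r2 [^]\<^bsub>Th_group\<^esub> (- fst (pi_ab x) - snd (pi_ab x)))" for x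
  have "group_hom Th_group Th_group (l 1)"
    using group_Th_group lT lc by (simp add: group_hom_def group_hom_axioms_def hom_def)
  then have "group_hom Th_group Th_group \<Psi>"
    unfolding \<Psi>_def[abs_def]
    using Th_group.twisted_hom[of Th_group "l 1" r1 r2 "\<lambda>x. fst (pi_ab x)" "\<lambda>x. - fst (pi_ab x) - snd (pi_ab x)"]
      rT c12 c1 c2 by (simp add: pi_ab_comp)
  then have "gen (\<Psi> ` Y) = \<Psi> ` gen Y" by (rule group_hom.generate_img) (use Y_subset_Th in simp)
  moreover have "pi_ab (vine_gen 0) = (1, -1)" "pi_ab (vine_gen 1) = (0, -1)"
    using pi_ab_bump pi_ab_vine_gen_1 by (simp_all add: vine_gen_0)
  then have "\<Psi> (vine_gen 0) = l 1 ?u \<circ> r1" "\<Psi> (vine_gen 1) = l 1 ?v \<circ> r2"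
    using rT unfolding \<Psi>_def by (simp_all add: Th_group.int_pow_1)
  then have "\<Psi> ` Y \<subseteq> gen S" using e1 e2 by simp
  ultimately have "\<Psi> ` Th \<subseteq> gen S" using gen_subset[OF _ S(1)] gen_vine_gens by metis
  then have "\<Psi> \<kappa> \<in> gen S" using \<kappa>(1) by blast
  moreover have "\<Psi> \<kappa> = t \<circ> ?\<iota> \<kappa> \<circ> minv t" using \<kappa>(2) by (simp add: \<Psi>_def l_def pow_conj_def)
  ultimately have "minv t \<circ> (t \<circ> ?\<iota> \<kappa> \<circ> minv t) \<circ> t \<in> gen S"
    using S(2) gen_minv[OF S] by (auto intro!: gen_comp)
  moreover have "minv t \<circ> (t \<circ> ?\<iota> \<kappa> \<circ> minv t) \<circ> t = ?\<iota> \<kappa>" using t by (auto simp: fun_eq_iff)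
  ultimately show ?thesis by simp
qed

section \<open>A partner without common fixed points\<close>

text \<open>Two slopes suffice: the powers of \<open>2\<close> on both sides of the average slope. The point \<open>m\<close> where the slope
  changes solves a linear equation whose solution is dyadic.\<close>

lemma PL_interpolation:
  fixes p q r s :: real
  assumes "p \<in> dyadic" "q \<in> dyadic" "r \<in> dyadic" "s \<in> dyadic" "p < q" "r < s"
  obtains \<phi> where "PL_on p q \<phi>" "\<phi> p = r" "\<phi> q = s"
proof -
  define R where "R = (s - r) / (q - p)"
  have R: "R > 0" using assms by (simp add: R_def)
  define k where "k = \<lfloor>log 2 R\<rfloor>"
  have "2 powr real_of_int k \<le> 2 powr (log 2 R)" "2 powr (log 2 R) < 2 powr (real_of_int k + 1)"
    unfolding k_def by (intro powr_mono powr_less_mono; linarith)+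
  then have k: "2 powi k \<le> R" "R < 2 * 2 powi k"
    using R by (simp_all add: powr_real_of_int' powr_add)
  define P where "P = (2::real) powi k"
  have P: "P > 0" by (simp add: P_def)
  have k': "P * (q - p) \<le> s - r" "s - r < 2 * P * (q - p)"
    using k assms(5) by (simp_all add: R_def P_def field_simps)
  define m where "m = p + (2 * (q - p) - (s - r) / P)"
  have m: "p < m" "m \<le> q" using k' P by (simp_all add: m_def field_simps)
  have "(s - r) / P = 2 powi (- k) * (s - r)" by (simp add: P_def power_int_minus field_simps)
  then have "(s - r) / P \<in> dyadic" using assms by (simp add: dyadic_scale dyadic_diff)
  then have md: "m \<in> dyadic" unfolding m_def using assms by (intro dyadic_add dyadic_diff dyadic_mult) auto
  define \<phi> where "\<phi> x = (if x \<le> m then r + P * (x - p) else s - 2 * P * (q - x))" for x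
  have eqm: "r + P * (m - p) = s - 2 * P * (q - m)" using P by (simp add: m_def field_simps)
  have "PL_on p m \<phi>"
    by (rule PL_on_affine[of _ _ _ k "r - P * p"]) (simp add: \<phi>_def P_def algebra_simps)
  moreover have "PL_on m q \<phi>"
  proof (rule PL_on_affine[of _ _ _ "k + 1" "s - 2 * P * q"])
    fix x assume "m \<le> x" "x \<le> q"
    then have "\<phi> x = s - 2 * P * (q - x)" using eqm by (auto simp: \<phi>_def)
    then show "\<phi> x = 2 powi (k + 1) * x + (s - 2 * P * q)" by (simp add: P_def power_int_add algebra_simps)
  qed
  ultimately have "PL_on p q \<phi>" using PL_on_glue md by blast
  moreover have "\<phi> p = r" using m by (simp add: \<phi>_def)
  moreover have "\<phi> q = s" using m eqm by (auto simp: \<phi>_def)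
  ultimately show ?thesis using that by blast
qed

text \<open>Near \<open>0\<close> and \<open>1\<close> the slopes of \<open>\<gamma>\<close> are prescribed. In between, \<open>\<gamma>\<close> rises at a point \<open>\<zeta>\<close> near \<open>0\<close> to a
  value \<open>v\<close> near \<open>1\<close>, so it moves everything up until \<open>f\<close> has no more fixed points or, if \<open>d < 0\<close>, until
  \<open>1\<close>. The large value at \<open>\<zeta>\<close> also prevents \<open>\<gamma>\<close> from commuting with \<open>f\<close>.\<close>

lemma exists_partner:
  fixes a c d :: int
  assumes f: "f \<in> Th" and a: "1 \<le> a" and \<delta>: "0 < \<delta>" "\<And>x. 0 \<le> x \<Longrightarrow> x \<le> \<delta> \<Longrightarrow> f x = 2 powi a * x"
    and top: "d < 0 \<or> (\<forall>x. 1 - \<delta>' \<le> x \<and> x < 1 \<longrightarrow> f x \<noteq> x)" "0 < \<delta>'"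
  obtains \<gamma> where "\<gamma> \<in> Th" "pi_ab \<gamma> = (c, d)" "\<And>x. 0 < x \<Longrightarrow> x < 1 \<Longrightarrow> f x \<noteq> x \<or> \<gamma> x \<noteq> x"
    "\<gamma> \<circ> f \<noteq> f \<circ> \<gamma>"
proof -
  define C D A :: real where "C = 2 powi c" and "D = 2 powi d" and "A = 2 powi a"
  have pos: "C > 0" "D > 0" by (simp_all add: C_def D_def)
  have A2: "A \<ge> 2" using power_int_increasing[of 1 a "2::real"] a by (simp add: A_def)
  define bd where "bd = min (min \<delta> (1/4)) (min (min (\<delta> / C) (1 / (4 * C))) (min (\<delta>' / (2 * D)) (min \<delta>' (1 / (4 * D)))))"
  have "bd > 0" using \<delta>(1) top(2) pos by (simp add: bd_def)
  then obtain n where n: "(1/2) ^ n < bd" using real_arch_pow_inv[of bd "1/2"] by auto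
  define \<zeta> :: real where "\<zeta> = 1 / 2 ^ n"
  have \<zeta>bd: "\<zeta> < bd" using n by (simp add: \<zeta>_def power_one_over)
  have \<zeta>: "0 < \<zeta>" "\<zeta> < \<delta>" "\<zeta> < 1/4" "C * \<zeta> < \<delta>" "C * \<zeta> < 1/4" "2 * (D * \<zeta>) < \<delta>'" "\<zeta> < \<delta>'" "D * \<zeta> < 1/4"
    using \<zeta>bd pos by (simp_all add: bd_def field_simps) (simp add: \<zeta>_def)
  have \<zeta>d: "\<zeta> \<in> dyadic" by (simp add: \<zeta>_def)
  define \<epsilon> where "\<epsilon> = \<zeta> / A"
  have \<epsilon>: "0 < \<epsilon>" "\<epsilon> \<le> \<zeta> / 2" "A * \<epsilon> = \<zeta>" using \<zeta>(1) A2 by (simp_all add: \<epsilon>_def field_simps)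
  have "\<epsilon> = 2 powi (- a) * \<zeta>" by (simp add: \<epsilon>_def A_def power_int_minus field_simps)
  then have \<epsilon>d: "\<epsilon> \<in> dyadic" using dyadic_scale[OF \<zeta>d] by simp
  have C\<epsilon>: "C * \<epsilon> \<le> C * \<zeta>" using \<epsilon> \<zeta>(1) pos by (intro mult_left_mono) auto
  have D\<zeta>: "0 < D * \<zeta>" using pos \<zeta> by simp
  \<comment> \<open>The factor \<open>3 / 2\<close> puts \<open>v\<close> below \<open>1 - D * \<zeta>\<close>, the value at \<open>1 - \<zeta>\<close>, but above \<open>1 - \<zeta>\<close> if \<open>D \<le> 1/2\<close>.\<close>
  define v where "v = 1 - 3 / 2 * (D * \<zeta>)"
  have CDd: "C \<in> dyadic" "D \<in> dyadic" by (simp_all add: C_def D_def)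
  have "v \<in> dyadic" unfolding v_def
    by (intro dyadic_diff dyadic_mult[of "3/2"] dyadic_mult[of D] dyadic_half CDd \<zeta>d) auto
  then have vd: "v \<in> dyadic" "1 - D * \<zeta> \<in> dyadic" "C * \<epsilon> \<in> dyadic" "1 - \<zeta> \<in> dyadic"
    using \<zeta>d \<epsilon>d CDd by (auto intro!: dyadic_diff dyadic_mult)
  have v: "C * \<epsilon> < v" "v < 1 - D * \<zeta>" "1/4 < v"
    unfolding v_def using C\<epsilon> \<zeta>(5,8) D\<zeta> by linarith+
  have \<epsilon>\<zeta>: "\<epsilon> < \<zeta>" "\<zeta> < 1 - \<zeta>" "1 - \<zeta> < 1" using \<epsilon>(2) \<zeta>(1,3) by linarith+
  obtain \<phi>1 where \<phi>1: "PL_on \<epsilon> \<zeta> \<phi>1" "\<phi>1 \<epsilon> = C * \<epsilon>" "\<phi>1 \<zeta> = v"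
    using PL_interpolation[OF \<epsilon>d \<zeta>d vd(3,1) \<epsilon>\<zeta>(1) v(1)] .
  obtain \<phi>2 where \<phi>2: "PL_on \<zeta> (1 - \<zeta>) \<phi>2" "\<phi>2 \<zeta> = v" "\<phi>2 (1 - \<zeta>) = 1 - D * \<zeta>"
    using PL_interpolation[OF \<zeta>d vd(4) vd(1,2) \<epsilon>\<zeta>(2) v(2)] .
  define \<gamma> where "\<gamma> x = (if x \<le> 0 then x else if x \<le> \<epsilon> then C * x else if x \<le> \<zeta> then \<phi>1 x
     else if x \<le> 1 - \<zeta> then \<phi>2 x else if x \<le> 1 then 1 - D * (1 - x) else x)" for x
  have \<gamma>v: "\<And>x. 0 \<le> x \<Longrightarrow> x \<le> \<epsilon> \<Longrightarrow> \<gamma> x = C * x" "\<And>x. \<epsilon> \<le> x \<Longrightarrow> x \<le> \<zeta> \<Longrightarrow> \<gamma> x = \<phi>1 x"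
    "\<And>x. \<zeta> \<le> x \<Longrightarrow> x \<le> 1 - \<zeta> \<Longrightarrow> \<gamma> x = \<phi>2 x" "\<And>x. 1 - \<zeta> \<le> x \<Longrightarrow> x \<le> 1 \<Longrightarrow> \<gamma> x = 1 - D * (1 - x)"
    using \<epsilon>(1) \<epsilon>\<zeta> \<phi>1(2,3) \<phi>2(2,3) by (auto simp: \<gamma>_def)
  have "PL_on 0 \<epsilon> \<gamma>" by (rule PL_on_affine[of _ _ _ c 0]) (simp add: \<gamma>v(1) C_def)
  moreover have "PL_on \<epsilon> \<zeta> \<gamma>" by (rule PL_on_cong[OF \<phi>1(1)]) (rule \<gamma>v(2))
  moreover have "PL_on \<zeta> (1 - \<zeta>) \<gamma>" by (rule PL_on_cong[OF \<phi>2(1)]) (rule \<gamma>v(3))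
  moreover have "PL_on (1 - \<zeta>) 1 \<gamma>"
    by (rule PL_on_affine[of _ _ _ d "1 - D"]) (simp add: \<gamma>v(4) D_def algebra_simps)
  ultimately have "PL_on 0 1 \<gamma>" using \<epsilon>d \<zeta>d vd(4) by (meson PL_on_glue)
  then have \<gamma>: "\<gamma> \<in> Th" using \<epsilon> \<epsilon>\<zeta> by (auto simp: Th_def \<gamma>_def)
  show ?thesis
  proof (rule that[OF \<gamma>])
    show "pi_ab \<gamma> = (c, d)"
      by (rule pi_ab_germs(3)[OF \<epsilon>(1)]) (use \<gamma>v(1,4) \<epsilon>\<zeta> in \<open>auto simp: C_def D_def\<close>)
    have "f \<epsilon> = \<zeta>" using \<delta>(2)[of \<epsilon>] \<epsilon> \<epsilon>\<zeta> \<zeta> by (simp add: A_def)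
    moreover have "\<gamma> \<zeta> = v" using \<gamma>v(2)[of \<zeta>] \<phi>1 \<epsilon>\<zeta> by simp
    moreover have "f (\<gamma> \<epsilon>) = C * \<zeta>"
    proof -
      have "0 \<le> C * \<epsilon>" "C * \<epsilon> \<le> \<delta>"
        using pos(1) \<epsilon>(1) order.strict_trans1[OF C\<epsilon> \<zeta>(4)] by simp_all
      then have "f (C * \<epsilon>) = A * (C * \<epsilon>)" using \<delta>(2) by (simp add: A_def)
      also have "\<dots> = C * \<zeta>" unfolding \<epsilon>(3)[symmetric] by simp
      finally show ?thesis using \<gamma>v(1)[of \<epsilon>] \<epsilon>(1) by simp
    qed
    ultimately have "(\<gamma> \<circ> f) \<epsilon> \<noteq> (f \<circ> \<gamma>) \<epsilon>" using v(3) \<zeta>(5) by simp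
    then show "\<gamma> \<circ> f \<noteq> f \<circ> \<gamma>" by metis
    fix x :: real assume x: "0 < x" "x < 1"
    show "f x \<noteq> x \<or> \<gamma> x \<noteq> x"
    proof (cases "x \<le> \<zeta>")
      case True
      then have "f x = A * x" using \<delta>(2)[of x] x \<zeta> by (simp add: A_def)
      moreover have "A * x \<ge> 2 * x" using A2 x by (intro mult_right_mono) auto
      ultimately show ?thesis using x by simp
    next
      case False
      show ?thesis
      proof (cases "d < 0")
        case True
        have "D \<le> 2 powi (-1)" unfolding D_def using True by (intro power_int_increasing) auto
        then have D: "D \<le> 1/2" by (simp add: power_int_minus)
        show ?thesis
        proof (cases "x \<le> 1 - \<zeta>")
          case True
          have "D * \<zeta> \<le> 1/2 * \<zeta>" using D \<zeta>(1) by (intro mult_right_mono) auto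
          then have "1 - \<zeta> < v" unfolding v_def using \<zeta>(1) by linarith
          moreover have "v \<le> \<gamma> x" using Th_le_iff[OF \<gamma>, of \<zeta> x] False \<open>\<gamma> \<zeta> = v\<close> by simp
          ultimately show ?thesis using True by auto
        next
          case False
          have "D * (1 - x) < 1 * (1 - x)" using D x by (intro mult_strict_right_mono) auto
          moreover have "\<gamma> x = 1 - D * (1 - x)" using \<gamma>v(4)[of x] False x by simp
          moreover have "x < 1 - w" if "w < 1 * (1 - x)" for w :: real using that by simp
          ultimately have "x < \<gamma> x" by simp
          then show ?thesis by simp
        qed
      next
        case d: False
        show ?thesis
        proof (cases "1 - \<delta>' \<le> x")
          case True
          then show ?thesis using top(1) d x by blast
        next
          case False
          have "v \<le> \<gamma> x" using Th_le_iff[OF \<gamma>, of \<zeta> x] \<open>\<not> x \<le> \<zeta>\<close> \<open>\<gamma> \<zeta> = v\<close> by simp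
          moreover have "1 - \<delta>' < v" using \<zeta>(6) D\<zeta> unfolding v_def by linarith
          ultimately show ?thesis using False by linarith
        qed
      qed
    qed
  qed
qed

section \<open>Orbits and perturbations\<close>

text \<open>A positive infimum of the orbit could be moved down, as it is not a common fixed point.\<close>

lemma orbit_near_zero:
  assumes S: "S \<subseteq> Th" and nofix: "\<And>x. 0 < x \<Longrightarrow> x < 1 \<Longrightarrow> \<exists>\<phi>\<in>S. \<phi> x \<noteq> x"
    and x: "0 < x" "x < 1" and w: "0 < w"
  shows "\<exists>h\<in>gen S. h x < w"
proof (rule ccontr)
  assume neg: "\<not> (\<exists>h\<in>gen S. h x < w)"
  define Q where "Q = {h x | h. h \<in> gen S}"
  have xQ: "x \<in> Q" unfolding Q_def using gen_id[of S] by (auto intro!: exI[of _ id])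
  have bdd: "bdd_below Q" using neg unfolding Q_def by (intro bdd_belowI[of _ w]) (auto simp: not_less)
  define m where "m = Inf Q"
  have lb: "m \<le> y" if "y \<in> Q" for y using cInf_lower[OF that bdd] by (simp add: m_def)
  have "w \<le> m" unfolding m_def using xQ neg by (intro cInf_greatest) (auto simp: Q_def not_less)
  then have m: "0 < m" "m < 1" using w lb[OF xQ] x by auto
  obtain \<phi> where \<phi>: "\<phi> \<in> S" "\<phi> m \<noteq> m" using nofix[OF m] by blast
  have \<phi>T: "\<phi> \<in> Th" using \<phi>(1) S by blast
  have \<phi>H: "\<phi> \<in> gen S" using \<phi>(1) by (rule generate.incl)
  have "\<exists>k\<in>gen S. k m < m"
  proof (cases "\<phi> m < m")
    case False
    then have "minv \<phi> m < m" using \<phi>(2) Th_less_iff[OF \<phi>T, of "minv \<phi> m" m] \<phi>T by simp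
    then show ?thesis using gen_minv[OF S \<phi>H] by blast
  qed (use \<phi>H in blast)
  then obtain k where k: "k \<in> gen S" "k m < m" by blast
  have kT: "k \<in> Th" using gen_Th[OF S k(1)] .
  have "m < minv k m" using k(2) Th_less_iff[OF kT, of m "minv k m"] kT by simp
  then have "\<exists>y\<in>Q. y < minv k m" using xQ unfolding m_def by (intro cInf_lessD) auto
  then obtain h where h: "h \<in> gen S" "h x < minv k m" by (auto simp: Q_def)
  have "k (h x) < m" using h(2) Th_less_iff[OF kT, of "h x" "minv k m"] kT by simp
  moreover have "k (h x) \<in> Q" unfolding Q_def using gen_comp[OF k(1) h(1)] by (auto intro!: exI[of _ "k \<circ> h"])
  ultimately show False using lb by fastforce
qed

text \<open>By induction on the word for \<open>h0\<close>: replacing the letter \<open>\<gamma>\<close> by \<open>\<gamma> \<circ> s\<close> has no effect on the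
  points in question if \<open>s\<close> moves only points below all those visited on the way.\<close>

lemma gen_stable:
  assumes f: "f \<in> Th" and \<gamma>: "\<gamma> \<in> Th" and h0: "h0 \<in> gen {f, \<gamma>}" and x: "0 < x"
  shows "\<exists>\<theta>>0. \<forall>s\<in>Th. (\<forall>y\<ge>\<theta>. s y = y) \<longrightarrow> (\<exists>h\<in>gen {f, \<gamma> \<circ> s}. \<forall>y\<ge>x. h y = h0 y)"
  using h0 x
proof (induction arbitrary: x rule: generate.induct)
  case one
  show ?case by (intro exI[of _ 1] conjI ballI impI, simp) (rule bexI[OF _ gen_id], simp)
next
  case (incl h)
  show ?case
  proof (intro exI[of _ x] conjI ballI impI)
    fix s assume s: "s \<in> Th" "\<forall>y\<ge>x. s y = y"
    consider "h = f" | "h = \<gamma>" using incl by blast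
    then show "\<exists>h'\<in>gen {f, \<gamma> \<circ> s}. \<forall>y\<ge>x. h' y = h y"
    proof cases
      case 1
      show ?thesis unfolding 1 by (rule bexI[OF _ generate.incl[of f]]) simp_all
    next
      case 2
      show ?thesis unfolding 2 by (rule bexI[OF _ generate.incl[of "\<gamma> \<circ> s"]]) (use s in simp_all)
    qed
  qed (use incl in auto)
next
  case (inv h)
  have hT: "h \<in> Th" using inv f \<gamma> by blast
  then have iv: "inv\<^bsub>Th_group\<^esub> h = minv h" by (rule inv_Th_group)
  show ?case
  proof (intro exI[of _ "minv h x"] conjI ballI impI)
    fix s assume s: "s \<in> Th" "\<forall>y\<ge>minv h x. s y = y"
    have S: "{f, \<gamma> \<circ> s} \<subseteq> Th" using f \<gamma> s Th_comp by auto
    consider "h = f" | "h = \<gamma>" using inv by blast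
    then show "\<exists>h'\<in>gen {f, \<gamma> \<circ> s}. \<forall>y\<ge>x. h' y = (inv\<^bsub>Th_group\<^esub> h) y"
    proof cases
      case 1
      show ?thesis unfolding iv unfolding 1 by (rule bexI[OF _ gen_minv[OF S generate.incl[of f]]]) simp_all
    next
      case 2
      have "minv (\<gamma> \<circ> s) y = minv \<gamma> y" if "x \<le> y" for y
      proof -
        have "minv \<gamma> x \<le> minv \<gamma> y" using Th_le_iff[OF Th_minv[OF \<gamma>]] that by simp
        then have "s (minv \<gamma> y) = minv \<gamma> y" using s(2) 2 by simp
        then show ?thesis using \<gamma> s(1) by (simp add: Th_minv_comp minv_eq_iff)
      qed
      moreover have "minv (\<gamma> \<circ> s) \<in> gen {f, \<gamma> \<circ> s}" by (rule gen_minv[OF S generate.incl]) simp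
      ultimately show ?thesis unfolding iv unfolding 2 by blast
    qed
  qed (use inv.prems hT Th_unit_iff(1)[OF Th_minv[OF hT]] in simp)
next
  case (eng h1 h2)
  have h2T: "h2 \<in> Th" using gen_Th[OF _ eng.hyps(2)] f \<gamma> by blast
  then have "0 < h2 x" using eng.prems by simp
  from eng.IH(1)[OF this] obtain \<theta>1 where 1: "\<theta>1 > 0"
    "\<forall>s\<in>Th. (\<forall>y\<ge>\<theta>1. s y = y) \<longrightarrow> (\<exists>h\<in>gen {f, \<gamma> \<circ> s}. \<forall>y\<ge>h2 x. h y = h1 y)"
    by (elim exE conjE)
  from eng.IH(2)[OF eng.prems] obtain \<theta>2 where 2: "\<theta>2 > 0"
    "\<forall>s\<in>Th. (\<forall>y\<ge>\<theta>2. s y = y) \<longrightarrow> (\<exists>h\<in>gen {f, \<gamma> \<circ> s}. \<forall>y\<ge>x. h y = h2 y)"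
    by (elim exE conjE)
  show ?case
  proof (intro exI[of _ "min \<theta>1 \<theta>2"] conjI ballI impI)
    fix s assume s: "s \<in> Th" "\<forall>y\<ge>min \<theta>1 \<theta>2. s y = y"
    have s': "\<forall>y\<ge>\<theta>1. s y = y" "\<forall>y\<ge>\<theta>2. s y = y" using s(2) by auto
    from 1(2)[THEN bspec, OF s(1), THEN mp, OF s'(1)]
    obtain k1 where k1: "k1 \<in> gen {f, \<gamma> \<circ> s}" "\<forall>y\<ge>h2 x. k1 y = h1 y" by (elim bexE)
    from 2(2)[THEN bspec, OF s(1), THEN mp, OF s'(2)]
    obtain k2 where k2: "k2 \<in> gen {f, \<gamma> \<circ> s}" "\<forall>y\<ge>x. k2 y = h2 y" by (elim bexE)
    have "(k1 \<circ> k2) y = (h1 \<otimes>\<^bsub>Th_group\<^esub> h2) y" if "x \<le> y" for y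
      using k1(2) k2(2) Th_le_iff[OF h2T, of x y] that by simp
    then show "\<exists>h\<in>gen {f, \<gamma> \<circ> s}. \<forall>y\<ge>x. h y = (h1 \<otimes>\<^bsub>Th_group\<^esub> h2) y" using gen_comp[OF k1(1) k2(1)] by blast
  qed (use 1(1) 2(1) in auto)
qed

lemma Th_left_affine:
  assumes "\<phi> \<in> Th" "0 < x" "x \<le> 1"
  obtains e :: real and k :: int and c where "0 < e" "e < x" "\<And>y. x - e \<le> y \<Longrightarrow> y \<le> x \<Longrightarrow> \<phi> y = 2 powi k * y + c"
proof -
  obtain B where B: "PL_breaks \<phi> B" using Th_obtain_breaks[OF assms(1)] .
  then have fin: "finite B" by (simp add: PL_breaks_def)
  define b where "b = Max (insert 0 (B \<inter> {..<x}))"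
  have "b \<in> insert 0 (B \<inter> {..<x})" unfolding b_def using fin by (intro Max_in) auto
  then have "b < x" using assms by auto
  moreover have le: "z \<le> b" if "z \<in> insert 0 (B \<inter> {..<x})" for z
    unfolding b_def using fin that by (intro Max_ge) auto
  ultimately have "{b<..<x} \<inter> B = {}" "0 \<le> b" by force+
  then obtain k :: int and c where kc: "\<And>y. y \<in> {b..x} \<Longrightarrow> \<phi> y = 2 powi k * y + c"
    using PL_breaks_affine[OF B, of b x] \<open>b < x\<close> assms(3) by metis
  define e where "e = (x - b) / 2"
  have e: "0 < e" "x - e = b + e" using \<open>b < x\<close> by (simp_all add: e_def field_simps)
  show ?thesis
  proof (rule that[of e k c])
    show "e < x" using e \<open>0 \<le> b\<close> by linarith
    show "\<phi> y = 2 powi k * y + c" if "x - e \<le> y" "y \<le> x" for y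
      by (rule kc) (use that e in auto)
  qed (rule e(1))
qed

text \<open>\<open>M\<close> is the supremum of the moved points. Just below \<open>M\<close> the map is affine and fixes \<open>M\<close>; its slope is
  not \<open>1\<close>, since otherwise \<open>M\<close> would not be the supremum, and the slope decides between \<open>\<phi>\<close> and its inverse.\<close>

lemma top_bump:
  assumes \<phi>: "\<phi> \<in> Th" "\<phi> \<noteq> id" and e: "e < 1" "\<And>x. e \<le> x \<Longrightarrow> \<phi> x = x"
  obtains M \<eta> \<psi> where "\<psi> = \<phi> \<or> \<psi> = minv \<phi>" "0 < \<eta>" "\<eta> < M" "M < 1" "\<And>x. M \<le> x \<Longrightarrow> \<psi> x = x"
    "\<And>x. M - \<eta> \<le> x \<Longrightarrow> x < M \<Longrightarrow> x < \<psi> x"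
proof -
  define Q where "Q = {x. \<phi> x \<noteq> x}"
  obtain x0 where x0: "x0 \<in> Q" using \<phi>(2) by (auto simp: Q_def fun_eq_iff)
  have Qe: "x < e" if "x \<in> Q" for x using e(2)[of x] that by (cases "e \<le> x") (auto simp: Q_def)
  then have bdd: "bdd_above Q" by (intro bdd_aboveI[of _ e]) force
  define M where "M = Sup Q"
  have ub: "x \<le> M" if "x \<in> Q" for x using cSup_upper[OF that bdd] by (simp add: M_def)
  have "M \<le> e" unfolding M_def using x0 Qe by (intro cSup_least) force+
  then have M1: "M < 1" using e by simp
  have "0 < x0" using x0 Th_fix[OF \<phi>(1), of x0] by (force simp: Q_def not_less)
  then have M0: "0 < M" using ub[OF x0] by simp
  have above: "\<phi> x = x" if "M < x" for x using ub[of x] that by (auto simp: Q_def)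
  have atM: "\<phi> M = M"
  proof (rule ccontr)
    assume "\<phi> M \<noteq> M"
    then consider "M < \<phi> M" | "M < minv \<phi> M"
      using Th_less_iff[OF \<phi>(1), of M "minv \<phi> M"] \<phi>(1) by fastforce
    then show False
    proof cases
      case 1 then show False using above[of "\<phi> M"] \<open>\<phi> M \<noteq> M\<close> Th_eq_iff[OF \<phi>(1)] by simp
    next
      case 2 then show False using above[of "minv \<phi> M"] \<phi>(1) \<open>\<phi> M \<noteq> M\<close> by simp
    qed
  qed
  obtain \<eta> k c where \<eta>: "0 < \<eta>" "\<eta> < M" "\<And>y. M - \<eta> \<le> y \<Longrightarrow> y \<le> M \<Longrightarrow> \<phi> y = 2 powi (k::int) * y + c"
    using Th_left_affine[OF \<phi>(1) M0] M1 by (metis less_imp_le)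
  define P where "P = (2::real) powi k"
  have "M = P * M + c" using \<eta>(3)[of M] \<eta>(1) atM by (simp add: P_def)
  then have diff: "\<phi> y - y = (1 - P) * (M - y)" if "M - \<eta> \<le> y" "y \<le> M" for y
    using \<eta>(3)[OF that] by (simp add: P_def algebra_simps)
  have "P \<noteq> 1"
  proof
    assume "P = 1"
    then have "\<phi> y = y" if "M - \<eta> \<le> y" for y using diff[of y] above[of y] that by (cases "y \<le> M") auto
    then have "x \<le> M - \<eta>" if "x \<in> Q" for x using that by (cases "M - \<eta> \<le> x") (auto simp: Q_def)
    then have "M \<le> M - \<eta>" unfolding M_def using x0 by (intro cSup_least) auto
    then show False using \<eta>(1) by simp
  qed
  then consider "P < 1" | "P > 1" by linarith
  then show ?thesis
  proof cases
    case 1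
    have "x < \<phi> x" if "M - \<eta> \<le> x" "x < M" for x
    proof -
      have "0 < (1 - P) * (M - x)" using 1 that by simp
      then show ?thesis using diff[of x] that by simp
    qed
    then show ?thesis using that[of \<phi> \<eta> M] \<eta> M1 above atM by (metis le_less)
  next
    case 2
    have "x < minv \<phi> x" if "M - \<eta> \<le> x" "x < M" for x
    proof -
      have "(1 - P) * (M - x) < 0" using 2 that by (simp add: mult_neg_pos)
      then have "\<phi> x < x" using diff[of x] that by simp
      then show ?thesis using Th_less_iff[OF \<phi>(1), of x "minv \<phi> x"] \<phi>(1) by simp
    qed
    moreover have "minv \<phi> x = x" if "M \<le> x" for x
      using above[of x] atM that minv_eq_iff[OF \<phi>(1), of x x] by (cases "x = M") auto
    ultimately show ?thesis using that[of "minv \<phi>" \<eta> M] \<eta> M1 by blast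
  qed
qed

section \<open>Perturbing the partner near zero\<close>

lemma linear_germ_funpow:
  assumes f: "f \<in> Th" and K: "1 \<le> K" and lin: "\<And>x. 0 \<le> x \<Longrightarrow> x \<le> \<delta> \<Longrightarrow> f x = K * x"
    and x: "0 \<le> x" "K ^ n * x \<le> K * \<delta>"
  shows "(f ^^ n) x = K ^ n * x"
  using x(2)
proof (induction n)
  case (Suc n)
  have "K * (K ^ n * x) \<le> K * \<delta>" using Suc.prems by (simp add: mult.assoc)
  then have le: "K ^ n * x \<le> \<delta>" using K by simp
  have "1 * \<delta> \<le> K * \<delta>"
  proof -
    have "0 \<le> \<delta>" using le x(1) K by (meson order_trans zero_le_mult_iff zero_le_power zero_le_one)
    then show ?thesis using K by (intro mult_right_mono) auto
  qed
  then have "(f ^^ n) x = K ^ n * x" using Suc.IH le by simp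
  then show ?case using lin[of "K ^ n * x"] le x(1) K by simp
qed simp

lemma linear_germ_minv:
  assumes f: "f \<in> Th" and K: "1 \<le> K" and lin: "\<And>x. 0 \<le> x \<Longrightarrow> x \<le> \<delta> \<Longrightarrow> f x = K * x"
    and x: "0 \<le> x" "x \<le> \<delta>"
  shows "minv f x = x / K"
proof -
  have "x * 1 \<le> x * K" using x K by (intro mult_left_mono) auto
  then have "x / K \<le> x" using K by (simp add: field_simps)
  then have "f (x / K) = x" using lin[of "x / K"] x K by (simp add: divide_nonneg_pos)
  then show ?thesis using f by (metis Th_minv_f)
qed

lemma linear_germ_minv_funpow:
  assumes f: "f \<in> Th" and K: "1 \<le> K" and lin: "\<And>x. 0 \<le> x \<Longrightarrow> x \<le> \<delta> \<Longrightarrow> f x = K * x"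
    and x: "0 \<le> x" "x \<le> \<delta>"
  shows "(minv f ^^ n) x = x / K ^ n"
proof (induction n)
  case (Suc n)
  have "1 \<le> K ^ n" using K by (rule one_le_power)
  then have "x * 1 \<le> x * K ^ n" using x by (intro mult_left_mono) auto
  then have "0 \<le> x / K ^ n" "x / K ^ n \<le> x" using \<open>1 \<le> K ^ n\<close> x by (simp_all add: field_simps)
  then show ?case using Suc linear_germ_minv[OF f K lin, of "x / K ^ n"] x by (simp add: field_simps)
qed simp

text \<open>The commutator \<open>k2\<close> of \<open>g\<close> and \<open>f\<close> is the composition of \<open>minv s\<close>, of the corresponding commutator of \<open>\<gamma>\<close> and \<open>f\<close>,
  and of the conjugate of \<open>s\<close> by \<open>f\<close>. Below \<open>\<delta>\<close> the second factor is the identity, and the third factor is so both below \<open>\<tau>\<close> and on the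
  support of \<open>s0\<close>. Hence \<open>k2\<close> agrees with the inverse of \<open>s1\<close> below \<open>\<tau>\<close>, which feeds
  \<open>shifted_copies_generate\<close>, and with the inverse of \<open>s0\<close> on the support of \<open>s0\<close>, which moves
  orbits into the image of \<open>{c<..<c + L}\<close> under \<open>f ^^ 2\<close>. The square leaves room between \<open>s1\<close>, its conjugate by
  \<open>f\<close>, and \<open>s0\<close>.\<close>

lemma perturbation_generates:
  fixes f \<gamma> s1 s0 t :: "real \<Rightarrow> real" and c L \<tau> K \<delta> :: real and n :: nat
  defines "g \<equiv> \<gamma> \<circ> (s1 \<circ> s0)" and "X1 \<equiv> c + L / 4" and "X2 \<equiv> c + L / 2"
  assumes f: "f \<in> Th" and \<gamma>: "\<gamma> \<in> Th" and s1: "s1 \<in> Th" and s0: "s0 \<in> Th" and t: "t \<in> gen {f, g}"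
    and K: "2 \<le> K" and lin: "\<And>x. 0 \<le> x \<Longrightarrow> x \<le> \<delta> \<Longrightarrow> f x = K * x" and \<delta>: "\<delta> \<le> 1/2"
    and k1: "\<And>x. x \<le> \<delta> \<Longrightarrow> (minv \<gamma> \<circ> f \<circ> \<gamma> \<circ> minv f) x = x"
    and nofix: "\<And>x. 0 < x \<Longrightarrow> x < 1 \<Longrightarrow> f x \<noteq> x \<or> \<gamma> x \<noteq> x"
    and surj: "generate Z2 {pi_ab f, pi_ab \<gamma>} = UNIV"
    and c: "0 < c" "c \<in> dyadic" "\<tau> \<le> 2 * c" and L: "L = 1 / 2 ^ n" "c + L \<le> \<tau>" and \<tau>: "K ^ 3 * \<tau> \<le> \<delta>"
    and s1_out: "\<And>x. x \<le> c \<or> \<tau> \<le> x \<Longrightarrow> s1 x = x"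
    and s0_out: "\<And>x. x \<le> K ^ 2 * X2 \<or> K ^ 3 * X1 \<le> x \<Longrightarrow> s0 x = x"
    and s0_in: "\<And>x. K ^ 2 * X2 < x \<Longrightarrow> x < K ^ 3 * X1 \<Longrightarrow> x < s0 x"
    and t_out: "\<And>x. \<tau> \<le> x \<Longrightarrow> t x = x" and tc: "c + L \<le> t c"
    and s1_eq: "s1 = affine_conj c L (vine_gen 1) \<circ> pow_conj t 1 (affine_conj c L (vine_gen 0))"
  shows "gen {f, g} = Th"
proof -
  let ?H = "gen {f, g}"
  define s where "s = s1 \<circ> s0"
  have sT: "s \<in> Th" unfolding s_def using s1 s0 by (rule Th_comp)
  have g_eq: "g = \<gamma> \<circ> s" by (simp add: g_def s_def)
  have gT: "g \<in> Th" unfolding g_eq using \<gamma> sT by (rule Th_comp)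
  have S: "{f, g} \<subseteq> Th" using f gT by simp
  have fH: "f \<in> ?H" "g \<in> ?H" by (auto intro: generate.incl)
  have HT: "h \<in> Th" if "h \<in> ?H" for h using gen_Th[OF S that] .
  have tT: "t \<in> Th" using HT[OF t] .
  \<comment> \<open>The support of \<open>s0\<close> lies above \<open>\<tau>\<close> and below \<open>\<delta>\<close>, where \<open>f\<close> is still multiplication by \<open>K\<close>.\<close>
  have K1: "1 \<le> K" using K by simp
  have Lp: "0 < L" by (simp add: L(1))
  have \<tau>p: "0 < \<tau>" using c(1) L(2) Lp by simp
  have up: "x \<le> K * x" "2 * x \<le> K * x" if "0 \<le> x" for x
    using mult_right_mono[OF K1 that] mult_right_mono[OF K that] by simp_all
  have sq: "K ^ 2 * x = K * (K * x)" "K ^ 3 * x = K * (K * (K * x))" for x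
    by (simp_all add: power2_eq_square power3_eq_cube mult.assoc)
  have X: "0 < X1" "c < X1" "X1 < X2" "X2 < c + L" "\<tau> \<le> 2 * X2" "0 < X2"
    using c(1,3) Lp by (simp_all add: X1_def X2_def)
  have K3: "K ^ 3 * x \<le> \<delta>" if "x \<le> \<tau>" for x
    using order_trans[OF mult_left_mono[OF that, of "K ^ 3"] \<tau>] K1 by simp
  have scale_mono: "K * x < K * y \<longleftrightarrow> x < y" "K * x \<le> K * y \<longleftrightarrow> x \<le> y" for x y using K1 by auto
  have X1\<delta>: "K ^ 3 * X1 \<le> \<delta>" using K3[of X1] X L(2) by simp
  have \<tau>KX: "\<tau> \<le> K * X2" using order_trans[OF X(5) up(2)[of X2]] X(6) by simp
  have \<tau>\<delta>: "\<tau> \<le> \<delta>" "K * \<tau> \<le> \<delta>" "K ^ 2 * \<tau> \<le> \<delta>"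
  proof -
    have "\<tau> \<le> K * \<tau>" "K * \<tau> \<le> K * (K * \<tau>)" "K * (K * \<tau>) \<le> K * (K * (K * \<tau>))"
      using \<tau>p K1 by (intro up(1); simp)+
    then show "\<tau> \<le> \<delta>" "K * \<tau> \<le> \<delta>" "K ^ 2 * \<tau> \<le> \<delta>" using \<tau> unfolding sq by linarith+
  qed
  have \<tau>2: "\<tau> \<le> K ^ 2 * X2" unfolding sq using order_trans[OF \<tau>KX up(1)[of "K * X2"]] X(6) K1 by simp
  have \<delta>p: "0 < \<delta>" using \<tau>\<delta>(1) \<tau>p by simp
  have minvf: "minv f x = x / K" if "0 \<le> x" "x \<le> \<delta>" for x
    using linear_germ_minv[OF f K1 lin that] .
  have s_low: "s x = x" if "x \<le> c" for x
    using s0_out[of x] s1_out[of x] that \<tau>2 L(2) Lp by (simp add: s_def)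
  have s_high: "s x = x" if "K ^ 3 * X1 \<le> x" for x
  proof -
    have "\<tau> \<le> K ^ 2 * X2" by (rule \<tau>2)
    also have "\<dots> \<le> K ^ 3 * X1"
    proof -
      have "X2 \<le> 2 * X1" using X(1) c(1) by (simp add: X1_def X2_def)
      then have "X2 \<le> K * X1" using order_trans[OF _ up(2)[of X1]] X(1) by simp
      then show ?thesis unfolding sq scale_mono .
    qed
    finally show ?thesis using s0_out[of x] s1_out[of x] that by (simp add: s_def)
  qed
  define k2 where "k2 = minv g \<circ> f \<circ> g \<circ> minv f"
  have k2H: "k2 \<in> ?H" unfolding k2_def using fH gen_minv[OF S] by (auto intro!: gen_comp)
  have k2T: "k2 \<in> Th" using HT[OF k2H] .
  have k2_eq: "k2 x = minv s ((minv \<gamma> \<circ> f \<circ> \<gamma> \<circ> minv f) (f (s (minv f x))))" for x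
    unfolding k2_def g_eq using \<gamma> sT f by (simp add: Th_minv_comp)
  have k2_inv_s: "k2 x = minv s x" if "x \<le> \<delta>" "s (minv f x) = minv f x" for x
    using that k1[OF that(1)] k2_eq[of x] f by simp
  have k2_low: "k2 x = minv s1 x" if "x \<le> \<tau>" for x
  proof -
    have "minv f x \<le> c"
    proof (cases "0 \<le> x")
      case True
      have "x \<le> K * c" using order_trans[OF order_trans[OF that c(3)] up(2)[of c]] c(1) by simp
      then have "x / K \<le> c" using K1 by (simp add: field_simps)
      moreover have "minv f x = x / K" using minvf[OF True] that \<tau>\<delta>(1) by simp
      ultimately show ?thesis by simp
    next
      case False
      then show ?thesis using Th_fix[OF Th_minv[OF f], of x] c(1) by simp
    qed
    then have k: "k2 x = minv s x" using k2_inv_s[of x] s_low that \<tau>\<delta> by simp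
    have "minv s1 x \<le> \<tau>"
      using Th_le_iff[OF s1, of "minv s1 x" \<tau>] s1_out[of \<tau>] that s1 by simp
    then have "s0 (minv s1 x) = minv s1 x" using s0_out \<tau>2 by simp
    then have "minv s x = minv s1 x" unfolding s_def using s1 s0 by (simp add: Th_minv_comp minv_eq_iff)
    then show ?thesis using k by simp
  qed
  have k2\<tau>: "k2 \<tau> = \<tau>" using k2_low[of \<tau>] s1_out[of \<tau>] minv_eq_iff[OF s1] by simp
  have k2_mid: "k2 x = minv s0 x" if "K ^ 2 * X2 \<le> x" "x \<le> K ^ 3 * X1" for x
  proof -
    have x0: "0 \<le> x" using that(1) \<tau>2 \<tau>p by simp
    have m: "minv f x = x / K" using minvf[OF x0] that X1\<delta> by simp
    have "K * X2 \<le> minv f x" "minv f x \<le> K ^ 2 * X1"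
      using that K1 unfolding m sq by (simp_all add: field_simps)
    moreover have "K ^ 2 * X1 \<le> K ^ 2 * X2" using X K1 by simp
    ultimately have "s (minv f x) = minv f x"
      using s1_out[of "minv f x"] s0_out[of "minv f x"] \<tau>KX by (simp add: s_def)
    then have k: "k2 x = minv s x" using k2_inv_s[of x] that X1\<delta> by simp
    have "s1 x = x" using s1_out[of x] \<tau>2 that by simp
    then have "minv s x = minv s0 x"
      unfolding s_def using s1 s0 by (simp add: Th_minv_comp) (metis Th_minv_f)
    then show ?thesis using k by simp
  qed
  \<comment> \<open>Above \<open>\<tau>\<close>, where \<open>k2\<close> is not known, \<open>t\<close> is the identity; so only \<open>s1\<close> survives in the commutator.\<close>
  have D: "s1 \<circ> pow_conj t m (minv s1) \<in> ?H" for m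
  proof -
    have tm: "t ^^ m \<in> Th" "t ^^ m \<in> ?H" using Th_funpow[OF tT] gen_funpow[OF t] by auto
    have tm_out: "(t ^^ m) x = x" if "\<tau> \<le> x" for x using funpow_fix t_out[OF that] .
    have tm_inv_out: "minv (t ^^ m) x = x" if "\<tau> \<le> x" for x
      using tm_out[OF that] minv_eq_iff[OF tm(1)] by simp
    have "minv k2 \<circ> (t ^^ m) \<circ> k2 \<circ> minv (t ^^ m) \<in> ?H"
      using k2H tm(2) gen_minv[OF S] by (auto intro!: gen_comp)
    moreover have "minv k2 \<circ> (t ^^ m) \<circ> k2 \<circ> minv (t ^^ m) = s1 \<circ> pow_conj t m (minv s1)"
    proof
      fix x
      show "(minv k2 \<circ> (t ^^ m) \<circ> k2 \<circ> minv (t ^^ m)) x = (s1 \<circ> pow_conj t m (minv s1)) x"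
      proof (cases "\<tau> \<le> x")
        case True
        then have "\<tau> \<le> k2 x" using Th_le_iff[OF k2T, of \<tau> x] k2\<tau> by simp
        then have "(minv k2 \<circ> (t ^^ m) \<circ> k2 \<circ> minv (t ^^ m)) x = x"
          using True tm_out tm_inv_out k2T by simp
        moreover have "minv s1 x = x" using s1_out[of x] True minv_eq_iff[OF s1] by simp
        then have "(s1 \<circ> pow_conj t m (minv s1)) x = x"
          using True tm_out tm_inv_out s1_out[of x] by (simp add: pow_conj_def)
        ultimately show ?thesis by simp
      next
        case False
        define y where "y = minv (t ^^ m) x"
        have y: "y < \<tau>" using False tm_inv_out[of \<tau>] Th_less_iff[OF Th_minv[OF tm(1)], of x \<tau>] by (simp add: y_def)
        have "minv s1 y < \<tau>"
          using Th_less_iff[OF s1, of "minv s1 y" \<tau>] s1_out[of \<tau>] y s1 by simp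
        define z where "z = (t ^^ m) (minv s1 y)"
        have z: "z < \<tau>" using \<open>minv s1 y < \<tau>\<close> Th_less_iff[OF tm(1), of "minv s1 y" \<tau>] tm_out[of \<tau>] by (simp add: z_def)
        have "s1 z < \<tau>" using Th_less_iff[OF s1, of z \<tau>] s1_out[of \<tau>] z by simp
        then have "k2 (s1 z) = z" using k2_low[of "s1 z"] s1 by simp
        then have "minv k2 z = s1 z" using minv_eq_iff[OF k2T] by simp
        moreover have "k2 y = minv s1 y" using k2_low[of y] y by simp
        ultimately show ?thesis by (simp add: pow_conj_def y_def[symmetric] z_def[symmetric])
      qed
    qed
    ultimately show ?thesis by simp
  qed
  have cL1: "c + L \<le> 1" using L(2) \<tau>\<delta>(1) \<delta> by simp
  have Ld: "L \<in> dyadic" by (simp add: L(1))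
  have local: "affine_conj c L \<kappa> \<in> ?H" if "\<kappa> \<in> Th" "pi_ab \<kappa> = (0, 0)" for \<kappa>
    using shifted_copies_generate[OF tT less_imp_le[OF c(1)] Lp cL1 c(2) Ld tc S t s1_eq D that] .
  \<comment> \<open>\<open>J = {j1..j2}\<close> is smaller than \<open>{c..c + L}\<close>, so that elements supported in \<open>J\<close> correspond to elements of
      the kernel of \<open>pi_ab\<close>.\<close>
  define j1 j2 where "j1 = c + L / 8" and "j2 = c + 3 * L / 4"
  have j: "0 < j1" "j1 < X1" "X2 < j2" "j2 < c + L" using c(1) Lp by (simp_all add: j1_def j2_def X1_def X2_def)
  have J: "\<phi> \<in> ?H" if \<phi>: "\<phi> \<in> Th" "\<And>x. x \<le> j1 \<or> j2 \<le> x \<Longrightarrow> \<phi> x = x" for \<phi>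
  proof -
    define \<kappa> where "\<kappa> = affine_conj (- c / L) (1 / L) \<phi>"
    have \<kappa>_val: "\<kappa> x = (\<phi> (c + L * x) - c) / L" for x
    proof -
      have "(x - - c / L) / (1 / L) = c + L * x" using Lp by (simp add: field_simps)
      then have "\<kappa> x = - c / L + 1 / L * \<phi> (c + L * x)" unfolding \<kappa>_def affine_conj_def by (simp only:)
      then show ?thesis by (simp add: diff_divide_distrib)
    qed
    have \<kappa>_fix: "\<kappa> x = x" if "x \<le> 1/8 \<or> 1 - 1/8 \<le> x" for x
    proof -
      have "c + L * x \<le> j1 \<or> j2 \<le> c + L * x"
        using that
      proof
        assume "x \<le> 1/8"
        then have "L * x \<le> L * (1/8)" using Lp by (intro mult_left_mono) auto
        then show ?thesis by (simp add: j1_def)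
      next
        assume "1 - 1/8 \<le> x"
        then have "L * (3/4) \<le> L * x" using Lp by (intro mult_left_mono) auto
        then show ?thesis by (simp add: j2_def)
      qed
      then show ?thesis using \<phi>(2) Lp by (simp add: \<kappa>_val)
    qed
    have iL: "1 / L \<in> dyadic"
      using dyadic_of_int[of "2 ^ n"] by (simp add: L(1))
    have "\<kappa> \<in> Th" unfolding \<kappa>_def
    proof (rule affine_conj_Th[OF \<phi>(1) _ iL])
      have "- c / L = (- c) * (1 / L)" by simp
      then show "- c / L \<in> dyadic" using dyadic_mult[OF dyadic_uminus[OF c(2)] iL] by simp
      fix x :: real assume "x \<le> 0 \<or> 1 \<le> x"
      then have "\<kappa> x = x" by (intro \<kappa>_fix) auto
      then have "\<phi> (c + L * x) = c + L * x" using Lp by (simp add: \<kappa>_val field_simps)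
      moreover have "(x - - c / L) / (1 / L) = c + L * x" using Lp by (simp add: field_simps)
      ultimately show "\<phi> ((x - - c / L) / (1 / L)) = (x - - c / L) / (1 / L)" by (simp only:)
    qed (use Lp in simp)
    moreover have "pi_ab \<kappa> = (0, 0)" by (rule pi_ab_zero_if_support[of "1/8"]) (use \<kappa>_fix in auto)
    ultimately have "affine_conj c L \<kappa> \<in> ?H" by (rule local)
    moreover have "affine_conj c L \<kappa> = \<phi>" using Lp by (auto simp: fun_eq_iff affine_conj_def \<kappa>_val)
    ultimately show ?thesis by simp
  qed
  have nofix': "\<exists>\<phi>\<in>{f, g}. \<phi> x \<noteq> x" if x: "0 < x" "x < 1" for x
  proof (cases "f x = x")
    case True
    have "\<delta> < x"
    proof (rule ccontr)
      assume "\<not> \<delta> < x"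
      then have "2 * x \<le> x" using lin[of x] True x(1) up(2)[of x] by simp
      then show False using x(1) by simp
    qed
    then have "g x = \<gamma> x" using s_high[of x] X1\<delta> by (simp add: g_eq)
    then show ?thesis using nofix[OF x] True by auto
  qed auto
  have down2: "minv f (minv f z) = z / K ^ 2" if "0 \<le> z" "z \<le> \<delta>" for z
  proof -
    have "z / K \<le> z" using up(1)[OF that(1)] K1 by (simp add: field_simps)
    then show ?thesis using minvf[OF that] minvf[of "z / K"] that K1 by (simp add: power2_eq_square)
  qed
  have ff: "minv f \<circ> minv f \<in> ?H" using gen_minv[OF S fH(1)] gen_comp by blast
  \<comment> \<open>Move \<open>x\<close> close to \<open>0\<close>, then by powers of \<open>f\<close> into the fundamental domain between \<open>K ^ 2 * X1\<close> and
      \<open>K ^ 3 * X1\<close>; from there \<open>k2\<close> leads into \<open>{K ^ 2 * X1..<K ^ 2 * j2}\<close>, and the inverse of \<open>f ^^ 2\<close> maps this into \<open>J\<close>.\<close>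
  have orbit: "\<exists>h\<in>?H. j1 < h x \<and> h x < j2" if x: "0 < x" "x < 1" for x
  proof -
    obtain h where h: "h \<in> ?H" "h x < X1" using orbit_near_zero[OF S nofix' x X(1)] by blast
    define y where "y = h x"
    have y: "0 < y" "y < X1" using h x HT[OF h(1)] by (simp_all add: y_def)
    have "\<exists>n. K ^ 2 * X1 / y < K ^ n" by (rule real_arch_pow) (use K in simp)
    then have ex: "\<exists>n. K ^ 2 * X1 \<le> K ^ n * y" using y by (auto simp: field_simps intro: less_imp_le)
    define m where "m = (LEAST n. K ^ 2 * X1 \<le> K ^ n * y)"
    have m1: "K ^ 2 * X1 \<le> K ^ m * y" unfolding m_def by (rule LeastI_ex[OF ex])
    have "m \<noteq> 0"
    proof
      assume "m = 0"
      then have "K ^ 2 * X1 \<le> y" using m1 by simp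
      moreover have "X1 \<le> K ^ 2 * X1" unfolding sq
        using order_trans[OF up(1)[of X1] up(1)[of "K * X1"]] X(1) K1 by simp
      ultimately show False using y by simp
    qed
    then obtain m' where m': "m = Suc m'" by (cases m) auto
    have "\<not> K ^ 2 * X1 \<le> K ^ m' * y" using not_less_Least[of m' "\<lambda>n. K ^ 2 * X1 \<le> K ^ n * y"] m' by (simp add: m_def)
    then have "K * (K ^ m' * y) < K * (K ^ 2 * X1)" unfolding scale_mono by simp
    then have m2: "K ^ m * y < K ^ 3 * X1" by (simp add: m' sq mult.assoc)
    define z where "z = K ^ m * y"
    have z: "K ^ 2 * X1 \<le> z" "z < K ^ 3 * X1" "0 < z" "z \<le> \<delta>"
      using m1 m2 y K X1\<delta> by (simp_all add: z_def)
    have "K ^ m * y \<le> K * \<delta>" using order_trans[OF z(4) up(1)[of \<delta>]] \<delta>p by (simp add: z_def)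
    then have fm: "(f ^^ m) y = z"
      using linear_germ_funpow[OF f K1 lin less_imp_le[OF y(1)]] by (simp add: z_def)
    have H1: "(f ^^ m) \<circ> h \<in> ?H" using gen_funpow[OF fH(1)] h(1) gen_comp by blast
    have v1: "((f ^^ m) \<circ> h) x = z" using fm by (simp add: y_def)
    have K2p: "0 < K ^ 2" using K by simp
    show ?thesis
    proof (cases "z \<le> K ^ 2 * X2")
      case True
      then have "X1 \<le> z / K ^ 2" "z / K ^ 2 \<le> X2" using z(1) K2p by (simp_all add: field_simps)
      then have "j1 < (minv f \<circ> minv f \<circ> ((f ^^ m) \<circ> h)) x" "(minv f \<circ> minv f \<circ> ((f ^^ m) \<circ> h)) x < j2"
        using v1 down2[of z] z j by simp_all
      then show ?thesis using gen_comp[OF ff H1] by blast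
    next
      case False
      have fixX: "k2 (K ^ 2 * X2) = K ^ 2 * X2"
        using k2_mid[of "K ^ 2 * X2"] s0_out[of "K ^ 2 * X2"] minv_eq_iff[OF s0] False z by simp
      have "\<exists>n. (k2 ^^ n) z < K ^ 2 * j2"
      proof (rule push_down[OF k2T fixX])
        fix w assume w: "K ^ 2 * X2 < w" "w \<le> z"
        have "w < s0 w" using s0_in[of w] w z by simp
        then have "minv s0 w < w" using Th_less_iff[OF s0, of "minv s0 w" w] s0 by simp
        then show "k2 w < w" using k2_mid[of w] w z by simp
      qed (use False j K2p in auto)
      then obtain n where n: "(k2 ^^ n) z < K ^ 2 * j2" by blast
      define w where "w = (k2 ^^ n) z"
      have "(k2 ^^ n) (K ^ 2 * X2) = K ^ 2 * X2" using fixX by (rule funpow_fix)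
      then have w1: "K ^ 2 * X2 < w" unfolding w_def
        using Th_less_iff[OF Th_funpow[OF k2T], of n "K ^ 2 * X2" z] False by simp
      then have w2: "X2 < w / K ^ 2" "w / K ^ 2 < j2" using n K2p by (simp_all add: w_def field_simps)
      have "K ^ 2 * j2 \<le> K ^ 2 * \<tau>" using j(4) L(2) K2p by (intro mult_left_mono) auto
      then have "w \<le> \<delta>" using n \<tau>\<delta>(3) by (simp add: w_def)
      moreover have "0 \<le> w" using w1 \<tau>2 \<tau>p by simp
      ultimately have "(minv f \<circ> minv f \<circ> ((k2 ^^ n) \<circ> ((f ^^ m) \<circ> h))) x = w / K ^ 2"
        using v1 down2[of w] by (simp add: w_def)
      moreover have "minv f \<circ> minv f \<circ> ((k2 ^^ n) \<circ> ((f ^^ m) \<circ> h)) \<in> ?H"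
        by (intro gen_comp[OF ff] gen_comp[OF gen_funpow[OF k2H]] H1)
      ultimately show ?thesis using w2 j X by (metis order.strict_trans)
    qed
  qed
  have jj: "j1 < j2" "j2 < 1" using j X cL1 by auto
  have "pi_ab s = (0, 0)"
  proof (rule pi_ab_zero_if_support)
    show "0 < min c (1/2)" using c(1) by simp
    fix x assume "x \<le> min c (1/2) \<or> 1 - min c (1/2) \<le> x"
    then have "x \<le> c \<or> K ^ 3 * X1 \<le> x" using X1\<delta> \<delta> by auto
    then show "s x = x" using s_low s_high by blast
  qed
  then have "pi_ab g = pi_ab \<gamma>" unfolding g_eq using pi_ab_comp[OF \<gamma> sT] by simp
  then have "generate Z2 (pi_ab ` {f, g}) = UNIV" using surj by simp
  then show ?thesis
  proof (rule gen_eq_Th[OF S])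
    fix \<phi> assume \<phi>: "\<phi> \<in> Th" "pi_ab \<phi> = (0, 0)"
    obtain e where "0 < e" "e < 1/2" "\<And>x. x \<le> e \<or> 1 - e \<le> x \<Longrightarrow> \<phi> x = x"
      using pi_ab_zero_support[OF \<phi>] by metis
    then show "\<phi> \<in> ?H" using compact_support_in_gen[OF S j(1) jj J orbit \<phi>(1)] by blast
  qed
qed

text \<open>The commutator is not the identity and lies in the kernel of \<open>pi_ab\<close>, so \<open>top_bump\<close> applies to it; its
  inverse has to be allowed because the direction of the push just below \<open>M\<close> is not known.\<close>

lemma commutator_top_bump:
  fixes f \<gamma> :: "real \<Rightarrow> real"
  assumes f: "f \<in> Th" and \<gamma>: "\<gamma> \<in> Th" and nc: "\<gamma> \<circ> f \<noteq> f \<circ> \<gamma>"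
    and nofix: "\<And>x. 0 < x \<Longrightarrow> x < 1 \<Longrightarrow> f x \<noteq> x \<or> \<gamma> x \<noteq> x" and \<delta>: "0 < \<delta>"
  defines "k1 \<equiv> minv \<gamma> \<circ> f \<circ> \<gamma> \<circ> minv f"
  obtains M \<eta> h where "h \<in> gen {f, \<gamma>}" "0 < \<eta>" "\<eta> < M" "M < 1" "h M < \<delta>"
    "(\<forall>x\<ge>M. k1 x = x) \<and> (\<forall>x. M - \<eta> \<le> x \<and> x < M \<longrightarrow> x < k1 x) \<or>
     (\<forall>x\<ge>M. minv k1 x = x) \<and> (\<forall>x. M - \<eta> \<le> x \<and> x < M \<longrightarrow> x < minv k1 x)"
proof -
  have S: "{f, \<gamma>} \<subseteq> Th" using f \<gamma> by simp
  have k1T: "k1 \<in> Th" unfolding k1_def using f \<gamma> by (intro Th_comp Th_minv)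
  have "k1 \<noteq> id"
  proof
    assume "k1 = id"
    then have "\<gamma> (k1 (f x)) = \<gamma> (f x)" for x by simp
    then have "f (\<gamma> x) = \<gamma> (f x)" for x using f \<gamma> by (simp add: k1_def)
    then show False using nc by (auto simp: fun_eq_iff)
  qed
  have "pi_ab k1 = (0, 0)"
    unfolding k1_def using f \<gamma> by (simp add: pi_ab_comp pi_ab_minv Th_comp Th_minv)
  then obtain e where e: "0 < e" "e < 1/2" "\<And>x. x \<le> e \<or> 1 - e \<le> x \<Longrightarrow> k1 x = x"
    using pi_ab_zero_support[OF k1T] by metis
  have e1: "1 - e < 1" using e(1) by simp
  have e3: "k1 x = x" if "1 - e \<le> x" for x using e(3) that by blast
  obtain M \<eta> \<psi> where M: "\<psi> = k1 \<or> \<psi> = minv k1" "0 < \<eta>" "\<eta> < M" "M < 1" "\<And>x. M \<le> x \<Longrightarrow> \<psi> x = x"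
    "\<And>x. M - \<eta> \<le> x \<Longrightarrow> x < M \<Longrightarrow> x < \<psi> x"
    by (rule top_bump[OF k1T \<open>k1 \<noteq> id\<close> e1 e3], assumption) (rule that; assumption)
  have "\<exists>h\<in>gen {f, \<gamma>}. h M < \<delta>"
    by (rule orbit_near_zero[OF S _ _ M(4) \<delta>]) (use nofix M(2,3) in auto)
  then obtain h where h: "h \<in> gen {f, \<gamma>}" "h M < \<delta>" by blast
  show ?thesis by (rule that[OF h(1) M(2,3,4) h(2)]) (use M(1,5,6) in auto)
qed

text \<open>The element \<open>t\<close> required by \<open>perturbation_generates\<close> depends on the perturbation, and \<open>s1\<close> is defined
  in terms of \<open>t\<close>. The circle is broken by \<open>T\<close>, the analogue of \<open>t\<close> built from \<open>f\<close> and \<open>\<gamma>\<close>: the perturbation is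
  placed so low that \<open>t\<close> and \<open>T\<close> agree above the lower end \<open>c\<close> of its support, and \<open>s1\<close> is defined with \<open>T\<close>.\<close>

lemma partner_perturbed_generates:
  fixes f \<gamma> :: "real \<Rightarrow> real" and a :: int
  assumes f: "f \<in> Th" and \<gamma>: "\<gamma> \<in> Th" and nc: "\<gamma> \<circ> f \<noteq> f \<circ> \<gamma>"
    and a: "1 \<le> a" and \<delta>0: "0 < \<delta>\<^sub>0" and lin: "\<And>x. 0 \<le> x \<Longrightarrow> x \<le> \<delta>\<^sub>0 \<Longrightarrow> f x = 2 powi a * x"
    and nofix: "\<And>x. 0 < x \<Longrightarrow> x < 1 \<Longrightarrow> f x \<noteq> x \<or> \<gamma> x \<noteq> x"
    and surj: "generate Z2 {pi_ab f, pi_ab \<gamma>} = UNIV"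
  shows "\<exists>g\<in>Th. gen {f, g} = Th"
proof -
  define K :: real where "K = 2 powi a"
  have K: "2 \<le> K" using power_int_increasing[of 1 a "2::real"] a by (simp add: K_def)
  have K_nat: "K = 2 ^ nat a" using a by (simp add: K_def power_int_def)
  define k1 where "k1 = minv \<gamma> \<circ> f \<circ> \<gamma> \<circ> minv f"
  have k1T: "k1 \<in> Th" unfolding k1_def using f \<gamma> by (intro Th_comp Th_minv)
  have "pi_ab k1 = (0, 0)"
    unfolding k1_def using f \<gamma> by (simp add: pi_ab_comp pi_ab_minv Th_comp Th_minv)
  then obtain e where e: "0 < e" "e < 1/2" "\<And>x. x \<le> e \<or> 1 - e \<le> x \<Longrightarrow> k1 x = x"
    using pi_ab_zero_support[OF k1T] by metis
  define \<delta> where "\<delta> = min \<delta>\<^sub>0 e"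
  have \<delta>: "0 < \<delta>" "\<delta> \<le> 1/2" "\<delta> \<le> \<delta>\<^sub>0" "\<delta> \<le> e" using \<delta>0 e by (auto simp: \<delta>_def)
  have lin\<delta>: "f x = K * x" if "0 \<le> x" "x \<le> \<delta>" for x using lin[of x] that \<delta> by (simp add: K_def)
  have k1\<delta>: "k1 x = x" if "x \<le> \<delta>" for x using e(3)[of x] that \<delta> by simp
  obtain M \<eta> h0 where M: "h0 \<in> gen {f, \<gamma>}" "0 < \<eta>" "\<eta> < M" "M < 1" "h0 M < \<delta>"
    and bump: "(\<forall>x\<ge>M. k1 x = x) \<and> (\<forall>x. M - \<eta> \<le> x \<and> x < M \<longrightarrow> x < k1 x) \<or>
     (\<forall>x\<ge>M. minv k1 x = x) \<and> (\<forall>x. M - \<eta> \<le> x \<and> x < M \<longrightarrow> x < minv k1 x)"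
    by (rule commutator_top_bump[OF f \<gamma> nc _ \<delta>(1), folded k1_def], rule nofix, assumption, assumption)
      (rule that; assumption)
  \<comment> \<open>Whether \<open>k1\<close> or its inverse pushes towards \<open>M\<close>; the same choice has to be made for \<open>k2\<close> below.\<close>
  define inverted where "inverted \<longleftrightarrow> \<not> ((\<forall>x\<ge>M. k1 x = x) \<and> (\<forall>x. M - \<eta> \<le> x \<and> x < M \<longrightarrow> x < k1 x))"
  define orient where "orient k = (if inverted then minv k else k)" for k :: "real \<Rightarrow> real"
  define \<psi> where "\<psi> = orient k1"
  have \<psi>T: "\<psi> \<in> Th" using k1T Th_minv by (simp add: \<psi>_def orient_def)
  have \<psi>: "\<And>x. M \<le> x \<Longrightarrow> \<psi> x = x" "\<And>x. M - \<eta> \<le> x \<Longrightarrow> x < M \<Longrightarrow> x < \<psi> x"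
    using bump by (auto simp: \<psi>_def orient_def inverted_def)
  have \<psi>_le: "x \<le> \<psi> x" if "M - \<eta> \<le> x" for x using \<psi>[of x] that by (cases "M \<le> x") auto
  have h0T: "h0 \<in> Th" using gen_Th[OF _ M(1)] f \<gamma> by blast
  define p where "p = h0 M"
  have p: "0 < p" "p < \<delta>" using M h0T by (simp_all add: p_def)
  \<comment> \<open>Conjugation by \<open>h0\<close> turns the push towards \<open>M\<close> into a push towards \<open>p\<close>, where \<open>f\<close> is linear. The bound \<open>p / 2\<close>
      makes \<open>f\<close> move the region in question off itself.\<close>
  define t0 where "t0 = h0 \<circ> \<psi> \<circ> minv h0"
  have t0T: "t0 \<in> Th" unfolding t0_def using h0T \<psi>T by (intro Th_comp Th_minv)
  define p' where "p' = max (h0 (M - \<eta>)) (p / 2)"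
  have p': "p' < p" "p / 2 \<le> p'" "h0 (M - \<eta>) \<le> p'" "0 < p'"
    using p M(2) Th_less_iff[OF h0T, of "M - \<eta>" M] by (auto simp: p'_def p_def)
  have pulled_back: "M - \<eta> \<le> minv h0 x" if "p' \<le> x" for x
    using Th_le_iff[OF h0T, of "M - \<eta>" "minv h0 x"] p'(3) that h0T by simp
  have t0_out: "t0 x = x" if "p \<le> x" for x
  proof -
    have "M \<le> minv h0 x" using Th_le_iff[OF h0T, of M "minv h0 x"] that h0T by (simp add: p_def)
    then show ?thesis using \<psi>(1) h0T by (simp add: t0_def)
  qed
  have t0_up: "x < t0 x" if "p' \<le> x" "x < p" for x
  proof -
    have "minv h0 x < M" using Th_less_iff[OF h0T, of "minv h0 x" M] that h0T by (simp add: p_def)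
    then have "minv h0 x < \<psi> (minv h0 x)" using \<psi>(2) pulled_back[OF that(1)] by simp
    then have "h0 (minv h0 x) < h0 (\<psi> (minv h0 x))" using Th_less_iff[OF h0T] by simp
    then show ?thesis using h0T by (simp add: t0_def)
  qed
  obtain i where i: "i \<in> dyadic" "p' < i" "i < p" using dyadic_between[OF p'(1)] .
  obtain n\<^sub>1 where n1: "(1/2) ^ n\<^sub>1 < p - i" using real_arch_pow_inv[of "p - i" "1/2"] i by auto
  define l :: real where "l = 1 / 2 ^ n\<^sub>1"
  have l: "0 < l" "i + l < p" using n1 by (simp_all add: l_def power_one_over)
  have "\<exists>r. i + l < (t0 ^^ r) i"
    by (rule push_up[OF t0T t0_out[of p]]) (use t0_up i l in auto)
  then obtain r where r: "i + l < (t0 ^^ r) i" by blast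
  \<comment> \<open>If \<open>s\<close> is the identity above \<open>\<theta>\<close>, the perturbed group contains elements that agree with \<open>h0\<close> and \<open>k1\<close>
      above \<open>M - \<eta>\<close>.\<close>
  obtain \<theta>\<^sub>1 where th1: "\<theta>\<^sub>1 > 0"
    "\<forall>s\<in>Th. (\<forall>y\<ge>\<theta>\<^sub>1. s y = y) \<longrightarrow> (\<exists>h\<in>gen {f, \<gamma> \<circ> s}. \<forall>y\<ge>M - \<eta>. h y = h0 y)"
    using gen_stable[OF f \<gamma> M(1), of "M - \<eta>"] M(2,3) by auto
  define \<theta> where "\<theta> = min (min \<theta>\<^sub>1 \<delta>) (min (minv f (M - \<eta>)) (k1 (M - \<eta>)))"
  have "0 < minv f (M - \<eta>)" "0 < k1 (M - \<eta>)" using f k1T M(2,3) Th_minv[OF f] by simp_all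
  then have th: "0 < \<theta>" "\<theta> \<le> \<theta>\<^sub>1" "\<theta> \<le> \<delta>" "\<theta> \<le> minv f (M - \<eta>)" "\<theta> \<le> k1 (M - \<eta>)"
    using th1(1) \<delta>(1) by (auto simp: \<theta>_def)
  obtain m where m: "K ^ 3 * p / \<theta> < K ^ m" using real_arch_pow[of K "K ^ 3 * p / \<theta>"] K by auto
  have Km: "0 < K ^ m" using K by simp
  define \<mu> where "\<mu> = 1 / K ^ m"
  have \<mu>: "0 < \<mu>" "K ^ 3 * (\<mu> * p) < \<theta>" using m Km th(1) by (simp_all add: \<mu>_def field_simps)
  have \<mu>d: "\<mu> = 1 / 2 ^ (nat a * m)" by (simp add: \<mu>_def K_nat power_mult)
  \<comment> \<open>A large power of the inverse of \<open>f\<close> shrinks the picture at \<open>p\<close> below \<open>\<theta>\<close> without changing its shape.\<close>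
  define F where "F = minv f ^^ m"
  have FT: "F \<in> Th" unfolding F_def by (rule Th_funpow[OF Th_minv[OF f]])
  have F_lin: "F x = \<mu> * x" if "0 \<le> x" "x \<le> \<delta>" for x
    using linear_germ_minv_funpow[OF f _ lin\<delta> that, of m] K by (simp add: F_def \<mu>_def)
  define \<tau> where "\<tau> = \<mu> * p"
  define c where "c = \<mu> * i"
  define L where "L = \<mu> * l"
  have \<tau>_F: "\<tau> = F p" "\<mu> * p' = F p'" "c = F i" "c + L = F (i + l)"
    using F_lin p p' i l by (simp_all add: \<tau>_def c_def L_def algebra_simps)
  define T0 where "T0 = F \<circ> t0 \<circ> minv F"
  have T0T: "T0 \<in> Th" unfolding T0_def using FT t0T by (intro Th_comp Th_minv)
  have T0_pow: "(T0 ^^ q) (F x) = F ((t0 ^^ q) x)" for q x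
    by (induction q) (use FT in \<open>simp_all add: T0_def\<close>)
  have T0_le: "x \<le> T0 x" if "\<mu> * p' \<le> x" for x
  proof -
    have "p' \<le> minv F x" using that Th_le_iff[OF FT, of p' "minv F x"] \<tau>_F FT by simp
    then have "minv F x \<le> t0 (minv F x)" using t0_up[of "minv F x"] t0_out[of "minv F x"] by (cases "p \<le> minv F x") auto
    then have "F (minv F x) \<le> F (t0 (minv F x))" using Th_le_iff[OF FT] by simp
    then show ?thesis using FT by (simp add: T0_def)
  qed
  have T0_out: "T0 x = x" if "\<tau> \<le> x" for x
  proof -
    have "p \<le> minv F x" using that Th_le_iff[OF FT, of p "minv F x"] \<tau>_F FT by simp
    then show ?thesis using t0_out FT by (simp add: T0_def)
  qed
  define T where "T = T0 ^^ r"
  have TT: "T \<in> Th" unfolding T_def by (rule Th_funpow[OF T0T])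
  have "F (i + l) < (T0 ^^ r) (F i)" unfolding T0_pow using r Th_less_iff[OF FT] by simp
  then have Tc: "c + L < T c" by (simp only: T_def \<tau>_F(3)[symmetric] \<tau>_F(4)[symmetric])
  have T_out: "T x = x" if "\<tau> \<le> x" for x unfolding T_def by (rule funpow_fix) (rule T0_out[OF that])
  have c0: "0 < c" "\<mu> * p' < c" "0 < L" "c + L < \<tau>" "\<tau> \<le> 2 * c"
    using \<mu>(1) i p p' l by (simp_all add: c_def L_def \<tau>_def flip: distrib_left)
  have KT: "K ^ 3 * \<tau> < \<theta>" using \<mu>(2) by (simp add: \<tau>_def)
  have K1: "1 \<le> K" using K by simp
  have \<tau>1: "\<tau> \<le> K ^ 3 * \<tau>" using mult_right_mono[of 1 "K ^ 3" \<tau>] K1 c0 by simp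
  have cL1: "c + L \<le> 1" using c0(4) \<tau>1 KT th(3) \<delta>(2) by linarith
  have dy: "c \<in> dyadic" "L \<in> dyadic" "\<mu> \<in> dyadic"
    unfolding c_def L_def \<mu>d l_def by (intro dyadic_mult dyadic_inverse_power i(1))+
  define \<iota> where "\<iota> = affine_conj c L"
  have \<iota>T: "\<iota> \<phi> \<in> Th" if "\<phi> \<in> Th" for \<phi>
    unfolding \<iota>_def by (rule affine_conj_Th_shrink[OF that dy(1,2)]) (use c0 cL1 in auto)
  have \<iota>_out: "\<iota> \<phi> x = x" if "\<phi> \<in> Th" "x \<le> c \<or> c + L \<le> x" for \<phi> x
    unfolding \<iota>_def by (rule affine_conj_outside[OF that(1) c0(3) that(2)])
  define s1 where "s1 = \<iota> (vine_gen 1) \<circ> pow_conj T 1 (\<iota> (vine_gen 0))"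
  have s1T: "s1 \<in> Th" unfolding s1_def by (intro Th_comp pow_conj_Th TT \<iota>T vine_gen_Th)
  have s1_out: "s1 x = x" if "x \<le> c \<or> \<tau> \<le> x" for x
  proof -
    have "minv T x \<le> c \<or> c + L \<le> minv T x"
      using that
    proof
      assume "x \<le> c"
      then have "x \<le> T c" using Tc c0 by simp
      then have "minv T x \<le> c" using Th_le_iff[OF TT, of "minv T x" c] TT by simp
      then show ?thesis ..
    next
      assume "\<tau> \<le> x"
      then have "minv T x = x" using T_out minv_eq_iff[OF TT] by simp
      then show ?thesis using \<open>\<tau> \<le> x\<close> c0 by simp
    qed
    then have "pow_conj T 1 (\<iota> (vine_gen 0)) x = x" using \<iota>_out[OF vine_gen_Th] TT by (simp add: pow_conj_def)
    then show ?thesis using \<iota>_out[OF vine_gen_Th, of x] that c0 by (auto simp: s1_def)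
  qed
  define X1 where "X1 = c + L / 4"
  define X2 where "X2 = c + L / 2"
  define b1 where "b1 = K ^ 2 * X2"
  define b2 where "b2 = K ^ 3 * X1"
  define s0 where "s0 = affine_conj b1 (b2 - b1) bump"
  have X: "0 < X1" "X1 < \<tau>" "0 < X2" "X2 < 2 * X1" "\<tau> < 2 * X2" using c0 by (simp_all add: X1_def X2_def)
  have b: "b1 < b2" "0 < b1" "b2 < \<theta>"
  proof -
    have "2 * X1 \<le> K * X1" using K X by (intro mult_right_mono) auto
    then have "X2 < K * X1" using X(4) by linarith
    then have "K ^ 2 * X2 < K ^ 2 * (K * X1)" using K by (intro mult_strict_left_mono) auto
    then show "b1 < b2" by (simp add: b1_def b2_def power2_eq_square power3_eq_cube mult.assoc)
    show "0 < b1" using X K by (simp add: b1_def)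
    have "b2 \<le> K ^ 3 * \<tau>" unfolding b2_def using X K by (intro mult_left_mono) auto
    then show "b2 < \<theta>" using KT by simp
  qed
  have Kd: "K ^ q \<in> dyadic" for q using dyadic_of_int[of "2 ^ (nat a * q)"] by (simp add: K_nat power_mult)
  have bd: "b1 \<in> dyadic" "b2 \<in> dyadic"
  proof -
    have "X2 \<in> dyadic" unfolding X2_def by (intro dyadic_add dyadic_half dy)
    moreover have "L / 4 \<in> dyadic" using dyadic_half[OF dyadic_half[OF dy(2)]] by simp
    then have "X1 \<in> dyadic" unfolding X1_def by (intro dyadic_add dy)
    ultimately show "b1 \<in> dyadic" "b2 \<in> dyadic" unfolding b1_def b2_def by (simp_all add: dyadic_mult Kd)
  qed
  have b21: "b2 \<le> 1" using b(3) th(3) \<delta>(2) by linarith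
  have s0T: "s0 \<in> Th" unfolding s0_def
    by (rule affine_conj_Th_shrink[OF bump_Th bd(1) dyadic_diff[OF bd(2,1)]]) (use b b21 in auto)
  have s0_out: "s0 x = x" if "x \<le> b1 \<or> b2 \<le> x" for x
    unfolding s0_def by (rule affine_conj_outside[OF bump_Th]) (use b that in auto)
  have s0_in: "x < s0 x" if "b1 < x" "x < b2" for x
    unfolding s0_def by (rule affine_bump_gt) (use b that in auto)
  define s where "s = s1 \<circ> s0"
  have sT: "s \<in> Th" unfolding s_def using s1T s0T by (rule Th_comp)
  have s_out: "s y = y" if "\<theta> \<le> y" for y
    using s0_out[of y] s1_out[of y] that b(3) \<tau>1 KT by (simp add: s_def)
  define g where "g = \<gamma> \<circ> s"
  have gT: "g \<in> Th" unfolding g_def using \<gamma> sT by (rule Th_comp)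
  have S: "{f, g} \<subseteq> Th" using f gT by simp
  have "\<forall>y\<ge>\<theta>\<^sub>1. s y = y" using s_out th(2) by auto
  from th1(2)[THEN bspec, OF sT, THEN mp, OF this]
  obtain h where h: "h \<in> gen {f, g}" "\<forall>y\<ge>M - \<eta>. h y = h0 y" unfolding g_def by (elim bexE)
  have hT: "h \<in> Th" using gen_Th[OF S h(1)] .
  \<comment> \<open>The commutator of \<open>g\<close> and \<open>f\<close> agrees with \<open>k1\<close> near \<open>M\<close>, so the words that give \<open>T\<close> from \<open>k1\<close> give \<open>t\<close> from \<open>k2\<close>.\<close>
  define k2 where "k2 = minv g \<circ> f \<circ> g \<circ> minv f"
  have fH: "f \<in> gen {f, g}" "g \<in> gen {f, g}" by (auto intro: generate.incl)
  have k2H: "k2 \<in> gen {f, g}"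
    unfolding k2_def using fH gen_minv[OF S] by (auto intro!: gen_comp)
  have k2T: "k2 \<in> Th" using gen_Th[OF S k2H] .
  have k2_k1: "k2 x = k1 x" if "M - \<eta> \<le> x" for x
  proof -
    have "\<theta> \<le> minv f x" using th(4) that Th_le_iff[OF Th_minv[OF f], of "M - \<eta>" x] by simp
    then have "s (minv f x) = minv f x" by (rule s_out)
    moreover have "\<theta> \<le> k1 x" using th(5) that Th_le_iff[OF k1T, of "M - \<eta>" x] by simp
    then have "minv s (k1 x) = k1 x" using s_out[of "k1 x"] minv_eq_iff[OF sT] by simp
    ultimately show ?thesis unfolding k2_def g_def using \<gamma> sT by (simp add: Th_minv_comp k1_def)
  qed
  define \<psi>2 where "\<psi>2 = orient k2"
  have \<psi>2H: "\<psi>2 \<in> gen {f, g}" unfolding \<psi>2_def orient_def using k2H gen_minv[OF S k2H] by simp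
  have \<psi>2_\<psi>: "\<psi>2 x = \<psi> x" if "M - \<eta> \<le> x" for x
  proof (cases inverted)
    case True
    have "M - \<eta> \<le> \<psi> x" using \<psi>_le[OF that] that by simp
    then have "k2 (\<psi> x) = k1 (\<psi> x)" by (rule k2_k1)
    then have "k2 (\<psi> x) = x" using True k1T by (simp add: \<psi>_def orient_def)
    then show ?thesis using True minv_eq_iff[OF k2T, of x "\<psi> x"] by (simp add: \<psi>2_def orient_def)
  next
    case False
    then show ?thesis using k2_k1[OF that] by (simp add: \<psi>2_def \<psi>_def orient_def)
  qed
  define h' where "h' = F \<circ> h"
  have h'H: "h' \<in> gen {f, g}" unfolding h'_def F_def
    by (rule gen_comp[OF gen_funpow[OF gen_minv[OF S fH(1)]] h(1)])
  have h'T: "h' \<in> Th" using gen_Th[OF S h'H] .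
  define tt where "tt = h' \<circ> \<psi>2 \<circ> minv h'"
  have ttH: "tt \<in> gen {f, g}" unfolding tt_def
    by (intro gen_comp[OF gen_comp[OF h'H \<psi>2H] gen_minv[OF S h'H]])
  have tt_T0: "tt x = T0 x" if "\<mu> * p' \<le> x" for x
  proof -
    define y where "y = minv h0 (minv F x)"
    have "p' \<le> minv F x" using that Th_le_iff[OF FT, of p' "minv F x"] \<tau>_F FT by simp
    then have y: "M - \<eta> \<le> y" unfolding y_def by (rule pulled_back)
    have "h y = minv F x" using h(2) y h0T by (simp add: y_def)
    then have "h' y = x" using FT by (simp add: h'_def)
    then have m: "minv h' x = y" using minv_eq_iff[OF h'T] by simp
    have "\<psi>2 y = \<psi> y" "M - \<eta> \<le> \<psi> y" using \<psi>2_\<psi>[OF y] \<psi>_le[OF y] y by simp_all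
    then have "h' (\<psi>2 y) = F (h0 (\<psi> y))" using h(2) by (simp add: h'_def)
    then show ?thesis by (simp add: tt_def m T0_def t0_def y_def)
  qed
  define t where "t = tt ^^ r"
  have tH: "t \<in> gen {f, g}" unfolding t_def by (rule gen_funpow[OF ttH])
  have tT: "t \<in> Th" using gen_Th[OF S tH] .
  have pow: "(tt ^^ q) x = (T0 ^^ q) x \<and> x \<le> (T0 ^^ q) x" if "\<mu> * p' \<le> x" for q x
  proof (induction q)
    case (Suc q)
    then have "\<mu> * p' \<le> (T0 ^^ q) x" using that by simp
    then show ?case using Suc tt_T0 T0_le[of "(T0 ^^ q) x"] by simp
  qed simp
  have t_T: "t x = T x" "x \<le> T x" if "\<mu> * p' \<le> x" for x using pow[OF that] by (simp_all add: t_def T_def)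
  have lev_eq: "pow_conj t 1 \<phi> = pow_conj T 1 \<phi>" if \<phi>: "\<phi> \<in> Th" "\<And>x. x \<le> c \<or> c + L \<le> x \<Longrightarrow> \<phi> x = x" for \<phi>
  proof
    fix x
    show "pow_conj t 1 \<phi> x = pow_conj T 1 \<phi> x"
    proof (cases "\<mu> * p' \<le> minv t x")
      case True
      then have "T (minv t x) = x" using t_T(1)[OF True] tT by simp
      then have "minv T x = minv t x" using minv_eq_iff[OF TT] by simp
      moreover have "t (\<phi> (minv t x)) = T (\<phi> (minv t x))"
      proof (rule t_T(1))
        show "\<mu> * p' \<le> \<phi> (minv t x)"
        using Th_le_iff[OF \<phi>(1), of "\<mu> * p'" "minv t x"] \<phi>(2)[of "\<mu> * p'"] c0(2) True by simp
      qed
      ultimately show ?thesis by (simp add: pow_conj_def)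
    next
      case False
      then have "t (minv t x) < t (\<mu> * p')" using Th_less_iff[OF tT] by simp
      then have "x < T (\<mu> * p')" using t_T(1)[of "\<mu> * p'"] tT by simp
      then have "minv T x < \<mu> * p'" using Th_less_iff[OF TT, of "minv T x"] TT by simp
      then show ?thesis using False \<phi>(2) c0(2) tT TT by (simp add: pow_conj_def)
    qed
  qed
  have g_eq: "g = \<gamma> \<circ> (s1 \<circ> s0)" by (simp add: g_def s_def)
  have L_eq: "L = 1 / 2 ^ (nat a * m + n\<^sub>1)" by (simp add: L_def \<mu>d l_def power_add)
  have "gen {f, \<gamma> \<circ> (s1 \<circ> s0)} = Th"
  proof (rule perturbation_generates[OF f \<gamma> s1T s0T _ K lin\<delta> \<delta>(2) _ nofix surj c0(1) dy(1) c0(5) L_eq])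
    show "t \<in> gen {f, \<gamma> \<circ> (s1 \<circ> s0)}" using tH by (simp only: g_eq)
    show "(minv \<gamma> \<circ> f \<circ> \<gamma> \<circ> minv f) x = x" if "x \<le> \<delta>" for x
      using k1\<delta>[OF that] by (simp only: k1_def)
    show "c + L \<le> \<tau>" using c0(4) by simp
    show "K ^ 3 * \<tau> \<le> \<delta>" using KT th(3) by simp
    show "s1 x = x" if "x \<le> c \<or> \<tau> \<le> x" for x by (rule s1_out[OF that])
    show "s0 x = x" if "x \<le> K ^ 2 * (c + L / 2) \<or> K ^ 3 * (c + L / 4) \<le> x" for x
      using s0_out that by (simp only: b1_def b2_def X1_def X2_def)
    show "x < s0 x" if "K ^ 2 * (c + L / 2) < x" "x < K ^ 3 * (c + L / 4)" for x
      using s0_in that by (simp only: b1_def b2_def X1_def X2_def)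
    show "t x = x" if "\<tau> \<le> x" for x
    proof -
      have "\<mu> * p' \<le> x" using that c0 by linarith
      then show ?thesis using t_T(1) T_out[OF that] by simp
    qed
    show "c + L \<le> t c" using t_T(1)[of c] Tc c0(2) by simp
    show "s1 = affine_conj c L (vine_gen 1) \<circ> pow_conj t 1 (affine_conj c L (vine_gen 0))"
      using lev_eq[OF \<iota>T[OF vine_gen_Th] \<iota>_out[OF vine_gen_Th], of 0] by (simp add: s1_def \<iota>_def)
  qed
  then show ?thesis using gT by (auto simp: g_eq)
qed

section \<open>Cogenerators\<close>

lemma (in group) generate_inv_pair:
  assumes "x \<in> carrier G" "y \<in> carrier G"
  shows "generate G {x, inv y} = generate G {x, y}"
proof (rule antisym)
  have sub: "generate G {x, inv z} \<subseteq> generate G {x, z}" if "z \<in> carrier G" for z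
    by (rule generate_subgroup_incl[OF _ generate_is_subgroup])
      (use assms(1) that in \<open>auto intro: generate.incl generate.inv\<close>)
  show "generate G {x, inv y} \<subseteq> generate G {x, y}" using sub assms(2) by blast
  show "generate G {x, y} \<subseteq> generate G {x, inv y}" using sub[of "inv y"] assms(2) by simp
qed

lemma carrier_Z2: "carrier Z2 = UNIV"
  by (simp add: UNIV_Times_UNIV)

lemma inv_Z2: "inv\<^bsub>Z2\<^esub> (a, b) = (- a, - b)"
  by simp

text \<open>Used to see that certain coordinates of a generating pair are not zero.\<close>

lemma generate_Z2_combination:
  assumes "z \<in> generate Z2 {(a, b), (c, d)}"
  shows "\<exists>m n. fst z = m * a + n * c \<and> snd z = m * b + n * d"
  using assms
proof (induction rule: generate.induct)
  case one
  show ?case by (intro exI[of _ 0]) simp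
next
  case (incl h)
  then consider "h = (a, b)" | "h = (c, d)" by blast
  then show ?case
  proof cases
    case 1 then show ?thesis by (intro exI[of _ 1] exI[of _ 0]) simp
  next
    case 2 then show ?thesis by (intro exI[of _ 0] exI[of _ 1]) simp
  qed
next
  case (inv h)
  then consider "h = (a, b)" | "h = (c, d)" by blast
  then show ?case
  proof cases
    case 1 then show ?thesis by (intro exI[of _ "-1"] exI[of _ 0]) (simp add: inv_Z2)
  next
    case 2 then show ?thesis by (intro exI[of _ 0] exI[of _ "-1"]) (simp add: inv_Z2)
  qed
next
  case (eng h1 h2)
  then obtain m n m' n' where "fst h1 = m * a + n * c" "snd h1 = m * b + n * d"
    "fst h2 = m' * a + n' * c" "snd h2 = m' * b + n' * d" by blast
  then show ?case
    by (intro exI[of _ "m + m'"] exI[of _ "n + n'"]) (simp add: mult_DirProd' algebra_simps)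
qed

text \<open>The complementary pair \<open>(c, d)\<close> may be replaced by its negative. If \<open>f\<close> is the identity near \<open>1\<close>, then
  \<open>d\<close> is not zero, and it is chosen negative so that the partner moves points near \<open>1\<close> upwards.\<close>

lemma cogenerator_expanding_at_zero:
  assumes f: "f \<in> Th" and a: "1 \<le> fst (pi_ab f)" and y: "generate Z2 {pi_ab f, y} = UNIV"
  shows "\<exists>g\<in>Th. gen {f, g} = Th"
proof -
  define a b where "a = fst (pi_ab f)" and "b = snd (pi_ab f)"
  have ab: "pi_ab f = (a, b)" by (simp add: a_def b_def)
  have "\<exists>c d. generate Z2 {(a, b), (c, d)} = UNIV \<and> (b = 0 \<longrightarrow> d < 0)"
  proof -
    obtain c d where cd: "y = (c, d)" by (cases y)
    have gen_cd: "generate Z2 {(a, b), (c, d)} = UNIV" using y by (simp add: ab cd)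
    have "d \<noteq> 0" if "b = 0"
      using generate_Z2_combination[of "(0, 1)" a b c d] gen_cd that by auto
    moreover have "generate Z2 {(a, b), (- c, - d)} = UNIV"
      using group.generate_inv_pair[OF group_Z2, of "(a, b)" "(c, d)"] gen_cd by simp
    ultimately have "(b = 0 \<longrightarrow> d < 0) \<or>
        generate Z2 {(a, b), (- c, - d)} = UNIV \<and> (b = 0 \<longrightarrow> - d < 0)" by linarith
    then show ?thesis using gen_cd by blast
  qed
  then obtain c d where cd: "generate Z2 {(a, b), (c, d)} = UNIV" "b = 0 \<longrightarrow> d < 0" by blast
  obtain e where e: "0 < e" "e < 1" "\<And>x. 0 \<le> x \<Longrightarrow> x \<le> e \<Longrightarrow> f x = 2 powi a * x"
    "\<And>x. 1 - e \<le> x \<Longrightarrow> x \<le> 1 \<Longrightarrow> f x = 1 - 2 powi b * (1 - x)"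
    using Th_germs[OF f] unfolding ab by auto
  have top: "d < 0 \<or> (\<forall>x. 1 - e \<le> x \<and> x < 1 \<longrightarrow> f x \<noteq> x)"
  proof (cases "b = 0")
    case False
    have "f x \<noteq> x" if x: "1 - e \<le> x" "x < 1" for x
    proof
      assume "f x = x"
      then have "(1 - 2 powi b) * (1 - x) = 0"
        using e(4)[OF x(1) less_imp_le[OF x(2)]] by (simp add: algebra_simps)
      then have "2 powi b = (1::real)" using x(2) by simp
      then have "b = 0" using power_int_strict_increasing[of 0 b "2::real"] power_int_strict_increasing[of b 0 "2::real"]
        by (cases b "0::int" rule: linorder_cases) auto
      then show False using False by simp
    qed
    then show ?thesis by blast
  qed (use cd in simp)
  have a1: "1 \<le> a" using a by (simp add: a_def)
  obtain \<gamma> where \<gamma>: "\<gamma> \<in> Th" "pi_ab \<gamma> = (c, d)"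
    "\<And>x. 0 < x \<Longrightarrow> x < 1 \<Longrightarrow> f x \<noteq> x \<or> \<gamma> x \<noteq> x" "\<gamma> \<circ> f \<noteq> f \<circ> \<gamma>"
    by (rule exists_partner[OF f a1 e(1) _ top e(1), where c = c], rule e(3), assumption, assumption)
      (rule that; assumption)
  show ?thesis
    using partner_perturbed_generates[OF f \<gamma>(1,4) a1 e(1,3) \<gamma>(3)] cd(1) ab \<gamma>(2) by simp
qed

lemma cogenerator_nontrivial_at_zero:
  assumes f: "f \<in> Th" and a: "fst (pi_ab f) \<noteq> 0" and y: "generate Z2 {pi_ab f, y} = UNIV"
  shows "\<exists>g\<in>Th. gen {f, g} = Th"
proof (cases "1 \<le> fst (pi_ab f)")
  case True
  then show ?thesis using cogenerator_expanding_at_zero f y by blast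
next
  case False
  obtain a b c d where ab: "pi_ab f = (a, b)" and cd: "y = (c, d)" by (metis surj_pair)
  have inv: "pi_ab (minv f) = (- a, - b)" using pi_ab_minv[OF f] ab by simp
  have "generate Z2 {pi_ab (minv f), y} = generate Z2 {pi_ab f, y}"
    using group.generate_inv_pair[OF group_Z2, of "(c, d)" "(a, b)"] by (simp add: inv ab cd insert_commute)
  then obtain g where g: "g \<in> Th" "gen {minv f, g} = Th"
    using cogenerator_expanding_at_zero[OF Th_minv[OF f], of y] y False a ab inv by auto
  have "gen {minv f, g} = gen {f, g}"
    using Th_group.generate_inv_pair[of g f] f g(1) by (simp add: inv_Th_group insert_commute)
  then show ?thesis using g by auto
qed

text \<open>If \<open>f\<close> has slope \<open>1\<close> at \<open>0\<close>, its slope at \<open>1\<close> differs from \<open>1\<close>, and the flip exchanges the two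
  ends.\<close>

lemma cogenerator_on_line:
  assumes f: "f \<in> Th" and y: "generate Z2 {pi_ab f, y} = UNIV"
  shows "\<exists>g\<in>Th. gen {f, g} = Th"
proof (cases "fst (pi_ab f) = 0")
  case False
  then show ?thesis using cogenerator_nontrivial_at_zero f y by blast
next
  case True
  then obtain b c d where ab: "pi_ab f = (0, b)" and cd: "y = (c, d)" by (metis prod.collapse surj_pair)
  have "b \<noteq> 0"
  proof
    assume "b = 0"
    then have *: "\<exists>m n. fst z = m * 0 + n * c \<and> snd z = m * 0 + n * d" for z
      using generate_Z2_combination[of z 0 0 c d] y by (simp add: ab cd)
    obtain n where "1 = n * c" "0 = n * d" using *[of "(1, 0)"] by auto
    then have "d = 0" by auto
    then show False using *[of "(0, 1)"] by auto
  qed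
  have "prod.swap \<in> hom Z2 Z2" by (auto simp: hom_def)
  then have "group_hom Z2 Z2 prod.swap" using group_Z2 by (simp add: group_hom_def group_hom_axioms_def)
  then have "generate Z2 (prod.swap ` {(0, b), (c, d)}) = prod.swap ` generate Z2 {(0, b), (c, d)}"
    by (rule group_hom.generate_img) simp
  also have "\<dots> = UNIV" using y by (simp add: ab cd)
  finally have "generate Z2 {pi_ab (flip f), (d, c)} = UNIV" by (simp add: pi_ab_flip[OF f] ab)
  then obtain g where g: "g \<in> Th" "gen {flip f, g} = Th"
    using cogenerator_nontrivial_at_zero[OF flip_Th[OF f], of "(d, c)"] \<open>b \<noteq> 0\<close> by (auto simp: pi_ab_flip[OF f] ab)
  have "gen (flip ` {flip f, g}) = flip ` gen {flip f, g}"
    by (rule group_hom.generate_img[OF flip_hom]) (use flip_Th f g in simp)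
  then have "gen {f, flip g} = Th" using g(2) flip_image_Th by simp
  then show ?thesis using flip_Th[OF g(1)] by blast
qed

theorem theorem1:
  fixes f :: "real \<Rightarrow> real"
  assumes "f \<in> carrier thompson_F"
    and "\<exists>y\<in>carrier Z2. generate Z2 {pi_ab f, y} = carrier Z2"
  shows "\<exists>g\<in>carrier thompson_F. generate thompson_F {f, g} = carrier thompson_F"
proof -
  let ?r = "\<lambda>\<phi>. restrict \<phi> {0..1} :: real \<Rightarrow> real"
  obtain y where y: "generate Z2 {pi_ab f, y} = UNIV" using assms(2) carrier_Z2 by auto
  have f: "extend f \<in> Th" using extend_Th[OF assms(1)] .
  have "pi_ab (extend f) = pi_ab f" using pi_ab_restrict[OF f] restrict_extend[OF assms(1)] by simp
  then have "generate Z2 {pi_ab (extend f), y} = UNIV" using y by simp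
  from cogenerator_on_line[OF f this] obtain g where g: "g \<in> Th" "gen {extend f, g} = Th" by (elim bexE)
  have "generate thompson_F (?r ` {extend f, g}) = ?r ` gen {extend f, g}"
    by (rule group_hom.generate_img[OF restrict_hom]) (use f g in simp)
  then have "generate thompson_F {f, ?r g} = carrier thompson_F"
    using g(2) Th_image_restrict restrict_extend[OF assms(1)] by simp
  then show ?thesis using Th_restrict[OF g(1)] by blast
qed

end
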